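(* Fix $D\ge3$. For all integers $k\geq1$ and $\delta\geq0$, the core decomposition $G\mapsto(\hat G;(G_\circ,G_\bullet,G_{e_1},\dots,G_{e_{\ell-1}}))$ is a bijection between (i) rooted colored graphs with $2k$ vertices and degree $\delta$, and (ii) pairs $(G';(G_0,G_1,\dots,G_{(D+1)p}))$ where $G'$ is a melon-free rooted colored graph with $2p$ vertices and degree $\delta$, and for each $i=0,1,\dots,(D+1)p$, $G_i$ is a possibly empty open melonic graph with $2q_i$ vertices, such that $2p+\sum_{i=0}^{(D+1)p}2q_i=2k$.
   Context: A colored graph is a finite connected bipartite multigraph (black/white vertices, multiple edges allowed) with edges colored in $\{0,\dots,D\}$, every vertex incident to exactly one edge of each color. A rooted colored graph has a distinguished root edge. Faces of color $(c,c')$, $c<c'$, are the cycles formed by edges of colors $c,c'$; with $F$ faces in total and $2k$ vertices, the degree is $\frac12D(D-1)k+D-F$. Each edge consists of two half-edges. An open colored graph is a connected bipartite structure of the same kind in which exactly two half-edges (of the same color, one at a white and one at a black vertex) are unmatched; $\mathrm{cl}(H)$ is the rooted colored graph obtained by joining them into the root edge, and $\mathrm{op}(G)$ is obtained from a rooted colored graph $G$ by cutting its root edge into two unmatched half-edges. $\Delta$ is the rooted colored graph with two vertices joined by $D+1$ parallel edges. A melon is $\mathrm{op}(\Delta)$. Inserting a melon at an edge $e$ means cutting $e$ into its two half-edges and joining them to the two unmatched half-edges of a melon so that the result is bipartite. A rooted colored graph is melonic if it can be obtained from $\Delta$ by a sequence of melon insertions (this is equivalent to the paper's inductive definition via cut-sets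 and prime melonic graphs); an open colored graph $H$ is melonic if $\mathrm{cl}(H)$ is; the empty open graph is allowed as a possibly empty open melonic graph. A melon in a rooted colored graph $G$ (proper sub-melon) is a pair of vertices with $D$ parallel edges between them none of which is the root edge; $G$ is melon-free if it has none; the empty graph is melon-free. An open subgraph of an open colored graph $G$ is a connected open colored graph $H$ whose vertices and edges are vertices and edges of $G$, every vertex of $H$ having all its $D+1$ half-edges in $H$, whose two unmatched half-edges are halves of edges of $G$ (or unmatched half-edges of $G$) not in $H$. Two open subgraphs are totally disjoint if their edge sets are disjoint and their unmatched half-edges belong to different edges of $G$. A maximal melonic subgraph of $G$ is an open melonic subgraph maximal for inclusion; the maximal melonic subgraphs of $G$ are pairwise totally disjoint. The core $\hat G$ of a rooted colored graph $G$ is obtained from $\mathrm{op}(G)$ by deleting every maximal melonic subgraph $H$ and joining the two remaining halves of the edges to which $H$ was attached into one edge (if one unmatched half-edge of $H$ is an unmatched half-edge of $\mathrm{op}(G)$, the other remaining half becomes unmatched instead), then closing into a rooted graph; it is empty if $\mathrm{op}(G)$ is itself melonic. For each non-root edge $e$ of $\hat G$, $G_e$ is the maximal melonic subgraph deleted at the place of $e$ (empty if $e$ is an edge of $G$ contained in no melonic subgraph); $G_\circ$ (resp. $G_\bullet$) is the maximal melonic subgraph whose white (resp. black) unmatched half-edge is the white (resp. black) unmatched half-edge of $\mathrm{op}(G)$, or empty if there is none. With $e_1,\dots,e_{\ell-1}$ a canonical list of the non-root edges of $\hat G$, the core decomposition of $G$ is $(\hat G;(G_\circ,G_\bullet,G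_{e_1},\dots,G_{e_{\ell-1}}))$.
   Formalization: Graphs are taken up to isomorphism; in (ii) each nonempty G_i must have unmatched half-edges of the colour of the edge where it is inserted (the root colour for G_0, G_1; arbitrary if G' is empty), without which the map is not onto, and the empty graph has degree 0. *)

theory Defs
  imports Main
begin

text \<open>
  White and black vertices are named independently by natural numbers: the white vertex \<open>3\<close> and
  the black vertex \<open>3\<close> are different vertices.  An edge is a triple
  (white end, colour, black end).  Since a vertex has exactly one half-edge of each colour, the
  half-edges at a vertex are the pairs (vertex, colour) with colour in \<open>{..D}\<close>, and two
  parallel edges always differ in their colour, so a set of triples can represent multiple edges.
\<close>

type_synonym edge = "nat \<times> nat \<times> nat"

record cgraph =
  white :: "nat set"
  black :: "nat set"
  edges :: "edge set"

type_synonym rgraph = "cgraph \<times> edge"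

definition colour :: "edge \<Rightarrow> nat" where
  "colour e = fst (snd e)"

definition vertices :: "cgraph \<Rightarrow> (nat + nat) set" where
  "vertices G = white G <+> black G"

definition adj :: "edge set \<Rightarrow> (nat + nat) rel" where
  "adj E = {(Inl w, Inr b) | w b. \<exists>c. (w, c, b) \<in> E} \<union> {(Inr b, Inl w) | w b. \<exists>c. (w, c, b) \<in> E}"

definition connected_graph :: "cgraph \<Rightarrow> bool" where
  "connected_graph G \<longleftrightarrow> (\<forall>u \<in> vertices G. \<forall>v \<in> vertices G. (u, v) \<in> (adj (edges G))\<^sup>*)"

text \<open>Connected structures in which every half-edge belongs to at most one edge.\<close>

definition partial_graph :: "nat \<Rightarrow> cgraph \<Rightarrow> bool" where
  "partial_graph D G \<longleftrightarrow>
     finite (white G) \<and> finite (black G) \<and>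
     edges G \<subseteq> white G \<times> {..D} \<times> black G \<and>
     (\<forall>w c b b'. (w, c, b) \<in> edges G \<longrightarrow> (w, c, b') \<in> edges G \<longrightarrow> b = b') \<and>
     (\<forall>w w' c b. (w, c, b) \<in> edges G \<longrightarrow> (w', c, b) \<in> edges G \<longrightarrow> w = w') \<and>
     connected_graph G"

text \<open>The unmatched half-edges.\<close>

definition free_white :: "nat \<Rightarrow> cgraph \<Rightarrow> (nat \<times> nat) set" where
  "free_white D G = {(w, c). w \<in> white G \<and> c \<le> D \<and> (\<forall>b. (w, c, b) \<notin> edges G)}"

definition free_black :: "nat \<Rightarrow> cgraph \<Rightarrow> (nat \<times> nat) set" where
  "free_black D G = {(b, c). b \<in> black G \<and> c \<le> D \<and> (\<forall>w. (w, c, b) \<notin> edges G)}"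

definition coloured_graph :: "nat \<Rightarrow> cgraph \<Rightarrow> bool" where
  "coloured_graph D G \<longleftrightarrow> partial_graph D G \<and> free_white D G = {} \<and> free_black D G = {}"

definition rooted_graph :: "nat \<Rightarrow> rgraph \<Rightarrow> bool" where
  "rooted_graph D R \<longleftrightarrow> coloured_graph D (fst R) \<and> snd R \<in> edges (fst R)"

definition open_graph :: "nat \<Rightarrow> cgraph \<Rightarrow> bool" where
  "open_graph D H \<longleftrightarrow> partial_graph D H \<and>
     (\<exists>w c b. free_white D H = {(w, c)} \<and> free_black D H = {(b, c)})"

definition empty_graph :: cgraph where
  "empty_graph = \<lparr>white = {}, black = {}, edges = {}\<rparr>"

text \<open>The common colour of the two unmatched half-edges.\<close>

definition open_colour :: "nat \<Rightarrow> cgraph \<Rightarrow> nat" where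
  "open_colour D H = snd (the_elem (free_white D H))"

definition cl_graph :: "nat \<Rightarrow> cgraph \<Rightarrow> rgraph" where
  "cl_graph D H =
     (let (w, c) = the_elem (free_white D H); b = fst (the_elem (free_black D H))
      in (H\<lparr>edges := insert (w, c, b) (edges H)\<rparr>, (w, c, b)))"

definition op_graph :: "rgraph \<Rightarrow> cgraph" where
  "op_graph R = (fst R)\<lparr>edges := edges (fst R) - {snd R}\<rparr>"


subsection \<open>Faces and degree\<close>

text \<open>
  The edges of two colours form a disjoint union of cycles; a face is represented by the two
  colours and the vertex set of its cycle.
\<close>

definition faces :: "nat \<Rightarrow> cgraph \<Rightarrow> (nat \<times> nat \<times> (nat + nat) set) set" where
  "faces D G = {(c, c', X). c < c' \<and> c' \<le> D \<and>
     X \<in> vertices G // (adj {e \<in> edges G. colour e = c \<or> colour e = c'})\<^sup>*}"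

text \<open>\<open>D * (D - 1)\<close> is even, so the division is exact.\<close>

definition degree :: "nat \<Rightarrow> cgraph \<Rightarrow> int" where
  "degree D G = int (D * (D - 1) div 2) * int (card (vertices G) div 2) + int D
     - int (card (faces D G))"

text \<open>
  \<open>None\<close> is the empty rooted graph.  It is the closure of the empty open graph, i.e. an edge
  closed on itself, with no vertex and with one face for each of the \<open>D\<close> pairs of colours
  containing the colour of that edge; hence its degree is \<open>0 + D - D = 0\<close>.
\<close>

definition degree_opt :: "nat \<Rightarrow> rgraph option \<Rightarrow> int" where
  "degree_opt D Q = (case Q of None \<Rightarrow> 0 | Some R \<Rightarrow> degree D (fst R))"

definition size_opt :: "rgraph option \<Rightarrow> nat" where
  "size_opt Q = (case Q of None \<Rightarrow> 0 | Some R \<Rightarrow> card (vertices (fst R)))"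


subsection \<open>Melonic graphs\<close>

definition Delta :: "nat \<Rightarrow> nat \<Rightarrow> nat \<Rightarrow> nat \<Rightarrow> rgraph" where
  "Delta D r w b = (\<lparr>white = {w}, black = {b}, edges = {(w, c, b) | c. c \<le> D}\<rparr>, (w, r, b))"

definition insert_melon :: "nat \<Rightarrow> nat \<Rightarrow> nat \<Rightarrow> edge \<Rightarrow> cgraph \<Rightarrow> cgraph" where
  "insert_melon D w' b' e G = (case e of (w, c, b) \<Rightarrow>
     \<lparr>white = insert w' (white G), black = insert b' (black G),
      edges = (edges G - {(w, c, b)}) \<union> edges (op_graph (Delta D c w' b'))
                \<union> {(w, c, b'), (w', c, b)}\<rparr>)"

text \<open>
  The names of the vertices of \<open>\<Delta>\<close> and of the inserted melons are arbitrary.  When the melon is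
  inserted at the root edge, either of the two edges joining the melon to the rest may become
  the root edge.
\<close>

inductive melonic :: "nat \<Rightarrow> rgraph \<Rightarrow> bool" for D :: nat where
  Delta: "r \<le> D \<Longrightarrow> melonic D (Delta D r w b)"
| insert_nonroot: "melonic D (G, e\<^sub>0) \<Longrightarrow> e \<in> edges G \<Longrightarrow> e \<noteq> e\<^sub>0 \<Longrightarrow>
    w' \<notin> white G \<Longrightarrow> b' \<notin> black G \<Longrightarrow> melonic D (insert_melon D w' b' e G, e\<^sub>0)"
| insert_root: "melonic D (G, (w, c, b)) \<Longrightarrow> w' \<notin> white G \<Longrightarrow> b' \<notin> black G \<Longrightarrow>
    e = (w, c, b') \<or> e = (w', c, b) \<Longrightarrow> melonic D (insert_melon D w' b' (w, c, b) G, e)"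

definition open_melonic :: "nat \<Rightarrow> cgraph \<Rightarrow> bool" where
  "open_melonic D H \<longleftrightarrow> open_graph D H \<and> melonic D (cl_graph D H)"

definition possibly_empty_open_melonic :: "nat \<Rightarrow> cgraph \<Rightarrow> bool" where
  "possibly_empty_open_melonic D H \<longleftrightarrow> H = empty_graph \<or> open_melonic D H"

text \<open>A melon is given by its white vertex, its black vertex and its \<open>D\<close> edges.\<close>

definition is_melon_in :: "nat \<Rightarrow> rgraph \<Rightarrow> nat \<Rightarrow> nat \<Rightarrow> edge set \<Rightarrow> bool" where
  "is_melon_in D R w b S \<longleftrightarrow> w \<in> white (fst R) \<and> b \<in> black (fst R) \<and>
     S \<subseteq> edges (fst R) - {snd R} \<and> card S = D \<and> (\<forall>(x, c, y) \<in> S. x = w \<and> y = b)"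

definition melon_free :: "nat \<Rightarrow> rgraph option \<Rightarrow> bool" where
  "melon_free D Q = (case Q of None \<Rightarrow> True | Some R \<Rightarrow> (\<nexists>w b S. is_melon_in D R w b S))"


subsection \<open>The core decomposition\<close>

definition subgraph :: "cgraph \<Rightarrow> cgraph \<Rightarrow> bool" where
  "subgraph H G \<longleftrightarrow> white H \<subseteq> white G \<and> black H \<subseteq> black G \<and> edges H \<subseteq> edges G"

text \<open>
  The half-edges of \<open>H\<close> are all pairs of a vertex of \<open>H\<close> and a colour.  An unmatched one is
  in no edge of \<open>H\<close>, so in \<open>G\<close> it is either unmatched or half of an edge that is not in \<open>H\<close>.
\<close>

definition open_subgraph :: "nat \<Rightarrow> cgraph \<Rightarrow> cgraph \<Rightarrow> bool" where
  "open_subgraph D H G \<longleftrightarrow> open_graph D H \<and> subgraph H G"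

definition maximal_melonic_subgraph :: "nat \<Rightarrow> cgraph \<Rightarrow> cgraph \<Rightarrow> bool" where
  "maximal_melonic_subgraph D H G \<longleftrightarrow>
     open_subgraph D H G \<and> open_melonic D H \<and>
     (\<forall>H'. open_subgraph D H' G \<longrightarrow> open_melonic D H' \<longrightarrow> subgraph H H' \<longrightarrow> H' = H)"

text \<open>
  \<open>H\<close> is attached to two edges of \<open>G\<close> whose other halves are the white half-edge \<open>(w, c)\<close> and
  the black half-edge \<open>(b, c)\<close>: removing \<open>H\<close> and joining these halves creates the edge
  \<open>(w, c, b)\<close>.
\<close>

definition at_place :: "nat \<Rightarrow> cgraph \<Rightarrow> edge \<Rightarrow> cgraph \<Rightarrow> bool" where
  "at_place D G e H = (case e of (w, c, b) \<Rightarrow>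
     \<exists>w' b'. free_white D H = {(w', c)} \<and> free_black D H = {(b', c)} \<and>
       (w, c, b') \<in> edges G \<and> (w', c, b) \<in> edges G)"

text \<open>
  No edge is created for a subgraph one of whose unmatched half-edges is unmatched in \<open>G\<close>; the
  other half of the edge to which it was attached is then unmatched in \<open>open_core D G\<close>.
\<close>

definition open_core :: "nat \<Rightarrow> cgraph \<Rightarrow> cgraph" where
  "open_core D G =
     (let M = {H. maximal_melonic_subgraph D H G};
          W = white G - (\<Union>H \<in> M. white H);
          B = black G - (\<Union>H \<in> M. black H)
      in \<lparr>white = W, black = B,
          edges = {(w, c, b) \<in> edges G. w \<in> W \<and> b \<in> B} \<union> {e. \<exists>H \<in> M. at_place D G e H}\<rparr>)"

definition core :: "nat \<Rightarrow> rgraph \<Rightarrow> rgraph option" where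
  "core D R = (if open_melonic D (op_graph R) then None
     else Some (cl_graph D (open_core D (op_graph R))))"

text \<open>The maximal melonic subgraph satisfying \<open>P\<close>, empty if there is none.\<close>

definition piece :: "nat \<Rightarrow> cgraph \<Rightarrow> (cgraph \<Rightarrow> bool) \<Rightarrow> cgraph" where
  "piece D G P = (if \<exists>H. maximal_melonic_subgraph D H G \<and> P H
     then THE H. maximal_melonic_subgraph D H G \<and> P H else empty_graph)"

text \<open>
  The argument \<open>L\<close> lists the non-root edges of each rooted graph.  When the core is empty, the
  only component is \<open>op_graph R\<close>.
\<close>

definition core_decomposition ::
  "nat \<Rightarrow> (rgraph \<Rightarrow> edge list) \<Rightarrow> rgraph \<Rightarrow> rgraph option \<times> cgraph list" where
  "core_decomposition D L R = (let G = op_graph R in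
     case core D R of
       None \<Rightarrow> (None, [G])
     | Some C \<Rightarrow> (Some C,
         piece D G (\<lambda>H. free_white D H = free_white D G) #
         piece D G (\<lambda>H. free_black D H = free_black D G) #
         map (\<lambda>e. piece D G (at_place D G e)) (L C)))"


subsection \<open>Isomorphism\<close>

definition map_edge :: "(nat \<Rightarrow> nat) \<Rightarrow> (nat \<Rightarrow> nat) \<Rightarrow> edge \<Rightarrow> edge" where
  "map_edge f g e = (case e of (w, c, b) \<Rightarrow> (f w, c, g b))"

definition is_iso :: "(nat \<Rightarrow> nat) \<Rightarrow> (nat \<Rightarrow> nat) \<Rightarrow> cgraph \<Rightarrow> cgraph \<Rightarrow> bool" where
  "is_iso f g G G' \<longleftrightarrow> bij_betw f (white G) (white G') \<and> bij_betw g (black G) (black G') \<and>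
     edges G' = map_edge f g ` edges G"

definition is_rooted_iso :: "(nat \<Rightarrow> nat) \<Rightarrow> (nat \<Rightarrow> nat) \<Rightarrow> rgraph \<Rightarrow> rgraph \<Rightarrow> bool" where
  "is_rooted_iso f g R R' \<longleftrightarrow> is_iso f g (fst R) (fst R') \<and> snd R' = map_edge f g (snd R)"

definition rooted_iso :: "nat \<Rightarrow> rgraph rel" where
  "rooted_iso D = {(R, R'). rooted_graph D R \<and> rooted_graph D R' \<and> (\<exists>f g. is_rooted_iso f g R R')}"

definition open_iso :: "nat \<Rightarrow> cgraph rel" where
  "open_iso D = {(H, H'). (H = empty_graph \<or> open_graph D H) \<and> (H' = empty_graph \<or> open_graph D H') \<and>
     (\<exists>f g. is_iso f g H H')}"

text \<open>Canonical: the list depends only on the rooted graph up to isomorphism.\<close>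

definition canonical_listing :: "nat \<Rightarrow> (rgraph \<Rightarrow> edge list) \<Rightarrow> bool" where
  "canonical_listing D L \<longleftrightarrow>
     (\<forall>R. rooted_graph D R \<longrightarrow> distinct (L R) \<and> set (L R) = edges (fst R) - {snd R}) \<and>
     (\<forall>R R' f g. rooted_graph D R \<longrightarrow> rooted_graph D R' \<longrightarrow> is_rooted_iso f g R R' \<longrightarrow>
        L R' = map (map_edge f g) (L R))"

definition pair_class ::
  "nat \<Rightarrow> rgraph option \<times> cgraph list \<Rightarrow> rgraph set option \<times> cgraph set list" where
  "pair_class D = map_prod (map_option (\<lambda>R. rooted_iso D `` {R})) (map (\<lambda>H. open_iso D `` {H}))"

definition rooted_graphs :: "nat \<Rightarrow> nat \<Rightarrow> nat \<Rightarrow> rgraph set" where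
  "rooted_graphs D k \<delta> = {R. rooted_graph D R \<and> card (vertices (fst R)) = 2 * k \<and>
     degree D (fst R) = int \<delta>}"

text \<open>
  The \<open>i\<close>-th open graph has to fit at its place: its unmatched half-edges have the colour of the
  edge at which it is inserted, which is the root edge for the first two.
\<close>

definition colours_fit :: "nat \<Rightarrow> (rgraph \<Rightarrow> edge list) \<Rightarrow> rgraph option \<Rightarrow> cgraph list \<Rightarrow> bool" where
  "colours_fit D L Q Hs = (case Q of None \<Rightarrow> True | Some R \<Rightarrow>
     list_all2 (\<lambda>e H. H = empty_graph \<or> open_colour D H = colour e) (snd R # snd R # L R) Hs)"

definition core_pairs ::
  "nat \<Rightarrow> (rgraph \<Rightarrow> edge list) \<Rightarrow> nat \<Rightarrow> nat \<Rightarrow> (rgraph option \<times> cgraph list) set" where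
  "core_pairs D L k \<delta> = {(Q, Hs). \<exists>p.
     (\<forall>R. Q = Some R \<longrightarrow> rooted_graph D R) \<and> melon_free D Q \<and>
     size_opt Q = 2 * p \<and> degree_opt D Q = int \<delta> \<and>
     length Hs = (D + 1) * p + 1 \<and>
     (\<forall>H \<in> set Hs. possibly_empty_open_melonic D H) \<and> colours_fit D L Q Hs \<and>
     2 * p + (\<Sum>H \<leftarrow> Hs. card (vertices H)) = 2 * k}"


subsection \<open>Canonical listings exist\<close>

lemma is_iso_comp:
  assumes "is_rooted_iso f g R R'" "is_rooted_iso f' g' R' R''"
  shows "is_rooted_iso (f' \<circ> f) (g' \<circ> g) R R''"
proof -
  have m: "map_edge f' g' (map_edge f g e) = map_edge (f' \<circ> f) (g' \<circ> g) e" for e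
    by (simp add: map_edge_def split: prod.splits)
  show ?thesis
    using assms by (auto simp: is_rooted_iso_def is_iso_def m image_image intro: bij_betw_trans)
qed

lemma is_iso_inverse:
  assumes R: "rooted_graph D R" and i: "is_rooted_iso f g R R'"
  shows "is_rooted_iso (inv_into (white (fst R)) f) (inv_into (black (fst R)) g) R' R"
proof -
  let ?f = "inv_into (white (fst R)) f" and ?g = "inv_into (black (fst R)) g"
  have b: "bij_betw f (white (fst R)) (white (fst R'))" "bij_betw g (black (fst R)) (black (fst R'))"
    using i by (auto simp: is_rooted_iso_def is_iso_def)
  have m: "map_edge ?f ?g (map_edge f g e) = e" if "e \<in> edges (fst R)" for e
    using that R b
    by (cases e) (auto simp: map_edge_def rooted_graph_def coloured_graph_def partial_graph_def
        bij_betw_def inv_into_f_f)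
  have "map_edge ?f ?g ` map_edge f g ` edges (fst R) = edges (fst R)"
    using m by (force simp: image_image)
  moreover have "snd R \<in> edges (fst R)" using R by (simp add: rooted_graph_def)
  ultimately show ?thesis
    using i b m by (auto simp: is_rooted_iso_def is_iso_def bij_betw_inv_into)
qed

lemma rooted_rigid:
  assumes R: "rooted_graph D R" and R': "rooted_graph D R'"
    and i: "is_rooted_iso f g R R'" and j: "is_rooted_iso f' g' R R'"
    and e: "e \<in> edges (fst R)"
  shows "map_edge f g e = map_edge f' g' e"
proof -
  define P where "P v = (case v of Inl w \<Rightarrow> f w = f' w | Inr b \<Rightarrow> g b = g' b)" for v
  have im: "map_edge f g x \<in> edges (fst R')" "map_edge f' g' x \<in> edges (fst R')"
    if "x \<in> edges (fst R)" for x
    using that i j by (auto simp: is_rooted_iso_def is_iso_def)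
  have u: "\<And>w c b b'. (w, c, b) \<in> edges (fst R') \<Longrightarrow> (w, c, b') \<in> edges (fst R') \<Longrightarrow> b = b'"
    "\<And>w w' c b. (w, c, b) \<in> edges (fst R') \<Longrightarrow> (w', c, b) \<in> edges (fst R') \<Longrightarrow> w = w'"
    using R' unfolding rooted_graph_def coloured_graph_def partial_graph_def by blast+
  have step: "P v" if "P u" "(u, v) \<in> adj (edges (fst R))" for u v
    using that(2) unfolding adj_def
  proof (elim UnE CollectE exE conjE)
    fix w b c assume uv: "(u, v) = (Inl w, Inr b)" and x: "(w, c, b) \<in> edges (fst R)"
    then have "f w = f' w" using that(1) by (simp add: P_def)
    then show "P v" using uv u(1) im[OF x] by (auto simp: P_def map_edge_def)
  next
    fix w b c assume uv: "(u, v) = (Inr b, Inl w)" and x: "(w, c, b) \<in> edges (fst R)"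
    then have "g b = g' b" using that(1) by (simp add: P_def)
    then show "P v" using uv u(2) im[OF x] by (auto simp: P_def map_edge_def)
  qed
  obtain w c b where r: "snd R = (w, c, b)" by (cases "snd R")
  have rE: "(w, c, b) \<in> edges (fst R)" using R r by (simp add: rooted_graph_def)
  have sub: "edges (fst R) \<subseteq> white (fst R) \<times> {..D} \<times> black (fst R)"
    and con: "connected_graph (fst R)"
    using R by (auto simp: rooted_graph_def coloured_graph_def partial_graph_def)
  have "P (Inl w)" using i j r by (auto simp: P_def is_rooted_iso_def map_edge_def)
  moreover have "(Inl w, v) \<in> (adj (edges (fst R)))\<^sup>*" if "v \<in> vertices (fst R)" for v
    using con that rE sub by (force simp: connected_graph_def vertices_def)
  ultimately have all: "P v" if "v \<in> vertices (fst R)" for v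
  proof -
    have "P (Inl w) \<Longrightarrow> P v" if "(Inl w, v) \<in> (adj (edges (fst R)))\<^sup>*" for v
      using that by (induction rule: rtrancl_induct) (auto intro: step)
    then show ?thesis
      using that \<open>P (Inl w)\<close> \<open>\<And>v. v \<in> vertices (fst R) \<Longrightarrow> (Inl w, v) \<in> (adj (edges (fst R)))\<^sup>*\<close>
      by blast
  qed
  obtain x d y where e': "e = (x, d, y)" by (cases e)
  have "P (Inl x)" "P (Inr y)"
    using e e' sub by (auto intro!: all simp: vertices_def)
  then show ?thesis by (simp add: e' map_edge_def P_def)
qed

lemma canonical_listing_exists: "\<exists>L. canonical_listing D L"
proof -
  define rep where "rep R = (SOME S. (S, R) \<in> rooted_iso D)" for R
  define l where "l S = (SOME xs. distinct xs \<and> set xs = edges (fst S) - {snd S})" for S :: rgraph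
  define h where "h R = (SOME (f, g). is_rooted_iso f g (rep R) R)" for R
  define L where "L R = map (map_edge (fst (h R)) (snd (h R))) (l (rep R))" for R
  have l: "distinct (l S) \<and> set (l S) = edges (fst S) - {snd S}" if "rooted_graph D S" for S
  proof -
    have "edges (fst S) \<subseteq> white (fst S) \<times> {..D} \<times> black (fst S)"
      "finite (white (fst S) \<times> {..D} \<times> black (fst S))"
      using that by (auto simp: rooted_graph_def coloured_graph_def partial_graph_def)
    then have "finite (edges (fst S) - {snd S})" by (meson finite_Diff finite_subset)
    then have "\<exists>xs. distinct xs \<and> set xs = edges (fst S) - {snd S}"
      using finite_distinct_list by metis
    then show ?thesis unfolding l_def by (rule someI_ex)
  qed
  have refl: "(R, R) \<in> rooted_iso D" if "rooted_graph D R" for R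
  proof -
    have "is_rooted_iso id id R R"
      by (auto simp: is_rooted_iso_def is_iso_def map_edge_def bij_betw_id)
    then show ?thesis using that by (auto simp: rooted_iso_def)
  qed
  have rep: "(rep R, R) \<in> rooted_iso D" if "rooted_graph D R" for R
    unfolding rep_def using refl[OF that] by (rule someI)
  have h: "is_rooted_iso (fst (h R)) (snd (h R)) (rep R) R" if "rooted_graph D R" for R
  proof -
    have "\<exists>p. case p of (f, g) \<Rightarrow> is_rooted_iso f g (rep R) R"
      using rep[OF that] by (auto simp: rooted_iso_def)
    then have "case h R of (f, g) \<Rightarrow> is_rooted_iso f g (rep R) R"
      unfolding h_def by (rule someI_ex)
    then show ?thesis by (simp add: case_prod_beta)
  qed
  have rep_g: "rooted_graph D (rep R)" if "rooted_graph D R" for R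
    using rep[OF that] by (auto simp: rooted_iso_def)
  have 1: "distinct (L R) \<and> set (L R) = edges (fst R) - {snd R}" if R: "rooted_graph D R" for R
  proof -
    let ?m = "map_edge (fst (h R)) (snd (h R))" and ?S = "rep R"
    have sub: "edges (fst ?S) \<subseteq> white (fst ?S) \<times> {..D} \<times> black (fst ?S)"
      using rep_g[OF R] by (auto simp: rooted_graph_def coloured_graph_def partial_graph_def)
    have b: "inj_on (fst (h R)) (white (fst ?S))" "inj_on (snd (h R)) (black (fst ?S))"
      using h[OF R] by (auto simp: is_rooted_iso_def is_iso_def bij_betw_def)
    have inj: "inj_on ?m (edges (fst ?S))"
    proof (rule inj_onI)
      fix x y assume "x \<in> edges (fst ?S)" "y \<in> edges (fst ?S)" "?m x = ?m y"
      then show "x = y"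
        using sub b by (cases x; cases y) (auto simp: map_edge_def dest!: inj_onD)
    qed
    have ls: "distinct (l ?S)" "set (l ?S) = edges (fst ?S) - {snd ?S}"
      using l[OF rep_g[OF R]] by auto
    have "inj_on ?m (set (l ?S))"
      using inj ls(2) by (auto intro: inj_on_subset)
    then have "distinct (L R)" by (simp add: L_def distinct_map ls(1))
    moreover have "?m ` (edges (fst ?S) - {snd ?S}) = ?m ` edges (fst ?S) - ?m ` {snd ?S}"
      using rep_g[OF R] by (intro inj_on_image_set_diff[OF inj]) (auto simp: rooted_graph_def)
    then have "set (L R) = edges (fst R) - {snd R}"
      using h[OF R] by (simp add: L_def ls(2) is_rooted_iso_def is_iso_def)
    ultimately show ?thesis by simp
  qed
  have 2: "L R' = map (map_edge f g) (L R)"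
    if R: "rooted_graph D R" and R': "rooted_graph D R'" and i: "is_rooted_iso f g R R'" for R R' f g
  proof -
    have "(S, R) \<in> rooted_iso D \<longleftrightarrow> (S, R') \<in> rooted_iso D" for S
      using R R' i is_iso_inverse[OF R i] unfolding rooted_iso_def
      by (blast intro: is_iso_comp)
    then have same: "rep R' = rep R" by (simp add: rep_def)
    have j: "is_rooted_iso (f \<circ> fst (h R)) (g \<circ> snd (h R)) (rep R) R'"
      using h[OF R] i by (rule is_iso_comp)
    have j': "is_rooted_iso (fst (h R')) (snd (h R')) (rep R) R'"
      using h[OF R'] same by simp
    have "map_edge (fst (h R')) (snd (h R')) x = map_edge f g (map_edge (fst (h R)) (snd (h R)) x)"
      if "x \<in> set (l (rep R))" for x
    proof -
      have "x \<in> edges (fst (rep R))" using that l[OF rep_g[OF R]] by auto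
      from rooted_rigid[OF rep_g[OF R] R' j' j this] show ?thesis
        by (simp add: map_edge_def split: prod.splits)
    qed
    then show ?thesis by (simp add: L_def same)
  qed
  show ?thesis
    unfolding canonical_listing_def using 1 2 by blast
qed

end

theory Submission
  imports Defs "HOL-Library.Nat_Bijection"
begin

text \<open>
  Close an open graph by two additional vertices of degree one at its unmatched half-edges.  Then a
  melonic graph is obtained from a single edge by inserting melons at arbitrary edges, without an
  exception for the root, and every graph is obtained from a melon-free one by replacing each edge by
  such a blow-up of a single edge: contract melons as long as there are any.  This replacement
  is unique: an open melonic subgraph \<open>K\<close> contains a melon, which must lie inside one of the
  blow-ups because the core has no melon and because a blow-up is attached to the rest by only two
  edges.  Contracting this melon yields a blow-up again (two melons are disjoint as \<open>D \<ge> 2\<close>), so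
  by induction \<open>K\<close> lies in a single blow-up.  Hence the maximal melonic subgraphs are exactly the
  nontrivial blow-ups, which determines the core decomposition.  Inserting a melon preserves the
  degree since it creates \<open>D * (D - 1) / 2\<close> new faces.
\<close>

subsection \<open>Edge sets with a border\<close>

text \<open>The border removes the special role of the root. Once the root edge is cut and both
  halves end in extra vertices, the two choices of a new root after an insertion at the root become
  insertions at two different edges. An open subgraph needs no extra vertices of its own: bordered
  by the outer ends of its two unmatched half-edges, it is a literal subset of the edge set of the
  whole graph, and of the same kind as the cut graph. So one format serves the cut graph, its core,
  the components and arbitrary open melonic subgraphs, and containment between them is plain
  inclusion. A place \<open>e\<close> of the core is the border of the component that replaces it,
  and an empty component is \<open>{e}\<close>, so empty and nonempty components need not be
  distinguished while melons are contracted and inserted. The price is the translation between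
  rooted graphs and bordered sets. Its one substantial point is that cutting the root edge keeps the
  graph connected, which is a counting argument on the edges of single colours.\<close>

definition ins :: "nat \<Rightarrow> 'a \<Rightarrow> 'b \<Rightarrow> 'a \<times> nat \<times> 'b \<Rightarrow> ('a \<times> nat \<times> 'b) set \<Rightarrow> ('a \<times> nat \<times> 'b) set" where
  "ins D w b f T = (case f of (x, c, y) \<Rightarrow>
     (T - {(x, c, y)}) \<union> {(x, c, b), (w, c, y)} \<union> {(w, c', b) | c'. c' \<le> D \<and> c' \<noteq> c})"

text \<open>The edge that closes the gap is not a parameter: \<open>T\<close> determines it, as the
  join of an edge at \<open>b\<close> and an edge at \<open>w\<close> of equal colour. For a melon
  only one such pair is left after excluding \<open>w\<close> and \<open>b\<close>, which is the
  content of \<open>in_del_melon\<close>.\<close>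

definition del :: "'a \<Rightarrow> 'b \<Rightarrow> ('a \<times> nat \<times> 'b) set \<Rightarrow> ('a \<times> nat \<times> 'b) set" where
  "del w b T = {(u, d, v). u \<noteq> w \<and> v \<noteq> b \<and> ((u, d, v) \<in> T \<or> (u, d, b) \<in> T \<and> (w, d, v) \<in> T)}"

lemma in_ins: "(u, d, v) \<in> ins D w b (x, c, y) T \<longleftrightarrow>
    (u, d, v) \<in> T \<and> (u, d, v) \<noteq> (x, c, y) \<or> (u, d, v) = (x, c, b) \<or> (u, d, v) = (w, c, y) \<or>
    u = w \<and> v = b \<and> d \<le> D \<and> d \<noteq> c"
  by (auto simp: ins_def)

lemma in_del: "(u, d, v) \<in> del w b T \<longleftrightarrow>
    u \<noteq> w \<and> v \<noteq> b \<and> ((u, d, v) \<in> T \<or> (u, d, b) \<in> T \<and> (w, d, v) \<in> T)"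
  by (auto simp: del_def)

definition fresh :: "'a \<Rightarrow> 'b \<Rightarrow> ('a \<times> nat \<times> 'b) set \<Rightarrow> bool" where
  "fresh w b T \<longleftrightarrow> (\<forall>(x, c, y) \<in> T. x \<noteq> w \<and> y \<noteq> b)"

lemma freshD: "fresh w b T \<Longrightarrow> (x, c, y) \<in> T \<Longrightarrow> x \<noteq> w \<and> y \<noteq> b"
  and fresh_simps: "fresh w b T \<Longrightarrow> (w, c, y) \<notin> T" "fresh w b T \<Longrightarrow> (x, c, b) \<notin> T"
  by (auto simp: fresh_def)

text \<open>\<open>c\<close> is the colour that the parallel edges leave out, so it is the colour of
  the two edges that attach the melon. The definition does not say whether \<open>(w, c, b)\<close>
  is present too; in a bordered set it cannot be (\<open>melon_at_outer\<close>).\<close>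

definition melon_at :: "nat \<Rightarrow> 'a \<Rightarrow> 'b \<Rightarrow> nat \<Rightarrow> ('a \<times> nat \<times> 'b) set \<Rightarrow> bool" where
  "melon_at D w b c T \<longleftrightarrow> c \<le> D \<and> (\<forall>c' \<le> D. c' \<noteq> c \<longrightarrow> (w, c', b) \<in> T)"

lemma del_ins:
  assumes "fresh w b T" "f \<in> T"
  shows "del w b (ins D w b f T) = T"
proof -
  obtain x c y where f: "f = (x, c, y)" by (cases f)
  have "x \<noteq> w" "y \<noteq> b" using freshD[OF assms(1)] assms(2) by (auto simp: f)
  moreover have "(u, d, v) \<in> T \<Longrightarrow> u \<noteq> w \<and> v \<noteq> b" for u d v
    using assms(1) by (rule freshD)
  ultimately have "(u, d, v) \<in> del w b (ins D w b f T) \<longleftrightarrow> (u, d, v) \<in> T" for u d v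
    using assms(2) by (auto simp: in_del in_ins f fresh_simps[OF assms(1)])
  then show ?thesis by auto
qed

text \<open>
  An open graph is turned into a set of edges by ending its unmatched half-edges in two additional
  vertices \<open>x\<^sub>0\<close> (white) and \<open>y\<^sub>0\<close> (black), which have a single edge each; the empty open
  graph is then the single edge \<open>(x\<^sub>0, c\<^sub>0, y\<^sub>0)\<close>.  Connectedness is stated by means of two-colourings
  \<open>P\<close>, \<open>Q\<close> of the white and black vertices, which are constant if no edge changes the colour.
\<close>

definition linked :: "('a \<times> nat \<times> 'b) set \<Rightarrow> bool" where
  "linked T \<longleftrightarrow> (\<forall>(P :: 'a \<Rightarrow> bool) Q. (\<forall>x c y. (x, c, y) \<in> T \<longrightarrow> P x = Q y) \<longrightarrow>
     (\<exists>v. \<forall>x c y. (x, c, y) \<in> T \<longrightarrow> P x = v))"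

definition bordered :: "nat \<Rightarrow> 'a \<times> nat \<times> 'b \<Rightarrow> ('a \<times> nat \<times> 'b) set \<Rightarrow> bool" where
  "bordered D e T \<longleftrightarrow> (case e of (x\<^sub>0, c\<^sub>0, y\<^sub>0) \<Rightarrow>
     finite T \<and> (\<forall>x c y. (x, c, y) \<in> T \<longrightarrow> c \<le> D) \<and>
     (\<forall>x c y y'. (x, c, y) \<in> T \<longrightarrow> (x, c, y') \<in> T \<longrightarrow> y = y') \<and>
     (\<forall>x x' c y. (x, c, y) \<in> T \<longrightarrow> (x', c, y) \<in> T \<longrightarrow> x = x') \<and>
     (\<exists>y. (x\<^sub>0, c\<^sub>0, y) \<in> T) \<and> (\<exists>x. (x, c\<^sub>0, y\<^sub>0) \<in> T) \<and>
     (\<forall>c y. (x\<^sub>0, c, y) \<in> T \<longrightarrow> c = c\<^sub>0) \<and> (\<forall>x c. (x, c, y\<^sub>0) \<in> T \<longrightarrow> c = c\<^sub>0) \<and>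
     (\<forall>x c y c'. (x, c, y) \<in> T \<longrightarrow> x \<noteq> x\<^sub>0 \<longrightarrow> c' \<le> D \<longrightarrow> (\<exists>y'. (x, c', y') \<in> T)) \<and>
     (\<forall>x c y c'. (x, c, y) \<in> T \<longrightarrow> y \<noteq> y\<^sub>0 \<longrightarrow> c' \<le> D \<longrightarrow> (\<exists>x'. (x', c', y) \<in> T)) \<and>
     linked T)"

lemma borderedI:
  fixes T :: "('a \<times> nat \<times> 'b) set"
  assumes "finite T" "\<And>x c y. (x, c, y) \<in> T \<Longrightarrow> c \<le> D"
    "\<And>x c y y'. (x, c, y) \<in> T \<Longrightarrow> (x, c, y') \<in> T \<Longrightarrow> y = y'"
    "\<And>x x' c y. (x, c, y) \<in> T \<Longrightarrow> (x', c, y) \<in> T \<Longrightarrow> x = x'"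
    "\<exists>y. (x\<^sub>0, c\<^sub>0, y) \<in> T" "\<exists>x. (x, c\<^sub>0, y\<^sub>0) \<in> T"
    "\<And>c y. (x\<^sub>0, c, y) \<in> T \<Longrightarrow> c = c\<^sub>0" "\<And>x c. (x, c, y\<^sub>0) \<in> T \<Longrightarrow> c = c\<^sub>0"
    "\<And>x c y c'. (x, c, y) \<in> T \<Longrightarrow> x \<noteq> x\<^sub>0 \<Longrightarrow> c' \<le> D \<Longrightarrow> \<exists>y'. (x, c', y') \<in> T"
    "\<And>x c y c'. (x, c, y) \<in> T \<Longrightarrow> y \<noteq> y\<^sub>0 \<Longrightarrow> c' \<le> D \<Longrightarrow> \<exists>x'. (x', c', y) \<in> T"
    "\<And>(P :: 'a \<Rightarrow> bool) Q. (\<And>x c y. (x, c, y) \<in> T \<Longrightarrow> P x = Q y) \<Longrightarrow> \<exists>v. \<forall>x c y. (x, c, y) \<in> T \<longrightarrow> P x = v"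
  shows "bordered D (x\<^sub>0, c\<^sub>0, y\<^sub>0) T"
proof -
  have "linked T" unfolding linked_def by (intro allI impI assms(11)) blast
  then show ?thesis unfolding bordered_def prod.case using assms(1-10) by blast
qed

context
  fixes D x\<^sub>0 c\<^sub>0 y\<^sub>0 and T :: "('a \<times> nat \<times> 'b) set"
  assumes b: "bordered D (x\<^sub>0, c\<^sub>0, y\<^sub>0) T"
begin

private lemmas parts = b[unfolded bordered_def prod.case]

lemmas bordered_finite = parts[THEN conjunct1]
  and bordered_colour = parts[THEN conjunct2, THEN conjunct1, rule_format]
  and bordered_white_unique = parts[THEN conjunct2, THEN conjunct2, THEN conjunct1, rule_format]
  and bordered_black_unique = parts[THEN conjunct2, THEN conjunct2, THEN conjunct2, THEN conjunct1,
    rule_format]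
  and bordered_border_white = parts[THEN conjunct2, THEN conjunct2, THEN conjunct2, THEN conjunct2,
    THEN conjunct1]
  and bordered_border_black = parts[THEN conjunct2, THEN conjunct2, THEN conjunct2, THEN conjunct2,
    THEN conjunct2, THEN conjunct1]
  and bordered_border_white_colour = parts[THEN conjunct2, THEN conjunct2, THEN conjunct2, THEN
    conjunct2, THEN conjunct2, THEN conjunct2, THEN conjunct1, rule_format]
  and bordered_border_black_colour = parts[THEN conjunct2, THEN conjunct2, THEN conjunct2, THEN
    conjunct2, THEN conjunct2, THEN conjunct2, THEN conjunct2, THEN conjunct1, rule_format]
  and bordered_white_full = parts[THEN conjunct2, THEN conjunct2, THEN conjunct2, THEN conjunct2,
    THEN conjunct2, THEN conjunct2, THEN conjunct2, THEN conjunct2, THEN conjunct1, rule_format]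
  and bordered_black_full = parts[THEN conjunct2, THEN conjunct2, THEN conjunct2, THEN conjunct2,
    THEN conjunct2, THEN conjunct2, THEN conjunct2, THEN conjunct2, THEN conjunct2, THEN conjunct1,
      rule_format]
  and bordered_linked = parts[THEN conjunct2, THEN conjunct2, THEN conjunct2, THEN conjunct2, THEN
    conjunct2, THEN conjunct2, THEN conjunct2, THEN conjunct2, THEN conjunct2, THEN conjunct2]

lemma bordered_connected:
  fixes P :: "'a \<Rightarrow> bool" and Q :: "'b \<Rightarrow> bool"
  assumes "\<And>x c y. (x, c, y) \<in> T \<Longrightarrow> P x = Q y"
  obtains v where "\<And>x c y. (x, c, y) \<in> T \<Longrightarrow> P x = v \<and> Q y = v"
proof -
  have *: "\<forall>(P :: 'a \<Rightarrow> bool) Q. (\<forall>x c y. (x, c, y) \<in> T \<longrightarrow> P x = Q y) \<longrightarrow>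
       (\<exists>v. \<forall>x c y. (x, c, y) \<in> T \<longrightarrow> P x = v)"
    using bordered_linked unfolding linked_def .
  have "\<exists>v. \<forall>x c y. (x, c, y) \<in> T \<longrightarrow> P x = v"
    using *[THEN spec, THEN spec, of P Q] assms by simp
  then obtain v where "\<And>x c y. (x, c, y) \<in> T \<Longrightarrow> P x = v" by (elim exE) simp
  then show thesis using that[of v] assms by metis
qed

end

lemma bordered_single: "c \<le> D \<Longrightarrow> bordered D (x, c, y) {(x, c, y)}"
  by (rule borderedI) auto

text \<open>Each border vertex has a single edge, so an edge between the two leaves them no other
  neighbour. Marking exactly the border vertices is then a compatible two-colouring, and
  connectedness leaves no room for further edges.\<close>

lemma bordered_eq_single:
  assumes b: "bordered D (x\<^sub>0, c\<^sub>0, y\<^sub>0) T" and e: "(x\<^sub>0, c, y\<^sub>0) \<in> T"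
  shows "T = {(x\<^sub>0, c\<^sub>0, y\<^sub>0)}"
proof -
  have c: "c = c\<^sub>0" using bordered_border_white_colour[OF b e] .
  have PQ: "(x = x\<^sub>0) = (y = y\<^sub>0)" if "(x, d, y) \<in> T" for x d y
    using that e c bordered_border_white_colour[OF b] bordered_border_black_colour[OF b]
      bordered_white_unique[OF b] bordered_black_unique[OF b] by metis
  obtain v where v: "\<And>x c y. (x, c, y) \<in> T \<Longrightarrow> (x = x\<^sub>0) = v \<and> (y = y\<^sub>0) = v"
    by (rule bordered_connected[OF b, of "\<lambda>x. x = x\<^sub>0" "\<lambda>y. y = y\<^sub>0"], erule PQ, rule that)
  have "v" using v[OF e] by simp
  then have "(x, d, y) = (x\<^sub>0, c\<^sub>0, y\<^sub>0)" if "(x, d, y) \<in> T" for x d y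
    using v[OF that] that bordered_border_white_colour[OF b, of d y] by simp
  then have "T \<subseteq> {(x\<^sub>0, c\<^sub>0, y\<^sub>0)}" by (intro subrelI subsetI) (metis prod_cases3 singletonI)
  then show ?thesis using e c by blast
qed

lemma bordered_ins:
  fixes T :: "('a \<times> nat \<times> 'b) set"
  assumes b: "bordered D e T" and f: "f \<in> T" and fr: "fresh w b T" and D: "1 \<le> D"
  shows "bordered D e (ins D w b f T)"
proof -
  obtain x\<^sub>0 c\<^sub>0 y\<^sub>0 where e: "e = (x\<^sub>0, c\<^sub>0, y\<^sub>0)" by (cases e)
  obtain x c y where f': "f = (x, c, y)" by (cases f)
  note B = b[unfolded e]
  have cD: "c \<le> D" using bordered_colour[OF B] f f' by auto
  have xy: "x \<noteq> w" "y \<noteq> b" using freshD[OF fr] f f' by blast+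
  have fT: "(x, c, y) \<in> T" using f f' by simp
  note uw = bordered_white_unique[OF B fT] and ub = bordered_black_unique[OF B fT]
  have x0: "x\<^sub>0 \<noteq> w" "y\<^sub>0 \<noteq> b"
    using bordered_border_white[OF B] bordered_border_black[OF B] freshD[OF fr] by blast+
  let ?T = "ins D w b (x, c, y) T"
  have new: "(x, c, b) \<in> ?T" "(w, c, y) \<in> ?T" "\<And>c'. c' \<le> D \<Longrightarrow> c' \<noteq> c \<Longrightarrow> (w, c', b) \<in> ?T"
    by (auto simp: in_ins)
  have "bordered D (x\<^sub>0, c\<^sub>0, y\<^sub>0) ?T"
  proof (rule borderedI)
    have "ins D w b (x, c, y) T \<subseteq> T \<union> {(x, c, b), (w, c, y)} \<union> {w} \<times> {..D} \<times> {b}"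
      by (auto simp: ins_def)
    then show "finite ?T" by (rule finite_subset) (use bordered_finite[OF B] in auto)
    show "d \<le> D" if "(u, d, v) \<in> ?T" for u d v
      using that cD by (auto simp: in_ins dest: bordered_colour[OF B])
    show "v = v'" if "(u, d, v) \<in> ?T" "(u, d, v') \<in> ?T" for u d v v'
      using that xy by (auto simp: in_ins fresh_simps[OF fr] dest: uw bordered_white_unique[OF B])
    show "u = u'" if "(u, d, v) \<in> ?T" "(u', d, v) \<in> ?T" for u u' d v
      using that xy by (auto simp: in_ins fresh_simps[OF fr] dest: ub bordered_black_unique[OF B])
    show "\<exists>v. (x\<^sub>0, c\<^sub>0, v) \<in> ?T" using bordered_border_white[OF B] by (auto simp: in_ins)
    show "\<exists>u. (u, c\<^sub>0, y\<^sub>0) \<in> ?T" using bordered_border_black[OF B] by (auto simp: in_ins)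
    show "d = c\<^sub>0" if "(x\<^sub>0, d, v) \<in> ?T" for d v
    proof -
      have "\<exists>v. (x\<^sub>0, d, v) \<in> T" using that fT x0 by (auto simp: in_ins)
      then show ?thesis using bordered_border_white_colour[OF B] by blast
    qed
    show "d = c\<^sub>0" if "(u, d, y\<^sub>0) \<in> ?T" for u d
    proof -
      have "\<exists>u. (u, d, y\<^sub>0) \<in> T" using that fT x0 by (auto simp: in_ins)
      then show ?thesis using bordered_border_black_colour[OF B] by blast
    qed
    show "\<exists>v'. (u, d', v') \<in> ?T" if h: "(u, d, v) \<in> ?T" "u \<noteq> x\<^sub>0" "d' \<le> D" for u d v d'
    proof (cases "u = w")
      case True then show ?thesis using new h(3) by (cases "d' = c") blast+
    next
      case False
      then have "\<exists>c v. (u, c, v) \<in> T" using h(1) fT by (auto simp: in_ins)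
      then obtain v' where "(u, d', v') \<in> T" using bordered_white_full[OF B] h(2,3) by blast
      then show ?thesis by (cases "(u, d', v') = (x, c, y)") (auto simp: in_ins)
    qed
    show "\<exists>u'. (u', d', v) \<in> ?T" if h: "(u, d, v) \<in> ?T" "v \<noteq> y\<^sub>0" "d' \<le> D" for u d v d'
    proof (cases "v = b")
      case True then show ?thesis using new h(3) by (cases "d' = c") blast+
    next
      case False
      then have "\<exists>c u. (u, c, v) \<in> T" using h(1) fT by (auto simp: in_ins)
      then obtain u' where "(u', d', v) \<in> T" using bordered_black_full[OF B] h(2,3) by blast
      then show ?thesis by (cases "(u', d', v) = (x, c, y)") (auto simp: in_ins)
    qed
    fix P :: "'a \<Rightarrow> bool" and Q assume *: "\<And>u d v. (u, d, v) \<in> ?T \<Longrightarrow> P u = Q v"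
    show "\<exists>v. \<forall>x c y. (x, c, y) \<in> ?T \<longrightarrow> P x = v"
    proof -
      \<comment> \<open>An inner colour of the melon: its edge makes the path from \<open>x\<close>
        over \<open>b\<close> and \<open>w\<close> to \<open>y\<close>, which replaces the removed
        edge.\<close>
      obtain c' where c': "c' \<le> D" "c' \<noteq> c"
        using D by (metis le0 not_one_le_zero)
      have eq: "P x = Q b" "P w = Q y" "P w = Q b"
        using *[OF new(1)] *[OF new(2)] *[OF new(3)[OF c']] by simp_all
      have PQ: "P u = Q v" if "(u, d, v) \<in> T" for u d v
      proof (cases "(u, d, v) = (x, c, y)")
        case True then show ?thesis using eq by simp
      next
        case False then show ?thesis using that *[of u d v] by (auto simp: in_ins)
      qed
      obtain v where v: "\<And>x c y. (x, c, y) \<in> T \<Longrightarrow> P x = v \<and> Q y = v"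
        by (rule bordered_connected[OF B, of P Q], erule PQ, rule that)
      have "P u = v" if "(u, d, z) \<in> ?T" for u d z
        using that[unfolded in_ins] v[of u d z] v[OF fT] eq by fastforce
      then show ?thesis by (intro exI[of _ v]) simp
    qed
  qed
  then show ?thesis by (simp add: e f')
qed

definition whites :: "('a \<times> nat \<times> 'b) set \<Rightarrow> 'a set" where
  "whites T = {x. \<exists>c y. (x, c, y) \<in> T}"

definition blacks :: "('a \<times> nat \<times> 'b) set \<Rightarrow> 'b set" where
  "blacks T = {y. \<exists>x c. (x, c, y) \<in> T}"

lemma in_whites: "(x, c, y) \<in> T \<Longrightarrow> x \<in> whites T"
  and in_blacks: "(x, c, y) \<in> T \<Longrightarrow> y \<in> blacks T"
  by (auto simp: whites_def blacks_def)

text \<open>This is how \<open>2 \<le> D\<close> enters: two melons with outer colours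
  \<open>c\<close> and \<open>c'\<close> have an inner colour in common, and some inner edge of a
  melon differs in colour from the border.\<close>

lemma exists_third_colour:
  fixes c c' D :: nat
  assumes "2 \<le> D"
  obtains d where "d \<le> D" "d \<noteq> c" "d \<noteq> c'"
proof -
  have "\<not> {0, 1, 2} \<subseteq> {c, c'}" using card_mono[of "{c, c'}" "{0, 1, 2 :: nat}"]
    by (auto simp: card_insert_if split: if_splits)
  then obtain d where "d \<in> {0, 1, 2}" "d \<notin> {c, c'}" by blast
  then show thesis using that[of d] assms by auto
qed

text \<open>A border vertex has edges of the colour \<open>c\<^sub>0\<close> only, while some
  parallel edge of the melon has another colour.\<close>

lemma melon_at_border:
  assumes D: "2 \<le> D" and T: "bordered D (x\<^sub>0, c\<^sub>0, y\<^sub>0) T" and m: "melon_at D w b c T"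
  shows "w \<noteq> x\<^sub>0" "b \<noteq> y\<^sub>0"
proof -
  obtain d where d: "d \<le> D" "d \<noteq> c" "d \<noteq> c\<^sub>0" by (rule exists_third_colour[OF D])
  then have wb: "(w, d, b) \<in> T" using m by (simp add: melon_at_def)
  show "w \<noteq> x\<^sub>0" using bordered_border_white_colour[OF T, of d b] wb d by blast
  show "b \<noteq> y\<^sub>0" using bordered_border_black_colour[OF T, of w d] wb d by blast
qed

text \<open>All colours at \<open>w\<close> except \<open>c\<close> lead to \<open>b\<close>. If
  \<open>c\<close> did so as well, the two vertices would be a connected component of their own, to
  which the border vertex \<open>x\<^sub>0\<close> does not belong.\<close>

lemma melon_at_outer:
  assumes D: "2 \<le> D" and T: "bordered D (x\<^sub>0, c\<^sub>0, y\<^sub>0) T" and m: "melon_at D w b c T"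
  obtains x y where "(x, c, b) \<in> T" "(w, c, y) \<in> T" "x \<noteq> w" "y \<noteq> b"
proof -
  note m0 = melon_at_border[OF D T m]
  have cD: "c \<le> D" and par: "\<And>d. d \<le> D \<Longrightarrow> d \<noteq> c \<Longrightarrow> (w, d, b) \<in> T"
    using m by (auto simp: melon_at_def)
  obtain d where d: "d \<le> D" "d \<noteq> c" "d \<noteq> c" by (rule exists_third_colour[OF D])
  obtain y where y: "(w, c, y) \<in> T" using bordered_white_full[OF T par[OF d(1,2)] m0(1) cD] by blast
  obtain x where x: "(x, c, b) \<in> T" using bordered_black_full[OF T par[OF d(1,2)] m0(2) cD] by blast
  have nb: "(w, c, b) \<notin> T"
  proof
    assume wcb: "(w, c, b) \<in> T"
    have all: "(w, d, b) \<in> T" if "d \<le> D" for d using par[OF that] wcb by (cases "d = c") auto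
    have PQ: "(u = w) = (v = b)" if h: "(u, d, v) \<in> T" for u d v
    proof -
      have "(w, d, b) \<in> T" using all bordered_colour[OF T h] by blast
      then show ?thesis using h bordered_white_unique[OF T] bordered_black_unique[OF T] by metis
    qed
    obtain v where v: "\<And>x c y. (x, c, y) \<in> T \<Longrightarrow> (x = w) = v \<and> (y = b) = v"
      by (rule bordered_connected[OF T, of "\<lambda>x. x = w" "\<lambda>y. y = b"], erule PQ, rule that)
    have "(x\<^sub>0 = w) = (w = w)" using v[OF wcb] bordered_border_white[OF T] v by metis
    then show False using m0 by simp
  qed
  show thesis
  proof (rule that[OF x y])
    show "x \<noteq> w" using x nb by blast
    show "y \<noteq> b" using y nb by blast
  qed
qed

text \<open>For a colour other than \<open>c\<close> the white neighbour of \<open>b\<close> is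
  \<open>w\<close>, which the definition of \<open>del\<close> excludes. So contraction creates
  exactly one edge, between the outer neighbours \<open>x\<close> and \<open>y\<close>.\<close>

lemma in_del_melon:
  assumes T: "bordered D e T" and m: "melon_at D w b c T"
    and x: "(x, c, b) \<in> T" "x \<noteq> w" and y: "(w, c, y) \<in> T" "y \<noteq> b"
  shows "(u, d, v) \<in> del w b T \<longleftrightarrow> (u, d, v) \<in> T \<and> u \<noteq> w \<and> v \<noteq> b \<or> (u, d, v) = (x, c, y)"
proof -
  obtain x\<^sub>0 c\<^sub>0 y\<^sub>0 where e: "e = (x\<^sub>0, c\<^sub>0, y\<^sub>0)" by (cases e)
  note B = T[unfolded e]
  have "(u, d, v) = (x, c, y)" if h: "u \<noteq> w" "(u, d, b) \<in> T" "(w, d, v) \<in> T"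
  proof -
    have "d = c"
    proof (rule ccontr)
      assume "d \<noteq> c"
      then have "(w, d, b) \<in> T" using m bordered_colour[OF B h(2)] by (simp add: melon_at_def)
      then show False using h bordered_black_unique[OF B] by blast
    qed
    then show ?thesis
      using h x y bordered_black_unique[OF B, of u c b x] bordered_white_unique[OF B, of w c v y] by simp
  qed
  then show ?thesis using x y unfolding in_del by blast
qed

lemma melon_edges:
  assumes T: "bordered D e T" and m: "melon_at D w b c T"
    and x: "(x, c, b) \<in> T" "x \<noteq> w" and y: "(w, c, y) \<in> T" "y \<noteq> b"
  shows "(w, d, v) \<in> T \<longleftrightarrow> d = c \<and> v = y \<or> d \<le> D \<and> d \<noteq> c \<and> v = b"
    and "(u, d, b) \<in> T \<longleftrightarrow> d = c \<and> u = x \<or> d \<le> D \<and> d \<noteq> c \<and> u = w"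
    and "(x, c, y) \<notin> T"
proof -
  obtain x\<^sub>0 c\<^sub>0 y\<^sub>0 where e: "e = (x\<^sub>0, c\<^sub>0, y\<^sub>0)" by (cases e)
  note B = T[unfolded e]
  have par: "(w, d, b) \<in> T" if "d \<le> D" "d \<noteq> c" for d using m that by (simp add: melon_at_def)
  show "(w, d, v) \<in> T \<longleftrightarrow> d = c \<and> v = y \<or> d \<le> D \<and> d \<noteq> c \<and> v = b"
  proof (cases "d = c")
    case True
    then show ?thesis using y bordered_white_unique[OF B, of w c v y] by auto
  next
    case False
    then show ?thesis
      using par[of d] bordered_colour[OF B, of w d v] bordered_white_unique[OF B, of w d v b] by auto
  qed
  show "(u, d, b) \<in> T \<longleftrightarrow> d = c \<and> u = x \<or> d \<le> D \<and> d \<noteq> c \<and> u = w"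
  proof (cases "d = c")
    case True
    then show ?thesis using x bordered_black_unique[OF B, of u c b x] by auto
  next
    case False
    then show ?thesis
      using par[of d] bordered_colour[OF B, of u d b] bordered_black_unique[OF B, of u d b w] by auto
  qed
  show "(x, c, y) \<notin> T" using bordered_white_unique[OF B x(1), of y] y(2) by auto
qed

text \<open>Contraction is undone by inserting the melon at the edge that the contraction created;
  this is the counterpart of \<open>del_ins\<close>.\<close>

lemma ins_del:
  assumes T: "bordered D e T" and m: "melon_at D w b c T"
    and x: "(x, c, b) \<in> T" "x \<noteq> w" and y: "(w, c, y) \<in> T" "y \<noteq> b"
  shows "ins D w b (x, c, y) (del w b T) = T" "(x, c, y) \<in> del w b T" "fresh w b (del w b T)"
proof -
  note del = in_del_melon[OF assms]
  obtain x\<^sub>0 c\<^sub>0 y\<^sub>0 where e: "e = (x\<^sub>0, c\<^sub>0, y\<^sub>0)" by (cases e)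
  note B = T[unfolded e]
  show xy: "(x, c, y) \<in> del w b T" by (simp add: del)
  show "fresh w b (del w b T)" by (auto simp: fresh_def in_del)
  have "(u, d, v) \<in> ins D w b (x, c, y) (del w b T) \<longleftrightarrow> (u, d, v) \<in> T" for u d v
    unfolding in_ins del using x(2) y(2) melon_edges[OF assms]
    by (cases "u = w"; cases "v = b") auto
  then show "ins D w b (x, c, y) (del w b T) = T" by (auto simp: set_eq_iff)
qed

lemma bordered_del:
  fixes T :: "('a \<times> nat \<times> 'b) set"
  assumes D: "2 \<le> D" and T: "bordered D e T" and m: "melon_at D w b c T"
  shows "bordered D e (del w b T)"
proof -
  obtain x\<^sub>0 c\<^sub>0 y\<^sub>0 where e: "e = (x\<^sub>0, c\<^sub>0, y\<^sub>0)" by (cases e)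
  note B = T[unfolded e]
  obtain x y where x: "(x, c, b) \<in> T" "x \<noteq> w" and y: "(w, c, y) \<in> T" "y \<noteq> b"
    by (rule melon_at_outer[OF D B m]) blast
  note del = in_del_melon[OF T m x y]
  note m0 = melon_at_border[OF D B m]
  have cD: "c \<le> D" using m by (simp add: melon_at_def)
  note medges = melon_edges[OF T m x y]
  have atw: "d = c \<and> v = y \<or> v = b" if "(w, d, v) \<in> T" for d v using that medges(1) by blast
  have atb: "d = c \<and> u = x \<or> u = w" if "(u, d, b) \<in> T" for u d using that medges(2) by blast
  have uw: "v = b" if "(x, c, v) \<in> T" for v using bordered_white_unique[OF B that x(1)] .
  have ub: "u = w" if "(u, c, y) \<in> T" for u using bordered_black_unique[OF B that y(1)] .
  let ?T = "del w b T"
  have new: "(x, c, y) \<in> ?T" by (simp add: del)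
  have old: "(u, d, v) \<in> ?T" if "(u, d, v) \<in> T" "u \<noteq> w" "v \<noteq> b" for u d v
    using that by (simp add: del)
  have "bordered D (x\<^sub>0, c\<^sub>0, y\<^sub>0) ?T"
  proof (rule borderedI)
    have "?T \<subseteq> insert (x, c, y) T" by (auto simp: del)
    then show "finite ?T" by (rule finite_subset) (use bordered_finite[OF B] in simp)
    show "d \<le> D" if "(u, d, v) \<in> ?T" for u d v
      using that[unfolded del] bordered_colour[OF B, of u d v] cD by blast
    show "v = v'" if h: "(u, d, v) \<in> ?T" "(u, d, v') \<in> ?T" for u d v v'
      using h(1)[unfolded del] h(2)[unfolded del] uw[of v] uw[of v'] bordered_white_unique[OF B, of
        u d v v']
      by blast
    show "u = u'" if h: "(u, d, v) \<in> ?T" "(u', d, v) \<in> ?T" for u u' d v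
      using h(1)[unfolded del] h(2)[unfolded del] ub[of u] ub[of u'] bordered_black_unique[OF B, of
        u d v u']
      by blast
    obtain v where v: "(x\<^sub>0, c\<^sub>0, v) \<in> T" using bordered_border_white[OF B] by blast
    show "\<exists>v. (x\<^sub>0, c\<^sub>0, v) \<in> ?T"
      using v atb[of x\<^sub>0 c\<^sub>0] m0 new old[OF v] by (cases "v = b") auto
    obtain u where u: "(u, c\<^sub>0, y\<^sub>0) \<in> T" using bordered_border_black[OF B] by blast
    show "\<exists>u. (u, c\<^sub>0, y\<^sub>0) \<in> ?T"
      using u atw[of c\<^sub>0 y\<^sub>0] m0 new old[OF u] by (cases "u = w") auto
    show "d = c\<^sub>0" if "(x\<^sub>0, d, v) \<in> ?T" for d v
      using that[unfolded del] x bordered_border_white_colour[OF B, of d] by blast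
    show "d = c\<^sub>0" if "(u, d, y\<^sub>0) \<in> ?T" for u d
      using that[unfolded del] y bordered_border_black_colour[OF B, of _ d] by blast
    show "\<exists>v'. (u, d', v') \<in> ?T" if h: "(u, d, v) \<in> ?T" "u \<noteq> x\<^sub>0" "d' \<le> D" for u d v d'
    proof -
      have uT: "\<exists>d v. (u, d, v) \<in> T" "u \<noteq> w" using h(1)[unfolded del] x by blast+
      then obtain v' where v': "(u, d', v') \<in> T" using bordered_white_full[OF B _ h(2,3)] by blast
      show ?thesis using atb[of u d'] v' uT(2) new old[OF v' uT(2)] by (cases "v' = b") auto
    qed
    show "\<exists>u'. (u', d', v) \<in> ?T" if h: "(u, d, v) \<in> ?T" "v \<noteq> y\<^sub>0" "d' \<le> D" for u d v d'
    proof -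
      have vT: "\<exists>d u. (u, d, v) \<in> T" "v \<noteq> b" using h(1)[unfolded del] y by blast+
      then obtain u' where u': "(u', d', v) \<in> T" using bordered_black_full[OF B _ h(2,3)] by blast
      show ?thesis using atw[of d' v] u' vT(2) new old[OF u' _ vT(2)] by (cases "u' = w") auto
    qed
    fix P :: "'a \<Rightarrow> bool" and Q assume PQ: "\<And>u d v. (u, d, v) \<in> ?T \<Longrightarrow> P u = Q v"
    \<comment> \<open>A two-colouring of the contracted set extends to the melon: \<open>w\<close>
      and \<open>b\<close> take the value of the new edge \<open>(x, c, y)\<close>, which fits the
      parallel edges and both attaching edges.\<close>
    define P' where "P' = P(w := P x)"
    define Q' where "Q' = Q(b := P x)"
    have PQ': "P' u = Q' v" if h: "(u, d, v) \<in> T" for u d v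
    proof -
      consider "u = w" "v = b" | "u = w" "v = y" "v \<noteq> b" | "v = b" "u = x" "u \<noteq> w" | "u \<noteq> w" "v \<noteq> b"
        using atw[of d v] atb[of u d] h by blast
      then show ?thesis
        using PQ[OF new] PQ[OF old[OF h]] by cases (auto simp: P'_def Q'_def)
    qed
    obtain z where z: "\<And>x c y. (x, c, y) \<in> T \<Longrightarrow> P' x = z \<and> Q' y = z"
      by (rule bordered_connected[OF B, of P' Q'], erule PQ', rule that)
    have "P u = z" if h: "(u, d, v) \<in> ?T" for u d v
    proof -
      obtain d' v' where "(u, d', v') \<in> T" "u \<noteq> w" using h[unfolded del] x by blast
      then show ?thesis using z[of u d' v'] by (simp add: P'_def)
    qed
    then show "\<exists>z. \<forall>u d v. (u, d, v) \<in> ?T \<longrightarrow> P u = z" by (intro exI[of _ z]) simp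
  qed
  then show ?thesis by (simp add: e)
qed

section \<open>Blow-ups of a single edge\<close>

inductive blowup :: "nat \<Rightarrow> 'a \<times> nat \<times> 'b \<Rightarrow> ('a \<times> nat \<times> 'b) set \<Rightarrow> bool" for D e where
  single: "blowup D e {e}"
| ins: "blowup D e T \<Longrightarrow> f \<in> T \<Longrightarrow> fresh w b T \<Longrightarrow> blowup D e (ins D w b f T)"

lemma bordered_blowup:
  assumes "blowup D e T" "fst (snd e) \<le> D" "2 \<le> D"
  shows "bordered D e T"
  using assms
proof (induction rule: blowup.induct)
  case single
  then show ?case by (cases e) (simp add: bordered_single)
next
  case (ins T f w b)
  then show ?case by (intro bordered_ins) auto
qed

text \<open>Melon removal is locally confluent because two melons are disjoint if \<open>D \<ge> 2\<close>.\<close>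

lemma blowup_del:
  assumes "blowup D e T" "melon_at D w b c T" "fst (snd e) \<le> D" and D: "2 \<le> D"
  shows "blowup D e (del w b T)"
  using assms(1-3)
proof (induction arbitrary: c rule: blowup.induct)
  case single
  obtain d where d: "d \<le> D" "d \<noteq> c" "d \<noteq> fst (snd e)" by (rule exists_third_colour[OF D])
  then have "(w, d, b) = e" using single.prems(1) by (simp add: melon_at_def)
  then show ?case using d by auto
next
  case (ins T f w' b')
  obtain xf cf yf where f: "f = (xf, cf, yf)" by (cases f)
  note fr = ins.hyps(3)
  have bT: "bordered D e T" using bordered_blowup[OF ins.hyps(1)] ins.prems(2) D by blast
  have xf: "xf \<noteq> w'" "yf \<noteq> b'" using freshD[OF fr] ins.hyps(2) f by blast+
  let ?T = "ins D w' b' f T"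
  have bT': "bordered D e ?T" using bordered_ins[OF bT ins.hyps(2) fr] D by simp
  have m: "(w, d, b) \<in> ?T" if "d \<le> D" "d \<noteq> c" for d
    using ins.prems(1) that by (simp add: melon_at_def)
  have cD: "c \<le> D" using ins.prems(1) by (simp add: melon_at_def)
  \<comment> \<open>A colour that is inner to both melons. Its edge between \<open>w\<close> and
    \<open>b\<close> is either old or part of the inserted melon, so melons sharing one vertex
    coincide.\<close>
  obtain d where d: "d \<le> D" "d \<noteq> c" "d \<noteq> cf" by (rule exists_third_colour[OF D])
  have mwb: "(w, d, b) \<in> T \<or> w = w' \<and> b = b'"
    using m[OF d(1,2)] d(3) unfolding f in_ins by blast
  show ?case
  proof (cases "w = w' \<or> b = b'")
    case True
    then have "w = w' \<and> b = b'" using mwb freshD[OF fr] by blast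
    then show ?thesis using del_ins[OF fr ins.hyps(2)] ins.hyps(1) by simp
  next
    case False
    then have ne: "w \<noteq> w'" "b \<noteq> b'" by auto
    have mT: "(w, d, b) \<in> T \<and> (w, d, b) \<noteq> f" if "d \<le> D" "d \<noteq> c" for d
      using m[OF that] ne unfolding f in_ins by blast
    then have mT': "melon_at D w b c T" using cD by (simp add: melon_at_def)
    then have IH: "blowup D e (del w b T)" using ins.IH ins.prems(2) by blast
    obtain x\<^sub>0 c\<^sub>0 y\<^sub>0 where e: "e = (x\<^sub>0, c\<^sub>0, y\<^sub>0)" by (cases e)
    note B = bT[unfolded e]
    obtain x y where x: "(x, c, b) \<in> T" "x \<noteq> w" and y: "(w, c, y) \<in> T" "y \<noteq> b"
      by (rule melon_at_outer[OF D B mT']) blast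
    note delT = in_del_melon[OF bT mT' x y]
    note medges = melon_edges[OF bT mT' x y]
    have xyT: "(x, c, y) \<notin> T" by (fact medges(3))
    have xy: "x \<noteq> w'" "y \<noteq> b'" using freshD[OF fr x(1)] freshD[OF fr y(1)] by auto
    have fT: "(xf, cf, yf) \<in> T" using ins.hyps(2) f by simp
    have fr': "fresh w' b' (del w b T)"
      unfolding fresh_def using xy by (auto simp: delT fresh_simps[OF fr])
    have atw: "cf = c \<and> yf = y" if "xf = w"
    proof -
      have "cf = c"
      proof (rule ccontr)
        assume "cf \<noteq> c"
        from mT[OF bordered_colour[OF B fT] this] have "(w, cf, b) \<in> T" "(w, cf, b) \<noteq> f" by auto
        then show False using bordered_white_unique[OF B fT, of b] that f by simp
      qed
      then show ?thesis using bordered_white_unique[OF B fT, of y] y that by simp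
    qed
    have atb: "cf = c \<and> xf = x" if "yf = b"
    proof -
      have "cf = c"
      proof (rule ccontr)
        assume "cf \<noteq> c"
        from mT[OF bordered_colour[OF B fT] this] have "(w, cf, b) \<in> T" "(w, cf, b) \<noteq> f" by auto
        then show False using bordered_black_unique[OF B fT, of w] that f by simp
      qed
      then show ?thesis using bordered_black_unique[OF B fT, of x] x that by simp
    qed
    \<comment> \<open>The edge at which the other melon sits after the contraction. If
      \<open>f\<close> was one of the two edges attaching the melon \<open>w\<close>,
      \<open>b\<close>, it has been absorbed into \<open>(x, c, y)\<close>; otherwise it is still
      there.\<close>
    define f' where "f' = (if xf = w \<or> yf = b then (x, c, y) else f)"
    have f': "f' \<in> del w b T" using fT by (cases "xf = w \<or> yf = b") (auto simp: f'_def delT f)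
    consider (w) "xf = w" "cf = c" "yf = y" | (b) "yf = b" "cf = c" "xf = x" "xf \<noteq> w"
      | (n) "xf \<noteq> w" "yf \<noteq> b" using atw atb by blast
    then have "del w b ?T = ins D w' b' f' (del w b T)"
    proof cases
      case w
      have o: "(x, c, b) \<in> ?T" "(w, c, b') \<in> ?T" using x w unfolding f by (auto simp: in_ins)
      note delT' = in_del_melon[OF bT' ins.prems(1) o(1) x(2) o(2) ne(2)[symmetric]]
      have "(u, d, v) \<in> del w b ?T \<longleftrightarrow> (u, d, v) \<in> ins D w' b' (x, c, y) (del w b T)" for u d v
        unfolding delT' in_ins delT unfolding f in_ins using w x(2) y(2) xy xf ne medges
        by (cases "u = w"; cases "v = b") auto
      then show ?thesis using w by (auto simp: f'_def set_eq_iff)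
    next
      case b
      have o: "(w', c, b) \<in> ?T" "(w, c, y) \<in> ?T" using y b x unfolding f by (auto simp: in_ins)
      note delT' = in_del_melon[OF bT' ins.prems(1) o(1) ne(1)[symmetric] o(2) y(2)]
      have "(u, d, v) \<in> del w b ?T \<longleftrightarrow> (u, d, v) \<in> ins D w' b' (x, c, y) (del w b T)" for u d v
        unfolding delT' in_ins delT unfolding f in_ins using b x(2) y(2) xy xf ne medges
        by (cases "u = w"; cases "v = b") auto
      then show ?thesis using b by (auto simp: f'_def set_eq_iff)
    next
      case n
      have o: "(x, c, b) \<in> ?T" "(w, c, y) \<in> ?T" using x y n unfolding f by (auto simp: in_ins)
      note delT' = in_del_melon[OF bT' ins.prems(1) o(1) x(2) o(2) y(2)]
      have "(x, c, y) \<noteq> (xf, cf, yf)" using xyT fT by blast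
      then have "(u, d, v) \<in> del w b ?T \<longleftrightarrow> (u, d, v) \<in> ins D w' b' f (del w b T)" for u d v
        unfolding delT' unfolding f in_ins delT using n x(2) y(2) xy xf ne medges
        by (cases "u = w"; cases "v = b") auto
      then show ?thesis using n by (auto simp: f'_def set_eq_iff)
    qed
    then show ?thesis using blowup.ins[OF IH f' fr'] by simp
  qed
qed

subsection \<open>Replacing edges by blow-ups\<close>

definition inner_whites :: "'a \<times> nat \<times> 'b \<Rightarrow> ('a \<times> nat \<times> 'b) set \<Rightarrow> 'a set" where
  "inner_whites e T = whites T - {fst e}"

definition inner_blacks :: "'a \<times> nat \<times> 'b \<Rightarrow> ('a \<times> nat \<times> 'b) set \<Rightarrow> 'b set" where
  "inner_blacks e T = blacks T - {snd (snd e)}"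

text \<open>\<open>E\<close> arises from \<open>C\<close> by replacing each edge \<open>e\<close> by the melonic graph \<open>F e\<close>.\<close>

definition family :: "nat \<Rightarrow> ('a \<times> nat \<times> 'b) set \<Rightarrow> ('a \<times> nat \<times> 'b \<Rightarrow> ('a \<times> nat \<times> 'b) set) \<Rightarrow>
    ('a \<times> nat \<times> 'b) set \<Rightarrow> bool" where
  "family D C F E \<longleftrightarrow> E = (\<Union>e \<in> C. F e) \<and> (\<forall>e \<in> C. blowup D e (F e)) \<and>
     (\<forall>e \<in> C. inner_whites e (F e) \<inter> whites C = {} \<and> inner_blacks e (F e) \<inter> blacks C = {}) \<and>
     (\<forall>e \<in> C. \<forall>e' \<in> C. e \<noteq> e' \<longrightarrow> inner_whites e (F e) \<inter> inner_whites e' (F e') = {} \<and>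
        inner_blacks e (F e) \<inter> inner_blacks e' (F e') = {})"

definition no_melon :: "nat \<Rightarrow> ('a \<times> nat \<times> 'b) set \<Rightarrow> bool" where
  "no_melon D C \<longleftrightarrow> (\<nexists>w b c. melon_at D w b c C)"

locale blown_up =
  fixes D :: nat and e\<^sub>0 :: "'a \<times> nat \<times> 'b" and C and F and E
  assumes D: "2 \<le> D" and C: "bordered D e\<^sub>0 C" and fam: "family D C F E"
begin

lemma F_blowup: "e \<in> C \<Longrightarrow> blowup D e (F e)"
  using fam by (simp add: family_def)

lemma E_eq: "E = (\<Union>e \<in> C. F e)"
  using fam by (simp add: family_def)

lemma in_E: "e \<in> C \<Longrightarrow> f \<in> F e \<Longrightarrow> f \<in> E"
  using E_eq by blast

lemma C_colour: "(x, c, y) \<in> C \<Longrightarrow> c \<le> D"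
  using C by (cases e\<^sub>0) (blast dest: bordered_colour)

lemma C_white: "(x, c, y) \<in> C \<Longrightarrow> (x, c, y') \<in> C \<Longrightarrow> y = y'"
  using C by (cases e\<^sub>0) (blast dest: bordered_white_unique)

lemma C_black: "(x, c, y) \<in> C \<Longrightarrow> (x', c, y) \<in> C \<Longrightarrow> x = x'"
  using C by (cases e\<^sub>0) (blast dest: bordered_black_unique)

lemma F_bordered: "e \<in> C \<Longrightarrow> bordered D e (F e)"
  using bordered_blowup[OF F_blowup, of e] C_colour[of "fst e" "fst (snd e)" "snd (snd e)"] D by simp

lemma fst_in_whites_C: "e \<in> C \<Longrightarrow> fst e \<in> whites C"
  and snd_in_blacks_C: "e \<in> C \<Longrightarrow> snd (snd e) \<in> blacks C"
  by (cases e; auto intro: in_whites in_blacks)+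

lemma inner_white_iff: "e \<in> C \<Longrightarrow> (x, c, y) \<in> F e \<Longrightarrow> x \<in> inner_whites e (F e) \<longleftrightarrow> x \<notin> whites C"
  and inner_black_iff: "e \<in> C \<Longrightarrow> (x, c, y) \<in> F e \<Longrightarrow> y \<in> inner_blacks e (F e) \<longleftrightarrow> y \<notin> blacks C"
proof -
  assume e: "e \<in> C" and f: "(x, c, y) \<in> F e"
  have "inner_whites e (F e) \<inter> whites C = {} \<and> inner_blacks e (F e) \<inter> blacks C = {}"
    using fam e unfolding family_def by blast
  then show "x \<in> inner_whites e (F e) \<longleftrightarrow> x \<notin> whites C" "y \<in> inner_blacks e (F e) \<longleftrightarrow> y \<notin> blacks C"
    using fst_in_whites_C[OF e] snd_in_blacks_C[OF e] in_whites[OF f] in_blacks[OF f]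
    unfolding inner_whites_def inner_blacks_def by blast+
qed

text \<open>Inner vertices avoid the core, so \<open>x\<close> is the white border vertex of
  \<open>F e\<close>, and a border vertex has a single colour. Thus \<open>F e\<close> takes over
  exactly the half-edge that \<open>e\<close> had.\<close>

lemma outer_white: "e \<in> C \<Longrightarrow> (x, c, y) \<in> F e \<Longrightarrow> x \<in> whites C \<Longrightarrow> x = fst e \<and> c = fst (snd e)"
  using inner_white_iff[of e x c y] F_bordered[of e] in_whites[of x c y "F e"]
    bordered_border_white_colour[of D "fst e" "fst (snd e)" "snd (snd e)" "F e" c y]
  by (auto simp: inner_whites_def)

lemma outer_black: "e \<in> C \<Longrightarrow> (x, c, y) \<in> F e \<Longrightarrow> y \<in> blacks C \<Longrightarrow> y = snd (snd e) \<and> c = fst (snd e)"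
  using inner_black_iff[of e x c y] F_bordered[of e] in_blacks[of x c y "F e"]
    bordered_border_black_colour[of D "fst e" "fst (snd e)" "snd (snd e)" "F e" x c]
  by (auto simp: inner_blacks_def)

lemma white_owner:
  assumes "e \<in> C" "(x, c, y) \<in> F e" "x \<notin> whites C" "e' \<in> C" "(x, c', y') \<in> F e'"
  shows "e' = e"
proof (rule ccontr)
  assume "e' \<noteq> e"
  then have "inner_whites e' (F e') \<inter> inner_whites e (F e) = {}"
    using fam assms(1,4) unfolding family_def by blast
  then show False using inner_white_iff assms by blast
qed

lemma black_owner:
  assumes "e \<in> C" "(x, c, y) \<in> F e" "y \<notin> blacks C" "e' \<in> C" "(x', c', y) \<in> F e'"
  shows "e' = e"
proof (rule ccontr)
  assume "e' \<noteq> e"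
  then have "inner_blacks e' (F e') \<inter> inner_blacks e (F e) = {}"
    using fam assms(1,4) unfolding family_def by blast
  then show False using inner_black_iff assms by blast
qed

text \<open>The two core vertices must be the two ends of \<open>e\<close>, so the edge joins both
  border vertices of \<open>F e\<close>, and a bordered set with such an edge contains nothing
  else.\<close>

lemma outer_edge:
  assumes e: "e \<in> C" and f: "(x, c, y) \<in> F e" "x \<in> whites C" "y \<in> blacks C"
  shows "e = (x, c, y)" "F e = {e}"
proof -
  show 1: "e = (x, c, y)"
    using outer_white[OF e f(1,2)] outer_black[OF e f(1,3)] by (simp add: prod_eq_iff)
  then show "F e = {e}" using bordered_eq_single[of D x c y "F e" c] F_bordered[OF e] f(1) by simp
qed

lemma F_disjoint:
  assumes "e \<in> C" "e' \<in> C" "f \<in> F e" "f \<in> F e'"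
  shows "e = e'"
proof -
  obtain x c y where f: "f = (x, c, y)" by (cases f)
  note e = assms(1) assms(3)[unfolded f] and e' = assms(2) assms(4)[unfolded f]
  consider "x \<notin> whites C" | "y \<notin> blacks C" | "x \<in> whites C" "y \<in> blacks C" by blast
  then show ?thesis
  proof cases
    case 1 then show ?thesis by (rule white_owner[OF e' _ e])
  next
    case 2 then show ?thesis by (rule black_owner[OF e' _ e])
  next
    case 3 then show ?thesis using outer_edge(1)[OF e] outer_edge(1)[OF e'] by simp
  qed
qed

lemma whites_C: "whites C \<subseteq> whites E" and blacks_C: "blacks C \<subseteq> blacks E"
proof -
  have "\<exists>z. (u, d, z) \<in> E" "\<exists>z. (z, d, v) \<in> E" if e: "(u, d, v) \<in> C" for u d v
    using bordered_border_white[OF F_bordered[OF e]] bordered_border_black[OF F_bordered[OF e]]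
      in_E[OF e]
    by blast+
  then show "whites C \<subseteq> whites E" "blacks C \<subseteq> blacks E" by (auto simp: whites_def blacks_def) blast+
qed

text \<open>At a core vertex the half-edges of \<open>E\<close> correspond to those of
  \<open>C\<close>, one for each colour; every other vertex has all its edges in a single
  \<open>F e\<close>. Each requirement therefore reduces to \<open>C\<close> or to one
  blow-up.\<close>

lemma E_bordered: "bordered D e\<^sub>0 E"
proof -
  obtain x\<^sub>0 c\<^sub>0 y\<^sub>0 where e0: "e\<^sub>0 = (x\<^sub>0, c\<^sub>0, y\<^sub>0)" by (cases e\<^sub>0)
  note B = C[unfolded e0]
  have ex: "\<exists>e \<in> C. f \<in> F e" if "f \<in> E" for f using that E_eq by blast
  have Fin: "\<And>e. e \<in> C \<Longrightarrow> finite (F e)" using F_bordered by (metis bordered_finite prod_cases3)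
  have "bordered D (x\<^sub>0, c\<^sub>0, y\<^sub>0) E"
  proof (rule borderedI)
    show "finite E" unfolding E_eq using bordered_finite[OF B] Fin by blast
    show "d \<le> D" if "(u, d, v) \<in> E" for u d v
      using ex[OF that] F_bordered by (metis bordered_colour prod_cases3)
    show "v = v'" if h: "(u, d, v) \<in> E" "(u, d, v') \<in> E" for u d v v'
    proof -
      obtain e e' where e: "e \<in> C" "(u, d, v) \<in> F e" and e': "e' \<in> C" "(u, d, v') \<in> F e'"
        using ex h by blast
      have "e = e'"
      proof (cases "u \<in> whites C")
        case True
        have "(u, d, snd (snd e)) \<in> C" using outer_white[OF e True] e(1) by simp
        moreover have "(u, d, snd (snd e')) \<in> C" using outer_white[OF e' True] e'(1) by simp
        ultimately have "snd (snd e) = snd (snd e')" by (rule C_white)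
        then show ?thesis
          using outer_white[OF e True] outer_white[OF e' True] by (simp add: prod_eq_iff)
      next
        case False
        then show ?thesis using white_owner[OF e' _ e] by simp
      qed
      then show ?thesis
        using e e' F_bordered[OF e(1)] bordered_white_unique[of D "fst e" "fst (snd e)"
          "snd (snd e)" "F e" u d v v']
        by simp
    qed
    show "u = u'" if h: "(u, d, v) \<in> E" "(u', d, v) \<in> E" for u u' d v
    proof -
      obtain e e' where e: "e \<in> C" "(u, d, v) \<in> F e" and e': "e' \<in> C" "(u', d, v) \<in> F e'"
        using ex h by blast
      have "e = e'"
      proof (cases "v \<in> blacks C")
        case True
        have "(fst e, d, v) \<in> C" using outer_black[OF e True] e(1) by simp
        moreover have "(fst e', d, v) \<in> C" using outer_black[OF e' True] e'(1) by simp
        ultimately have "fst e = fst e'" by (rule C_black)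
        then show ?thesis
          using outer_black[OF e True] outer_black[OF e' True] by (simp add: prod_eq_iff)
      next
        case False
        then show ?thesis using black_owner[OF e' _ e] by simp
      qed
      then show ?thesis
        using e e' F_bordered[OF e(1)] bordered_black_unique[of D "fst e" "fst (snd e)"
          "snd (snd e)" "F e" u d v u']
        by simp
    qed
    obtain y where y: "(x\<^sub>0, c\<^sub>0, y) \<in> C" using bordered_border_white[OF B] by blast
    then show "\<exists>v. (x\<^sub>0, c\<^sub>0, v) \<in> E" using bordered_border_white[OF F_bordered[OF y]] in_E[OF y]
      by blast
    obtain x where x: "(x, c\<^sub>0, y\<^sub>0) \<in> C" using bordered_border_black[OF B] by blast
    then show "\<exists>u. (u, c\<^sub>0, y\<^sub>0) \<in> E" using bordered_border_black[OF F_bordered[OF x]] in_E[OF x]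
      by blast
    show "d = c\<^sub>0" if h: "(x\<^sub>0, d, v) \<in> E" for d v
    proof -
      obtain e where e: "e \<in> C" "(x\<^sub>0, d, v) \<in> F e" using ex h by blast
      have "x\<^sub>0 \<in> whites C" using y by (rule in_whites)
      then have "x\<^sub>0 = fst e" "d = fst (snd e)" using outer_white[OF e] by simp_all
      then show ?thesis using e(1) bordered_border_white_colour[OF B, of d "snd (snd e)"] by simp
    qed
    show "d = c\<^sub>0" if h: "(u, d, y\<^sub>0) \<in> E" for u d
    proof -
      obtain e where e: "e \<in> C" "(u, d, y\<^sub>0) \<in> F e" using ex h by blast
      have "y\<^sub>0 \<in> blacks C" using x by (rule in_blacks)
      then have "y\<^sub>0 = snd (snd e)" "d = fst (snd e)" using outer_black[OF e] by simp_all
      then show ?thesis using e(1) bordered_border_black_colour[OF B, of "fst e" d] by simp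
    qed
    show "\<exists>v'. (u, d', v') \<in> E" if h: "(u, d, v) \<in> E" "u \<noteq> x\<^sub>0" "d' \<le> D" for u d v d'
    proof -
      obtain e where e: "e \<in> C" "(u, d, v) \<in> F e" using ex h by blast
      obtain p q r where pqr: "e = (p, q, r)" by (cases e)
      show ?thesis
      proof (cases "u = p")
        case True
        then obtain z where z: "(u, d', z) \<in> C" using bordered_white_full[OF B, of u q r] e h pqr
          by blast
        then show ?thesis using bordered_border_white[OF F_bordered[OF z]] in_E[OF z] by blast
      next
        case False
        then show ?thesis
          using bordered_white_full[of D p q r
            "F e" u d v d'] F_bordered[OF e(1)] e h(3) in_E[OF e(1)] pqr
          by blast
      qed
    qed
    show "\<exists>u'. (u', d', v) \<in> E" if h: "(u, d, v) \<in> E" "v \<noteq> y\<^sub>0" "d' \<le> D" for u d v d'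
    proof -
      obtain e where e: "e \<in> C" "(u, d, v) \<in> F e" using ex h by blast
      obtain p q r where pqr: "e = (p, q, r)" by (cases e)
      show ?thesis
      proof (cases "v = r")
        case True
        then obtain z where z: "(z, d', v) \<in> C" using bordered_black_full[OF B, of p q v] e h pqr
          by blast
        then show ?thesis using bordered_border_black[OF F_bordered[OF z]] in_E[OF z] by blast
      next
        case False
        then show ?thesis
          using bordered_black_full[of D p q r
            "F e" u d v d'] F_bordered[OF e(1)] e h(3) in_E[OF e(1)] pqr
          by blast
      qed
    qed
    fix P :: "'a \<Rightarrow> bool" and Q assume PQ: "\<And>u d v. (u, d, v) \<in> E \<Longrightarrow> P u = Q v"
    \<comment> \<open>A compatible two-colouring is constant on each blow-up, in particular equal at
      both ends of \<open>e\<close>, so it restricts to a compatible two-colouring of the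
      core.\<close>
    have F_const: "P (fst e) = Q (snd (snd e)) \<and> (\<forall>u d v. (u, d, v) \<in> F e \<longrightarrow> P u = P (fst e))"
      if e: "e \<in> C" for e
    proof -
      obtain p q r where pqr: "e = (p, q, r)" by (cases e)
      have b: "bordered D (p, q, r) (F e)" using F_bordered[OF e] pqr by simp
      have PQF: "P u = Q v" if "(u, d, v) \<in> F e" for u d v using PQ in_E[OF e] that by blast
      obtain z where z: "\<And>x c y. (x, c, y) \<in> F e \<Longrightarrow> P x = z \<and> Q y = z"
        by (rule bordered_connected[OF b, of P Q], erule PQF, rule that)
      have "P p = z" "Q r = z" using bordered_border_white[OF b] bordered_border_black[OF b] z by blast+
      then show ?thesis using z pqr by simp
    qed
    have PQC: "P u = Q v" if "(u, d, v) \<in> C" for u d v using F_const[OF that] by simp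
    obtain z where z: "\<And>x c y. (x, c, y) \<in> C \<Longrightarrow> P x = z \<and> Q y = z"
      by (rule bordered_connected[OF B, of P Q], erule PQC, rule that)
    have "P u = z" if h: "(u, d, v) \<in> E" for u d v
    proof -
      obtain e where e: "e \<in> C" "(u, d, v) \<in> F e" using ex h by blast
      have "P u = P (fst e)" using F_const[OF e(1)] e(2) by blast
      then show ?thesis using z[of "fst e" "fst (snd e)" "snd (snd e)"] e(1) by simp
    qed
    then show "\<exists>z. \<forall>u d v. (u, d, v) \<in> E \<longrightarrow> P u = z" by (intro exI[of _ z]) simp
  qed
  then show ?thesis by (simp add: e0)
qed

text \<open>With both vertices in the core, all parallel edges would be core edges and form a melon
  there. So one vertex is inner to some \<open>F e\<close>, which thereby contains all the parallel
  edges. A melon does not touch the border, hence both vertices are inner and \<open>F e\<close>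
  contains every edge at \<open>w\<close> and at \<open>b\<close>.\<close>

lemma melon_in_family:
  assumes m: "melon_at D w b c E" and nm: "no_melon D C"
  obtains (inside) e where "e \<in> C" "melon_at D w b c (F e)"
    "\<And>d v. (w, d, v) \<in> E \<Longrightarrow> (w, d, v) \<in> F e" "\<And>d u. (u, d, b) \<in> E \<Longrightarrow> (u, d, b) \<in> F e"
proof -
  have cD: "c \<le> D" and par: "\<And>d. d \<le> D \<Longrightarrow> d \<noteq> c \<Longrightarrow> (w, d, b) \<in> E"
    using m by (auto simp: melon_at_def)
  obtain d where d: "d \<le> D" "d \<noteq> c" "d \<noteq> c" by (rule exists_third_colour[OF D])
  obtain e where e: "e \<in> C" "(w, d, b) \<in> F e" using par[OF d(1) d(2)] E_eq by blast
  show thesis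
  proof (cases "w \<in> whites C \<and> b \<in> blacks C")
    case True
    have "(w, d, b) \<in> C" if h: "d \<le> D" "d \<noteq> c" for d
    proof -
      obtain e where e: "e \<in> C" "(w, d, b) \<in> F e" using par[OF h] E_eq by blast
      then show ?thesis using outer_edge(1)[OF e] True by simp
    qed
    then have "melon_at D w b c C" using cD by (simp add: melon_at_def)
    then show thesis using nm by (auto simp: no_melon_def)
  next
    case False
    then have own: "e' = e" if "e' \<in> C" "(w, d', b) \<in> F e'" for e' d'
      using white_owner[OF e _ that] black_owner[OF e _ that] by blast
    have "(w, d', b) \<in> F e" if "d' \<le> D" "d' \<noteq> c" for d'
      using par[OF that] own E_eq by blast
    then have me: "melon_at D w b c (F e)" using cD by (simp add: melon_at_def)
    have "w \<noteq> fst e" "b \<noteq> snd (snd e)"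
      using melon_at_border[of D "fst e" "fst (snd e)" "snd (snd e)"] F_bordered[OF e(1)] me D
        by simp_all
    then have "w \<notin> whites C" "b \<notin> blacks C" using outer_white[OF e] outer_black[OF e] by blast+
    then have own': "\<And>e' c y. e' \<in> C \<Longrightarrow> (w, c, y) \<in> F e' \<Longrightarrow> e' = e"
      "\<And>e' c x. e' \<in> C \<Longrightarrow> (x, c, b) \<in> F e' \<Longrightarrow> e' = e"
      using white_owner[OF e] black_owner[OF e] by blast+
    show thesis
    proof (rule inside[OF e(1) me])
      show "(w, d, v) \<in> F e" if "(w, d, v) \<in> E" for d v using that own'(1) E_eq by blast
      show "(u, d, b) \<in> F e" if "(u, d, b) \<in> E" for d u using that own'(2) E_eq by blast
    qed
  qed
qed

text \<open>\<open>W\<close> and \<open>B\<close> hold the vertices that the change of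
  \<open>F e\<close> introduces: the two vertices of an inserted melon, or none for a contraction.
  As they are foreign to \<open>E\<close>, no disjointness condition can break.\<close>

lemma family_upd:
  assumes e: "e \<in> C" and T: "blowup D e T"
    and w: "whites T \<subseteq> whites (F e) \<union> W" and b: "blacks T \<subseteq> blacks (F e) \<union> B"
    and W: "W \<inter> whites E = {}" and B: "B \<inter> blacks E = {}"
    and E': "E' = (\<Union>d \<in> C - {e}. F d) \<union> T"
  shows "family D C (F(e := T)) E'"
proof -
  have sub: "whites (F d) \<subseteq> whites E" "blacks (F d) \<subseteq> blacks E" if "d \<in> C" for d
    using in_E[OF that] by (auto simp: whites_def blacks_def) blast+
  have iw: "inner_whites e T \<subseteq> inner_whites e (F e) \<union> W" and ib:
    "inner_blacks e T \<subseteq> inner_blacks e (F e) \<union> B"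
    using w b by (auto simp: inner_whites_def inner_blacks_def)
  have sub': "inner_whites d (F d) \<inter> W = {}" "inner_blacks d (F d) \<inter> B = {}" if "d \<in> C" for d
    using sub[OF that] W B by (auto simp: inner_whites_def inner_blacks_def)
  have subC: "whites C \<inter> W = {}" "blacks C \<inter> B = {}" using whites_C blacks_C W B by auto
  have f1: "inner_whites d (F d) \<inter> whites C = {}" "inner_blacks d (F d) \<inter> blacks C = {}" if "d \<in> C" for d
    using fam that unfolding family_def by blast+
  have f2: "inner_whites d (F d) \<inter> inner_whites d' (F d') =
    {}" "inner_blacks d (F d) \<inter> inner_blacks d' (F d') = {}"
    if "d \<in> C" "d' \<in> C" "d \<noteq> d'" for d d'
    using fam that unfolding family_def by blast+
  show ?thesis
    unfolding family_def
  proof (intro conjI ballI impI)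
    show "E' = (\<Union>d \<in> C. (F(e := T)) d)" using E' e by (auto split: if_splits)
    show "blowup D d ((F(e := T)) d)" if "d \<in> C" for d using F_blowup[OF that] T by simp
    show "inner_whites d ((F(e := T)) d) \<inter> whites C = {}" if "d \<in> C" for d
      using f1(1)[OF that] iw subC by auto
    show "inner_blacks d ((F(e := T)) d) \<inter> blacks C = {}" if "d \<in> C" for d
      using f1(2)[OF that] ib subC by auto
    show "inner_whites d ((F(e := T)) d) \<inter> inner_whites d' ((F(e := T)) d') = {}"
      if "d \<in> C" "d' \<in> C" "d \<noteq> d'" for d d'
      using f2(1)[OF that] iw sub'(1)[OF that(1)] sub'(1)[OF that(2)] that by auto
    show "inner_blacks d ((F(e := T)) d) \<inter> inner_blacks d' ((F(e := T)) d') = {}"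
      if "d \<in> C" "d' \<in> C" "d \<noteq> d'" for d d'
      using f2(2)[OF that] ib sub'(2)[OF that(1)] sub'(2)[OF that(2)] that by auto
  qed
qed

lemma family_ins:
  assumes e: "e \<in> C" and f: "f \<in> F e" and fr: "fresh w b E"
  shows "family D C (F(e := ins D w b f (F e))) (ins D w b f E)"
proof (rule family_upd[OF e])
  have frF: "fresh w b (F e)" using fr in_E[OF e] by (auto simp: fresh_def)
  show "blowup D e (ins D w b f (F e))" using F_blowup[OF e] f frF by (rule blowup.ins)
  obtain x c y where xcy: "f = (x, c, y)" by (cases f)
  show "whites (ins D w b f (F e)) \<subseteq> whites (F e) \<union> {w}"
    "blacks (ins D w b f (F e)) \<subseteq> blacks (F e) \<union> {b}"
    using f by (auto simp: whites_def blacks_def xcy in_ins)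
  show "{w} \<inter> whites E = {}" "{b} \<inter> blacks E = {}"
    by (auto simp: whites_def blacks_def fresh_simps[OF fr])
  have "f \<notin> F d" if "d \<in> C - {e}" for d using F_disjoint[of d e f] e f that by blast
  then show "ins D w b f E = (\<Union>d \<in> C - {e}. F d) \<union> ins D w b f (F e)"
    unfolding E_eq using e by (auto simp: ins_def xcy)
qed

text \<open>The last two assumptions confine all edges at \<open>w\<close> and \<open>b\<close> to
  \<open>F e\<close>, so contracting in the union is the same as contracting in this single
  member.\<close>

lemma family_del:
  assumes e: "e \<in> C" and m: "melon_at D w b c (F e)"
    and w: "\<And>d v. (w, d, v) \<in> E \<Longrightarrow> (w, d, v) \<in> F e" and b: "\<And>d u. (u, d, b) \<in> E \<Longrightarrow> (u, d, b) \<in> F e"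
  shows "family D C (F(e := del w b (F e))) (del w b E)"
proof (rule family_upd[OF e, where W = "{}" and B = "{}"])
  have "fst (snd e) \<le> D" using C_colour[of "fst e" "fst (snd e)" "snd (snd e)"] e by simp
  then show "blowup D e (del w b (F e))" using blowup_del[OF F_blowup[OF e] m] D by blast
  show "whites (del w b (F e)) \<subseteq> whites (F e) \<union> {}" "blacks (del w b (F e)) \<subseteq> blacks (F e) \<union> {}"
    by (auto simp: whites_def blacks_def in_del)
  have 1: "(w, d, v) \<in> E \<longleftrightarrow> (w, d, v) \<in> F e" "(u, d, b) \<in> E \<longleftrightarrow> (u, d, b) \<in> F e" for u d v
    using w b in_E[OF e] by blast+
  obtain d where d: "d \<le> D" "d \<noteq> c" "d \<noteq> c" by (rule exists_third_colour[OF D])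
  have wb: "(w, d, b) \<in> F e" using m d by (simp add: melon_at_def)
  have w0: "w \<noteq> fst e" "b \<noteq> snd (snd e)"
    using melon_at_border[of D "fst e" "fst (snd e)" "snd (snd e)"] F_bordered[OF e] m D by simp_all
  have "w \<notin> whites C" "b \<notin> blacks C" using outer_white[OF e wb] outer_black[OF e wb] w0 by blast+
  then have 2: "u \<noteq> w \<and> v \<noteq> b" if h: "d' \<in> C - {e}" "(u, d, v) \<in> F d'" for u d v d'
    using h white_owner[OF e wb] black_owner[OF e wb] by blast
  have "(u, d, v) \<in> del w b E \<longleftrightarrow> (\<exists>d' \<in> C - {e}. (u, d, v) \<in> F d') \<or> (u, d, v) \<in> del w b (F e)" for u d v
  proof -
    have "(u, d, v) \<in> E \<longleftrightarrow> (\<exists>d' \<in> C - {e}. (u, d, v) \<in> F d') \<or> (u, d, v) \<in> F e"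
      unfolding E_eq using e by blast
    then show ?thesis unfolding in_del 1 using 2 by blast
  qed
  then show "del w b E = (\<Union>d \<in> C - {e}. F d) \<union> del w b (F e)" by (auto simp: set_eq_iff)
qed auto

end

text \<open>
  A melonic subgraph contains a melon; removing this melon leads to a smaller blow-up of the same
  core.
\<close>

lemma (in blown_up) blowup_in_family:
  assumes nm: "no_melon D C" and S: "blowup D s S" "S \<subseteq> E" "S \<noteq> {s}"
  shows "\<exists>e \<in> C. S \<subseteq> F e"
  using S fam
proof (induction arbitrary: F E rule: blowup.induct)
  case single
  then show ?case by simp
next
  case (ins S f w b F E)
  interpret blown_up D e\<^sub>0 C F E by (rule blown_up.intro[OF D C ins.prems(3)])
  obtain x c y where f: "f = (x, c, y)" by (cases f)
  let ?S = "ins D w b f S"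
  have new: "(x, c, b) \<in> ?S" "(w, c, y) \<in> ?S" "\<And>d. d \<le> D \<Longrightarrow> d \<noteq> c \<Longrightarrow> (w, d, b) \<in> ?S"
    unfolding f by (auto simp: in_ins)
  obtain x\<^sub>0 c\<^sub>0 y\<^sub>0 where e0: "e\<^sub>0 = (x\<^sub>0, c\<^sub>0, y\<^sub>0)" by (cases e\<^sub>0)
  note B = E_bordered[unfolded e0]
  \<comment> \<open>The melon inserted last into \<open>S\<close> is also a melon of
    \<open>E\<close>; its attaching edge supplies the bound on \<open>c\<close>.\<close>
  have "(x, c, b) \<in> E" using new(1) ins.prems(1) by blast
  then have m: "melon_at D w b c E"
    using new(3) ins.prems(1) bordered_colour[OF B] by (auto simp: melon_at_def)
  obtain e where e: "e \<in> C" "melon_at D w b c (F e)"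
    and full: "\<And>d v. (w, d, v) \<in> E \<Longrightarrow> (w, d, v) \<in> F e" "\<And>d u. (u, d, b) \<in> E \<Longrightarrow> (u, d, b) \<in> F e"
    by (rule melon_in_family[OF m nm]) blast
  have xy: "(x, c, b) \<in> F e" "(w, c, y) \<in> F e" using full new ins.prems(1) by blast+
  have xyn: "x \<noteq> w" "y \<noteq> b" using freshD[OF ins.hyps(3)] ins.hyps(2) f by blast+
  note delF = in_del_melon[OF F_bordered[OF e(1)] e(2) xy(1) xyn(1) xy(2) xyn(2)]
  note fam' = family_del[OF e full]
  interpret del: blown_up D e\<^sub>0 C "F(e := del w b (F e))" "del w b E"
    by (rule blown_up.intro[OF D C fam'])
  have inc: "z \<in> F e" if "z \<in> ?S" "z \<notin> S" for z
  proof -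
    obtain u d v where uv: "z = (u, d, v)" by (cases z)
    have "z \<in> E" using that ins.prems(1) by blast
    moreover have "u = w \<or> v = b" using that unfolding uv f in_ins by blast
    ultimately show ?thesis using full uv by blast
  qed
  \<comment> \<open>The insertion removed \<open>f\<close>, so \<open>f\<close> is not covered by
    the inclusion of \<open>?S\<close> in \<open>E\<close>, but the contraction of \<open>E\<close>
    creates it.\<close>
  have sub: "S \<subseteq> del w b E"
  proof
    fix z assume z: "z \<in> S"
    obtain u d v where uv: "z = (u, d, v)" by (cases z)
    show "z \<in> del w b E"
    proof (cases "z = f")
      case True
      then show ?thesis using xy xyn in_E[OF e(1)] uv f by (auto simp: in_del)
    next
      case False
      then have "z \<in> ?S" using z uv f by (auto simp: in_ins)
      then show ?thesis using ins.prems(1) freshD[OF ins.hyps(3)] z uv by (auto simp: in_del)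
    qed
  qed
  show ?case
  proof (cases "S = {s}")
    \<comment> \<open>\<open>S\<close> consists of the edge \<open>f\<close> alone, so every edge of
      \<open>?S\<close> is new and touches \<open>w\<close> or \<open>b\<close>.\<close>
    case True
    then have "z \<notin> ?S" if "z \<in> S" for z
      using that ins.hyps(2,3) xyn by (auto simp: in_ins f)
    then show ?thesis using inc e(1) by blast
  next
    case False
    from ins.IH[OF sub False fam'] obtain e' where e': "e' \<in> C" "S \<subseteq> (F(e := del w b (F e))) e'" by blast
    \<comment> \<open>\<open>f\<close> identifies the member found by induction: it is an edge of
      the contracted \<open>F e\<close> and also of the member that contains \<open>S\<close>, and
      members are disjoint.\<close>
    have "f \<in> del w b (F e)" using delF f by simp
    then have fe: "f \<in> (F(e := del w b (F e))) e" by simp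
    have "f \<in> (F(e := del w b (F e))) e'" using e'(2) ins.hyps(2) by (rule subsetD)
    then have ee: "e' = e" using fe by (rule del.F_disjoint[OF e'(1) e(1)])
    have "z \<in> F e" if z: "z \<in> ?S" "z \<in> S" for z
    proof -
      obtain u d v where uv: "z = (u, d, v)" by (cases z)
      have "z \<noteq> f" using z(1) xyn uv f by (auto simp: in_ins)
      moreover have "z \<in> del w b (F e)" using subsetD[OF e'(2) z(2)] ee by simp
      ultimately show ?thesis using delF[of u d v] unfolding uv f by blast
    qed
    then show ?thesis using inc e(1) by blast
  qed
qed

text \<open>\<open>\<phi>\<close> will be the degree.\<close>

lemma exists_family:
  fixes \<phi> :: "('a \<times> nat \<times> 'b) set \<Rightarrow> 'c"
  assumes D: "2 \<le> D" and E: "bordered D e\<^sub>0 E"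
    and \<phi>: "\<And>E f w b. bordered D e\<^sub>0 E \<Longrightarrow> f \<in> E \<Longrightarrow> fresh w b E \<Longrightarrow> \<phi> (ins D w b f E) = \<phi> E"
  shows "\<exists>C F. bordered D e\<^sub>0 C \<and> no_melon D C \<and> family D C F E \<and> \<phi> C = \<phi> E"
  using E
proof (induction "card E" arbitrary: E rule: less_induct)
  case less
  obtain x\<^sub>0 c\<^sub>0 y\<^sub>0 where e0: "e\<^sub>0 = (x\<^sub>0, c\<^sub>0, y\<^sub>0)" by (cases e\<^sub>0)
  note B = less.prems[unfolded e0]
  show ?case
  proof (cases "no_melon D E")
    case True
    have "family D E (\<lambda>e. {e}) E"
      by (auto simp: family_def inner_whites_def inner_blacks_def whites_def blacks_def intro:
        blowup.single)
    then show ?thesis using True less.prems by blast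
  next
    case False
    then obtain w b c where m: "melon_at D w b c E" by (auto simp: no_melon_def)
    obtain x y where xy: "(x, c, b) \<in> E" "x \<noteq> w" "(w, c, y) \<in> E" "y \<noteq> b"
      by (rule melon_at_outer[OF D B m]) blast
    let ?E = "del w b E"
    note ins = ins_del[OF less.prems m xy]
    have b': "bordered D e\<^sub>0 ?E" using bordered_del[OF D less.prems m] .
    \<comment> \<open>Contraction loses at least the two attaching edges and gains only one, so the
      number of edges decreases.\<close>
    have "?E \<subseteq> insert (x, c, y) (E - {(x, c, b), (w, c, y)})"
    proof
      fix z assume z: "z \<in> ?E"
      obtain u d v where uv: "z = (u, d, v)" by (cases z)
      show "z \<in> insert (x, c, y) (E - {(x, c, b), (w, c, y)})"
        using z[unfolded uv in_del_melon[OF less.prems m xy]] uv by auto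
    qed
    then have "card ?E \<le> card (insert (x, c, y) (E - {(x, c, b), (w, c, y)}))"
      using bordered_finite[OF B] by (intro card_mono) auto
    also have "\<dots> \<le> Suc (card (E - {(x, c, b), (w, c, y)}))"
      by (simp add: card_insert_if bordered_finite[OF B])
    also have "\<dots> = Suc (card E - 2)"
      using xy bordered_finite[OF B] by (subst card_Diff_subset) auto
    also have "\<dots> < card E"
      using card_mono[OF bordered_finite[OF B], of "{(x, c, b), (w, c, y)}"] xy by auto
    finally obtain C F where CF: "bordered D e\<^sub>0 C" "no_melon D C" "family D C F ?E" "\<phi> C = \<phi> ?E"
      using less.hyps[OF _ b'] by blast
    interpret blown_up D e\<^sub>0 C F ?E by (rule blown_up.intro[OF D CF(1,3)])
    \<comment> \<open>The edge created by the contraction lies in one blow-up, and the melon is put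
      back there.\<close>
    obtain e where e: "e \<in> C" "(x, c, y) \<in> F e" using ins(2) E_eq by blast
    have "family D C (F(e := ins D w b (x, c, y) (F e))) E"
      using family_ins[OF e ins(3)] ins(1) by simp
    moreover have "\<phi> C = \<phi> E" using \<phi>[OF b' ins(2,3)] ins(1) CF(4) by simp
    ultimately show ?thesis using CF(1,2) by blast
  qed
qed

subsection \<open>Rooted graphs as bordered edge sets\<close>

lemma partial_graphD:
  assumes "partial_graph D G"
  shows "finite (white G)" "finite (black G)"
    "(w, c, b) \<in> edges G \<Longrightarrow> w \<in> white G \<and> c \<le> D \<and> b \<in> black G"
    "(w, c, b) \<in> edges G \<Longrightarrow> (w, c, b') \<in> edges G \<Longrightarrow> b = b'"
    "(w, c, b) \<in> edges G \<Longrightarrow> (w', c, b) \<in> edges G \<Longrightarrow> w = w'"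
    "connected_graph G"
  using assms unfolding partial_graph_def by blast+

lemma coloured_graphD:
  assumes "coloured_graph D G"
  shows "partial_graph D G" "w \<in> white G \<Longrightarrow> c \<le> D \<Longrightarrow> \<exists>b. (w, c, b) \<in> edges G"
    "b \<in> black G \<Longrightarrow> c \<le> D \<Longrightarrow> \<exists>w. (w, c, b) \<in> edges G"
  using assms unfolding coloured_graph_def free_white_def free_black_def by auto

lemma adj_edge: "(w, c, b) \<in> S \<Longrightarrow> (Inl w, Inr b) \<in> adj S" "(w, c, b) \<in> S \<Longrightarrow> (Inr b, Inl w) \<in> adj S"
  unfolding adj_def by blast+

lemma adj_cases:
  assumes "(u, v) \<in> adj S"
  obtains w c b where "(w, c, b) \<in> S" "u = Inl w" "v = Inr b" | w c b where "(w, c, b) \<in> S" "u =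
    Inr b" "v = Inl w"
  using assms unfolding adj_def by blast

lemma adj_mono: "S \<subseteq> S' \<Longrightarrow> adj S \<subseteq> adj S'"
  unfolding adj_def by blast

lemma adj_const:
  assumes "(u, v) \<in> (adj S)\<^sup>*" and PQ: "\<And>w c b. (w, c, b) \<in> S \<Longrightarrow> P w = Q b"
  shows "case_sum P Q u = case_sum P Q v"
  using assms(1)
proof induction
  case (step v z)
  from step(2) have "case_sum P Q v = case_sum P Q z" by (cases rule: adj_cases) (auto dest: PQ)
  then show ?case using step by simp
qed simp

text \<open>The bijection is given as a relation, which suits its uses: edges of one colour as a
  matching of white and black vertices, corresponding faces, edges against white half-edges.\<close>

lemma card_eq_matching:
  assumes "finite A" "finite B" "\<And>a. a \<in> A \<Longrightarrow> \<exists>b \<in> B. r a b" "\<And>b. b \<in> B \<Longrightarrow> \<exists>a \<in> A. r a b"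
    "\<And>a b b'. r a b \<Longrightarrow> r a b' \<Longrightarrow> b = b'" "\<And>a a' b. r a b \<Longrightarrow> r a' b \<Longrightarrow> a = a'"
  shows "card A = card B"
proof -
  obtain f where f: "\<And>a. a \<in> A \<Longrightarrow> f a \<in> B \<and> r a (f a)" using assms(3) by metis
  have "inj_on f A" by (rule inj_onI) (metis f assms(6))
  moreover have "f ` A = B"
  proof
    show "f ` A \<subseteq> B" using f by blast
    show "B \<subseteq> f ` A"
    proof
      fix b assume "b \<in> B"
      then obtain a where "a \<in> A" "r a b" using assms(4) by blast
      then show "b \<in> f ` A" using f[of a] assms(5)[of a b "f a"] by blast
    qed
  qed
  ultimately show ?thesis by (metis card_image)
qed

text \<open>Vertices of a graph become \<open>Some\<close>, which leaves \<open>None\<close> as a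
  name for the border vertices of the cut graph.\<close>

definition lift :: "edge \<Rightarrow> nat option \<times> nat \<times> nat option" where
  "lift = (\<lambda>(w, c, b). (Some w, c, Some b))"

lemma lift_simp[simp]: "lift (w, c, b) = (Some w, c, Some b)"
  by (simp add: lift_def)

lemma in_lift: "(x, c, y) \<in> lift ` S \<longleftrightarrow> (\<exists>w b. x = Some w \<and> y = Some b \<and> (w, c, b) \<in> S)"
  by (force simp: lift_def)

lemma inj_lift: "inj lift"
  by (rule injI) (auto simp: lift_def split: prod.splits)

text \<open>The root edge is cut and its halves end in the new vertices \<open>x\<close> and \<open>y\<close>.\<close>

definition unroot :: "nat option \<Rightarrow> nat option \<Rightarrow> rgraph \<Rightarrow> (nat option \<times> nat \<times> nat option) set" where
  "unroot x y R = (case R of (G, (w, c, b)) \<Rightarrow>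
     lift ` (edges G - {(w, c, b)}) \<union> {(Some w, c, y), (x, c, Some b)})"

text \<open>Border vertices are not always \<open>None\<close>, because a subgraph is bordered by
  vertices of the graph around it; they only have to differ from its own.\<close>

definition avoids :: "nat option \<Rightarrow> nat option \<Rightarrow> cgraph \<Rightarrow> bool" where
  "avoids x y G \<longleftrightarrow> x \<notin> Some ` white G \<and> y \<notin> Some ` black G"

lemma avoids_None[simp]: "avoids None None G"
  by (auto simp: avoids_def)

lemma in_unroot: "(u, d, v) \<in> unroot x y (G, (w, c, b)) \<longleftrightarrow>
    (\<exists>w' b'. u = Some w' \<and> v = Some b' \<and> (w', d, b') \<in> edges G \<and> (w', d, b') \<noteq> (w, c, b)) \<or>
    (u, d, v) = (Some w, c, y) \<or> (u, d, v) = (x, c, Some b)"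
  unfolding unroot_def prod.case Un_iff in_lift by blast

text \<open>The way back from bordered sets to open graphs: border vertices and the edges at them
  are dropped, so that the half-edges which ended there become unmatched. A single edge yields the
  empty graph.\<close>

definition graph_of :: "nat option \<times> nat \<times> nat option \<Rightarrow> (nat option \<times> nat \<times> nat option) set \<Rightarrow>
  cgraph" where
  "graph_of e T = \<lparr>white = {w. Some w \<in> inner_whites e T}, black = {b. Some b \<in> inner_blacks e T},
     edges = {(w, c, b). (Some w, c, Some b) \<in> T \<and> Some w \<noteq> fst e \<and> Some b \<noteq> snd (snd e)}\<rparr>"

text \<open>Connectedness is the property at stake: the root edge must not be a bridge. If a
  compatible two-colouring told the ends of the root edge apart, the edges of the root colour and
  those of another colour would compare the numbers of white and black vertices with one value
  differently.\<close>

lemma bordered_unroot: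
  assumes D: "1 \<le> D" and R: "rooted_graph D (G, (w, c, b))" and av: "avoids x y G"
  shows "bordered D (x, c, y) (unroot x y (G, (w, c, b)))"
proof -
  have cg: "coloured_graph D G" and root: "(w, c, b) \<in> edges G" using R by (auto simp: rooted_graph_def)
  note pg = partial_graphD[OF coloured_graphD(1)[OF cg]] and full = coloured_graphD(2,3)[OF cg]
  have xy: "x \<noteq> Some u" "y \<noteq> Some v" if "u \<in> white G" "v \<in> black G" for u v
    using av that by (auto simp: avoids_def)
  have wcb: "w \<in> white G" "c \<le> D" "b \<in> black G" using pg(3)[OF root] by auto
  let ?T = "unroot x y (G, (w, c, b))"
  have edge: "u \<in> white G \<and> d \<le> D \<and> v \<in> black G" if "(u, d, v) \<in> edges G" for u d v
    using pg(3)[OF that] .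
  have nx: "x \<noteq> Some u \<and> y \<noteq> Some v" if "(u, d, v) \<in> edges G" for u d v
    using xy edge[OF that] by blast
  show ?thesis
  proof (rule borderedI)
    have "edges G \<subseteq> white G \<times> {..D} \<times> black G" using edge by auto
    then have "finite (edges G)" by (rule finite_subset) (use pg(1,2) in simp)
    then show "finite ?T" by (simp add: unroot_def)
    show "d \<le> D" if "(u, d, v) \<in> ?T" for u d v
      using that[unfolded in_unroot] edge wcb by blast
    show "v = v'" if h: "(u, d, v) \<in> ?T" "(u, d, v') \<in> ?T" for u d v v'
      using h nx[OF root] by (auto simp: in_unroot dest: nx pg(4) pg(4)[OF root])
    show "u = u'" if h: "(u, d, v) \<in> ?T" "(u', d, v) \<in> ?T" for u u' d v
      using h nx[OF root] by (auto simp: in_unroot dest: nx pg(5) pg(5)[OF root])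
    show "\<exists>v. (x, c, v) \<in> ?T" "\<exists>u. (u, c, y) \<in> ?T" by (auto simp: in_unroot)
    show "d = c" if "(x, d, v) \<in> ?T" for d v
      using that by (auto simp: in_unroot dest: nx)
    show "d = c" if "(u, d, y) \<in> ?T" for u d
      using that by (auto simp: in_unroot dest: nx)
    show "\<exists>v'. (u, d', v') \<in> ?T" if h: "(u, d, v) \<in> ?T" "u \<noteq> x" "d' \<le> D" for u d v d'
    proof -
      obtain u' where u': "u = Some u'" "u' \<in> white G" using h(1,2)[unfolded in_unroot] edge wcb by blast
      obtain v' where "(u', d', v') \<in> edges G" using full(1)[OF u'(2) h(3)] by blast
      then show ?thesis using u' unfolding in_unroot by blast
    qed
    show "\<exists>u'. (u', d', v) \<in> ?T" if h: "(u, d, v) \<in> ?T" "v \<noteq> y" "d' \<le> D" for u d v d'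
    proof -
      obtain v' where v': "v = Some v'" "v' \<in> black G" using h(1,2)[unfolded in_unroot] edge wcb by blast
      obtain u' where "(u', d', v') \<in> edges G" using full(2)[OF v'(2) h(3)] by blast
      then show ?thesis using v' unfolding in_unroot by blast
    qed
    fix P :: "nat option \<Rightarrow> bool" and Q assume PQ: "\<And>u d v. (u, d, v) \<in> ?T \<Longrightarrow> P u = Q v"
    have PQ': "P (Some u) = Q (Some v)" if "(u, d, v) \<in> edges G" "(u, d, v) \<noteq> (w, c, b)" for u d v
      using PQ[of "Some u" d "Some v"] that by (simp add: in_unroot)
    define A where "A = {u \<in> white G. P (Some u)}"
    define B where "B = {v \<in> black G. Q (Some v)}"
    have fin: "finite A" "finite B" using pg(1,2) by (simp_all add: A_def B_def)
    text \<open>Each colour other than that of the root edge matches \<open>A\<close> with \<open>B\<close>.\<close>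
    obtain d where d: "d \<le> D" "d \<noteq> c" using D by (metis le0 not_one_le_zero)
    have "card A = card B"
    proof (rule card_eq_matching[where r = "\<lambda>u v. (u, d, v) \<in> edges G"])
      show "\<exists>v \<in> B. (u, d, v) \<in> edges G" if u: "u \<in> A" for u
      proof -
        obtain v where v: "(u, d, v) \<in> edges G" using full(1)[of u d] u d by (auto simp: A_def)
        then show ?thesis using PQ'[of u d v] edge[OF v] u d by (auto simp: A_def B_def)
      qed
      show "\<exists>u \<in> A. (u, d, v) \<in> edges G" if v: "v \<in> B" for v
      proof -
        obtain u where u: "(u, d, v) \<in> edges G" using full(2)[of v d] v d by (auto simp: B_def)
        then show ?thesis using PQ'[of u d v] edge[OF u] v d by (auto simp: A_def B_def)
      qed
    qed (fact fin | erule (1) pg(4) | erule (1) pg(5))+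
    \<comment> \<open>Away from the ends of the root edge the root colour also matches
      \<open>A\<close> with \<open>B\<close>. Comparison with \<open>card A = card B\<close> shows
      that \<open>w\<close> belongs to \<open>A\<close> iff \<open>b\<close> belongs to
      \<open>B\<close>.\<close>
    moreover have "card (A - {w}) = card (B - {b})"
    proof (rule card_eq_matching[where r = "\<lambda>u v. (u, c, v) \<in> edges G"])
      show "\<exists>v \<in> B - {b}. (u, c, v) \<in> edges G" if u: "u \<in> A - {w}" for u
      proof -
        obtain v where v: "(u, c, v) \<in> edges G" using full(1)[of u c] u wcb by (auto simp: A_def)
        then have "v \<noteq> b" using pg(5)[OF root, of u] u by auto
        then show ?thesis using PQ'[of u c v] v edge[OF v] u by (auto simp: A_def B_def)
      qed
      show "\<exists>u \<in> A - {w}. (u, c, v) \<in> edges G" if v: "v \<in> B - {b}" for v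
      proof -
        obtain u where u: "(u, c, v) \<in> edges G" using full(2)[of v c] v wcb by (auto simp: B_def)
        then have "u \<noteq> w" using pg(4)[OF root, of v] v by auto
        then show ?thesis using PQ'[of u c v] u edge[OF u] v by (auto simp: A_def B_def)
      qed
      show "finite (A - {w})" "finite (B - {b})" using fin by auto
    qed (erule (1) pg(4) | erule (1) pg(5))+
    ultimately have "w \<in> A \<longleftrightarrow> b \<in> B"
      using fin card_gt_0_iff[of A] card_gt_0_iff[of B]
      by (cases "w \<in> A"; cases "b \<in> B") (auto simp: card_Diff_singleton_if)
    then have PQr: "P (Some w) = Q (Some b)" using wcb by (simp add: A_def B_def)
    then have PQG: "(P \<circ> Some) u = (Q \<circ> Some) v" if "(u, d, v) \<in> edges G" for u d v
      using PQ'[OF that] by (cases "(u, d, v) = (w, c, b)") auto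
    have con: "case_sum (P \<circ> Some) (Q \<circ> Some) v = P (Some w)" if "v \<in> vertices G" for v
    proof -
      have "(Inl w, v) \<in> (adj (edges G))\<^sup>*"
        using pg(6) that wcb(1) unfolding connected_graph_def vertices_def by blast
      from adj_const[OF this, of "P \<circ> Some" "Q \<circ> Some", OF PQG] show ?thesis by simp
    qed
    have "P u = P (Some w)" if h: "(u, d, v) \<in> ?T" for u d v
    proof -
      consider u' where "u = Some u'" "u' \<in> white G" | "u = x" "v = Some b"
        using h[unfolded in_unroot] edge wcb by blast
      then show ?thesis
      proof cases
        case 1
        then show ?thesis using con[of "Inl u'"] by (simp add: vertices_def InlI)
      next
        case 2
        then show ?thesis using PQ[OF h] PQr by simp
      qed
    qed
    then show "\<exists>z. \<forall>u d v. (u, d, v) \<in> ?T \<longrightarrow> P u = z" by (intro exI[of _ "P (Some w)"]) simp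
  qed
qed

lemma op_graph_simps[simp]:
  "white (op_graph R) = white (fst R)" "black (op_graph R) = black (fst R)"
  "edges (op_graph R) = edges (fst R) - {snd R}"
  by (simp_all add: op_graph_def)

text \<open>Reachability from \<open>u\<close> in the cut graph is a two-colouring. Continued to the
  border it is compatible with all edges of the bordered set, hence constant, and it holds at
  \<open>u\<close>.\<close>

lemma connected_op_graph:
  assumes T: "bordered D (x, c, y) (unroot x y (G, (w, c, b)))" and av: "avoids x y G"
    and sub: "edges G \<subseteq> white G \<times> {..D} \<times> black G"
    and root: "(w, c, b) \<in> edges G"
    and cov: "\<And>w. w \<in> white G \<Longrightarrow> \<exists>c b. (w, c, b) \<in> edges G" "\<And>b. b \<in> black G \<Longrightarrow> \<exists>c w. (w, c, b) \<in> edges G"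
  shows "connected_graph (op_graph (G, (w, c, b)))"
  unfolding connected_graph_def
proof (intro ballI)
  let ?S = "edges (op_graph (G, (w, c, b)))" and ?T = "unroot x y (G, (w, c, b))"
  fix u v assume u: "u \<in> vertices (op_graph (G, (w, c, b)))" and v:
    "v \<in> vertices (op_graph (G, (w, c, b)))"
  have xy: "x \<noteq> Some u" "y \<noteq> Some v" if "u \<in> white G" "v \<in> black G" for u v
    using av that by (auto simp: avoids_def)
  have wcb: "w \<in> white G" "b \<in> black G" using sub root by auto
  define p where "p u' \<longleftrightarrow> (u, Inl u') \<in> (adj ?S)\<^sup>*" for u'
  define q where "q v' \<longleftrightarrow> (u, Inr v') \<in> (adj ?S)\<^sup>*" for v'
  have pq: "p u' = q v'" if "(u', d, v') \<in> ?S" for u' d v'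
    unfolding p_def q_def using adj_edge[OF that] by (blast intro: rtrancl_into_rtrancl)
  \<comment> \<open>The border vertices take the value of their only neighbour: \<open>x\<close>
    that of \<open>b\<close>, and \<open>y\<close> that of \<open>w\<close>.\<close>
  define P where "P z \<longleftrightarrow> (if z = x then q b else p (the z))" for z
  define Q where "Q z \<longleftrightarrow> (if z = y then p w else q (the z))" for z
  have PS: "P (Some u') = p u'" if "u' \<in> white G" for u' using xy(1)[OF that wcb(2)] by (simp add: P_def)
  have QS: "Q (Some v') = q v'" if "v' \<in> black G" for v' using xy(2)[OF wcb(1) that] by (simp add: Q_def)
  have PQ: "P u' = Q v'" if h: "(u', d, v') \<in> ?T" for u' d v'
    using h unfolding in_unroot
  proof (elim disjE exE conjE)
    fix w' b' assume *: "u' = Some w'" "v' = Some b'" "(w', d, b') \<in> edges G" "(w', d, b') \<noteq> (w, c, b)"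
    then have "w' \<in> white G" "b' \<in> black G" using sub by auto
    then show ?thesis using * PS QS pq[of w' d b'] by simp
  next
    assume *: "(u', d, v') = (Some w, c, y)"
    then show ?thesis using PS[OF wcb(1)] by (simp add: Q_def)
  next
    assume *: "(u', d, v') = (x, c, Some b)"
    then show ?thesis using QS[OF wcb(2)] by (simp add: P_def)
  qed
  obtain z where z: "\<And>x c y. (x, c, y) \<in> ?T \<Longrightarrow> P x = z \<and> Q y = z"
    by (rule bordered_connected[OF T, of P Q], erule PQ, rule that)
  have pz: "p u' = z" if h: "u' \<in> white G" for u'
  proof -
    obtain d v' where e: "(u', d, v') \<in> edges G" using cov(1)[OF h] by blast
    have "\<exists>v''. (Some u', d, v'') \<in> ?T" using e unfolding in_unroot by blast
    then show ?thesis using z PS[OF h] by metis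
  qed
  have qz: "q v' = z" if h: "v' \<in> black G" for v'
  proof -
    obtain d u' where e: "(u', d, v') \<in> edges G" using cov(2)[OF h] by blast
    have "\<exists>u''. (u'', d, Some v') \<in> ?T" using e unfolding in_unroot by blast
    then show ?thesis using z QS[OF h] by metis
  qed
  have uz: "(u, v') \<in> (adj ?S)\<^sup>* \<longleftrightarrow> z" if "v' \<in> vertices G" for v'
    using that pz qz unfolding p_def q_def vertices_def by auto
  have "z" using uz[of u] u by (simp add: vertices_def)
  then show "(u, v) \<in> (adj ?S)\<^sup>*" using uz[of v] v by (simp add: vertices_def)
qed

text \<open>Converse of \<open>bordered_unroot\<close>, and the way in which new graphs are
  recognised as rooted: regularity and connectedness are shown on bordered sets, where insertion is
  a uniform operation, and carried back. The covering assumptions exclude vertices without edges,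
  which an edge set cannot see.\<close>

lemma rooted_if_bordered:
  assumes T: "bordered D (x, c, y) (unroot x y (G, (w, c, b)))" and av: "avoids x y G"
    and sub: "edges G \<subseteq> white G \<times> {..D} \<times> black G"
    and root: "(w, c, b) \<in> edges G"
    and cov: "\<And>w. w \<in> white G \<Longrightarrow> \<exists>c b. (w, c, b) \<in> edges G" "\<And>b. b \<in> black G \<Longrightarrow> \<exists>c w. (w, c, b) \<in> edges G"
  shows "rooted_graph D (G, (w, c, b))"
proof -
  let ?T = "unroot x y (G, (w, c, b))"
  have xy: "x \<noteq> Some u" "y \<noteq> Some v" if "u \<in> white G" "v \<in> black G" for u v
    using av that by (auto simp: avoids_def)
  have wcb: "w \<in> white G" "b \<in> black G" using sub root by auto
  have sub': "u \<in> white G \<and> v \<in> black G" if "(u, d, v) \<in> edges G" for u d v using sub that by auto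
  have "lift ` (edges G - {(w, c, b)}) \<subseteq> ?T" by (auto simp: unroot_def)
  then have "finite (lift ` (edges G - {(w, c, b)}))" using bordered_finite[OF T] by (rule finite_subset)
  then have "finite (edges G - {(w, c, b)})" using inj_lift
    by (metis finite_imageD inj_on_subset subset_UNIV)
  then have fin: "finite (edges G)" by simp
  have "white G \<subseteq> fst ` edges G" "black G \<subseteq> (\<lambda>e. snd (snd e)) ` edges G" using cov by force+
  then have fin': "finite (white G)" "finite (black G)" using fin by (meson finite_imageI finite_subset)+
  have old: "(Some u, d, Some v) \<in> ?T" if "(u, d, v) \<in> edges G" "(u, d, v) \<noteq> (w, c, b)" for u d v
    using that unfolding in_unroot by blast
  have new: "(Some w, c, y) \<in> ?T" "(x, c, Some b) \<in> ?T" by (auto simp: in_unroot)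
  have wu: "v = b" if "(w, c, v) \<in> edges G" for v
    using old[OF that] bordered_white_unique[OF T new(1), of
      "Some v"] xy(2)[OF wcb(1), of v] sub'[OF that] by auto
  have bu: "u = w" if "(u, c, b) \<in> edges G" for u
    using old[OF that] bordered_black_unique[OF T new(2), of
      "Some u"] xy(1)[OF _ wcb(2), of u] sub'[OF that] by auto
  have uw: "v = v'" if h: "(u, d, v) \<in> edges G" "(u, d, v') \<in> edges G" for u d v v'
  proof (cases "u = w \<and> d = c")
    case True
    then show ?thesis using wu h by blast
  next
    case False
    then show ?thesis using old[OF h(1)] old[OF h(2)] bordered_white_unique[OF T, of "Some u" d
      "Some v" "Some v'"] by auto
  qed
  have ub: "u = u'" if h: "(u, d, v) \<in> edges G" "(u', d, v) \<in> edges G" for u u' d v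
  proof (cases "v = b \<and> d = c")
    case True
    then show ?thesis using bu h by blast
  next
    case False
    then show ?thesis using old[OF h(1)] old[OF h(2)] bordered_black_unique[OF T, of "Some u" d
      "Some v" "Some u'"] by auto
  qed
  have "connected_graph (op_graph (G, (w, c, b)))" by (rule connected_op_graph[OF assms])
  then have con: "connected_graph G"
    using rtrancl_mono[OF adj_mono, of "edges G - {(w, c, b)}" "edges G"]
    unfolding connected_graph_def vertices_def by fastforce
  have fw: "\<exists>v. (u, d, v) \<in> edges G" if h: "u \<in> white G" "d \<le> D" for u d
  proof -
    obtain d' v' where e: "(u, d', v') \<in> edges G" using cov(1)[OF h(1)] by blast
    have "\<exists>v''. (Some u, d', v'') \<in> ?T" using e unfolding in_unroot by blast
    then obtain v where "(Some u, d, v) \<in> ?T"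
      using bordered_white_full[OF T _ _ h(2)] xy(1)[OF h(1) wcb(2)] by metis
    then show ?thesis using xy(1)[OF h(1) wcb(2)] root unfolding in_unroot by blast
  qed
  have fb: "\<exists>u. (u, d, v) \<in> edges G" if h: "v \<in> black G" "d \<le> D" for v d
  proof -
    obtain d' u' where e: "(u', d', v) \<in> edges G" using cov(2)[OF h(1)] by blast
    have "\<exists>u''. (u'', d', Some v) \<in> ?T" using e unfolding in_unroot by blast
    then obtain u where "(u, d, Some v) \<in> ?T"
      using bordered_black_full[OF T _ _ h(2)] xy(2)[OF wcb(1) h(1)] by metis
    then show ?thesis using xy(2)[OF wcb(1) h(1)] root unfolding in_unroot by blast
  qed
  have "partial_graph D G" unfolding partial_graph_def using fin' sub uw ub con by blast
  then show ?thesis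
    using fw fb root by (auto simp: rooted_graph_def coloured_graph_def free_white_def free_black_def)
qed

lemma rooted_cover:
  assumes "rooted_graph D (G, r)"
  shows "edges G \<subseteq> white G \<times> {..D} \<times> black G"
    "w \<in> white G \<Longrightarrow> \<exists>c b. (w, c, b) \<in> edges G" "b \<in> black G \<Longrightarrow> \<exists>c w. (w, c, b) \<in> edges G"
    "r \<in> edges G"
  using assms coloured_graphD(1)[of D G] coloured_graphD(2)[of D G w 0] coloured_graphD(3)[of D G b 0]
  by (auto simp: rooted_graph_def partial_graph_def)

lemma graph_of_unroot:
  assumes R: "rooted_graph D (G, (w, c, b))" and av: "avoids x y G"
  shows "graph_of (x, c, y) (unroot x y (G, (w, c, b))) = op_graph (G, (w, c, b))"
proof -
  note cov = rooted_cover[OF R]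
  have xy: "x \<noteq> Some u" "y \<noteq> Some v" if "u \<in> white G" "v \<in> black G" for u v
    using av that by (auto simp: avoids_def)
  have wcb: "w \<in> white G" "b \<in> black G" using cov by auto
  have sub': "u \<in> white G \<and> v \<in> black G" if "(u, d, v) \<in> edges G" for u d v using cov(1) that by auto
  let ?T = "unroot x y (G, (w, c, b))"
  have "Some u \<in> inner_whites (x, c, y) ?T \<longleftrightarrow> u \<in> white G" for u
  proof
    assume "Some u \<in> inner_whites (x, c, y) ?T"
    then show "u \<in> white G" using wcb sub' unfolding inner_whites_def whites_def in_unroot by auto
  next
    assume u: "u \<in> white G"
    then obtain d v where "(u, d, v) \<in> edges G" using cov(2) by blast
    then have "\<exists>d v. (Some u, d, v) \<in> ?T" unfolding in_unroot by blast
    then show "Some u \<in> inner_whites (x, c, y) ?T" using xy(1)[OF u wcb(2)]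
      unfolding inner_whites_def whites_def by auto
  qed
  moreover have "Some v \<in> inner_blacks (x, c, y) ?T \<longleftrightarrow> v \<in> black G" for v
  proof
    assume "Some v \<in> inner_blacks (x, c, y) ?T"
    then show "v \<in> black G" using wcb sub' unfolding inner_blacks_def blacks_def in_unroot by auto
  next
    assume v: "v \<in> black G"
    then obtain d u where "(u, d, v) \<in> edges G" using cov(3) by blast
    then have "\<exists>u d. (u, d, Some v) \<in> ?T" unfolding in_unroot by blast
    then show "Some v \<in> inner_blacks (x, c, y) ?T" using xy(2)[OF wcb(1) v]
      unfolding inner_blacks_def blacks_def by auto
  qed
  moreover have "(Some u, d, Some v) \<in> ?T \<and> Some u \<noteq> x \<and> Some v \<noteq> y \<longleftrightarrow>
      (u, d, v) \<in> edges G \<and> (u, d, v) \<noteq> (w, c, b)" for u d v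
    using sub'[of u d v] xy[of u v] unfolding in_unroot by auto
  ultimately show ?thesis
    unfolding graph_of_def by (intro cgraph.equality) (auto simp: set_eq_iff)
qed

lemma open_op_graph:
  assumes D: "1 \<le> D" and R: "rooted_graph D (G, (w, c, b))"
  shows "open_graph D (op_graph (G, (w, c, b)))" "free_white D (op_graph (G, (w, c, b))) = {(w, c)}"
    "free_black D (op_graph (G, (w, c, b))) = {(b, c)}" "cl_graph D (op_graph (G, (w, c, b))) =
      (G, (w, c, b))"
proof -
  note cov = rooted_cover[OF R]
  have cg: "coloured_graph D G" and root: "(w, c, b) \<in> edges G" using R by (auto simp: rooted_graph_def)
  note pg = partial_graphD[OF coloured_graphD(1)[OF cg]] and full = coloured_graphD(2,3)[OF cg]
  have wcb: "w \<in> white G" "c \<le> D" "b \<in> black G" using pg(3)[OF root] by auto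
  show 1: "free_white D (op_graph (G, (w, c, b))) = {(w, c)}"
    unfolding free_white_def using wcb pg(4)[OF root] full(1) by fastforce
  show 2: "free_black D (op_graph (G, (w, c, b))) = {(b, c)}"
    unfolding free_black_def using wcb pg(5)[OF root] full(2) by fastforce
  have "connected_graph (op_graph (G, (w, c, b)))"
    using connected_op_graph[OF bordered_unroot[OF D R avoids_None] avoids_None cov(1,4,2,3)] .
  then show "open_graph D (op_graph (G, (w, c, b)))"
    using 1 2 coloured_graphD(1)[OF cg] unfolding open_graph_def partial_graph_def by auto
  show "cl_graph D (op_graph (G, (w, c, b))) = (G, (w, c, b))"
    using root unfolding cl_graph_def 1 2 by (simp add: op_graph_def insert_absorb)
qed

lemma rooted_cl_graph:
  assumes H: "open_graph D H"
  obtains w c b where "cl_graph D H = (H\<lparr>edges := insert (w, c, b) (edges H)\<rparr>, (w, c, b))"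
    "free_white D H = {(w, c)}" "free_black D H = {(b, c)}" "(w, c, b) \<notin> edges H"
    "rooted_graph D (cl_graph D H)" "op_graph (cl_graph D H) = H"
proof -
  obtain w c b where fr: "free_white D H = {(w, c)}" "free_black D H = {(b, c)}"
    using H by (auto simp: open_graph_def)
  have pg: "partial_graph D H" using H by (simp add: open_graph_def)
  note p = partial_graphD[OF pg]
  have w: "w \<in> white H" "c \<le> D" "\<And>b. (w, c, b) \<notin> edges H" using fr(1) by (auto simp: free_white_def)
  have b: "b \<in> black H" "\<And>w. (w, c, b) \<notin> edges H" using fr(2) by (auto simp: free_black_def)
  let ?G = "H\<lparr>edges := insert (w, c, b) (edges H)\<rparr>"
  have cl: "cl_graph D H = (?G, (w, c, b))" by (simp add: cl_graph_def fr)
  have con: "connected_graph ?G"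
    using p(6) rtrancl_mono[OF adj_mono, of "edges H" "insert (w, c, b) (edges H)"]
    unfolding connected_graph_def vertices_def by fastforce
  have "partial_graph D ?G"
    unfolding partial_graph_def using p(1,2) pg w b con unfolding partial_graph_def by auto
  moreover have "free_white D ?G = {}"
  proof -
    have "(u, d) \<in> free_white D H" if "(u, d) \<in> free_white D ?G" for u d using that
      by (auto simp: free_white_def)
    then show ?thesis using fr(1) by (auto simp: free_white_def)
  qed
  moreover have "free_black D ?G = {}"
  proof -
    have "(u, d) \<in> free_black D H" if "(u, d) \<in> free_black D ?G" for u d using that
      by (auto simp: free_black_def)
    then show ?thesis using fr(2) by (auto simp: free_black_def)
  qed
  ultimately have "rooted_graph D (cl_graph D H)" by (simp add: cl rooted_graph_def coloured_graph_def)
  moreover have "op_graph (cl_graph D H) = H" using w(3) by (simp add: cl op_graph_def)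
  ultimately show thesis using that[OF cl fr w(3)] by blast
qed

text \<open>The two edges at the border are joined to form the root edge. Since \<open>T\<close> is
  not a single edge, neither of them runs from border to border, so their other ends are inner
  vertices and have the form \<open>Some\<close>.\<close>

lemma rooted_of_bordered:
  assumes T: "bordered D (x, c, y) T" and ne: "T \<noteq> {(x, c, y)}"
    and w: "inner_whites (x, c, y) T \<subseteq> range Some" and b: "inner_blacks (x, c, y) T \<subseteq> range Some"
  obtains G w b where "rooted_graph D (G, (w, c, b))" "avoids x y G" "unroot x y (G, (w, c, b)) = T"
proof -
  obtain u v where uv: "(u, c, y) \<in> T" "(x, c, v) \<in> T"
    using bordered_border_white[OF T] bordered_border_black[OF T] by blast
  have nxy: "(x, d, y) \<notin> T" for d using bordered_eq_single[OF T] ne by blast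
  have "u \<noteq> x" "v \<noteq> y" using uv nxy by blast+
  then have "u \<in> inner_whites (x, c, y) T" "v \<in> inner_blacks (x, c, y) T"
    using uv by (auto simp: inner_whites_def inner_blacks_def in_whites in_blacks)
  then obtain w b where wb: "u = Some w" "v = Some b" using w b by blast
  let ?G0 = "graph_of (x, c, y) T"
  define G where "G = ?G0\<lparr>edges := insert (w, c, b) (edges ?G0)\<rparr>"
  have cD: "c \<le> D" using bordered_colour[OF T uv(1)] .
  have notT: "(Some w, c, Some b) \<notin> T"
    using bordered_white_unique[OF T uv(1)[unfolded wb]] \<open>v \<noteq> y\<close> wb by blast
  have white: "u \<in> white G \<longleftrightarrow> Some u \<in> whites T \<and> Some u \<noteq> x" for u
    by (auto simp: G_def graph_of_def inner_whites_def)
  have black: "u \<in> black G \<longleftrightarrow> Some u \<in> blacks T \<and> Some u \<noteq> y" for u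
    by (auto simp: G_def graph_of_def inner_blacks_def)
  have edge: "(u, d, v) \<in> edges G \<longleftrightarrow> (u, d, v) = (w, c, b) \<or> (Some u, d, Some v) \<in> T \<and> Some u \<noteq> x \<and>
    Some v \<noteq> y" for u d v
    by (auto simp: G_def graph_of_def)
  have wG: "w \<in> white G" "b \<in> black G"
    using uv wb \<open>u \<noteq> x\<close> \<open>v \<noteq> y\<close> by (auto simp: white black intro: in_whites in_blacks)
  have av: "avoids x y G" using white black by (auto simp: avoids_def)
  have xT: "d = c \<and> v' = Some b" if "(x, d, v') \<in> T" for d v'
    using bordered_border_white_colour[OF T that] bordered_white_unique[OF T uv(2), of v'] that wb
      by auto
  have yT: "d = c \<and> u' = Some w" if "(u', d, y) \<in> T" for d u'
    using bordered_border_black_colour[OF T that] bordered_black_unique[OF T uv(1), of u'] that wb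
      by auto
  have wT: "u' \<in> range Some" if "(u', d, v') \<in> T" "u' \<noteq> x" for u' d v'
    using w in_whites[OF that(1)] that(2) by (auto simp: inner_whites_def)
  have bT: "v' \<in> range Some" if "(u', d, v') \<in> T" "v' \<noteq> y" for u' d v'
    using b in_blacks[OF that(1)] that(2) by (auto simp: inner_blacks_def)
  have unroot: "unroot x y (G, (w, c, b)) = T"
  proof -
    have "(u', d, v') \<in> unroot x y (G, (w, c, b)) \<longleftrightarrow> (u', d, v') \<in> T" for u' d v'
    proof
      assume "(u', d, v') \<in> unroot x y (G, (w, c, b))"
      then show "(u', d, v') \<in> T" using uv wb unfolding in_unroot edge by blast
    next
      assume h: "(u', d, v') \<in> T"
      show "(u', d, v') \<in> unroot x y (G, (w, c, b))"
      proof (cases "u' = x \<or> v' = y")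
        case True
        then show ?thesis using xT[of d v'] yT[of u' d] h by (auto simp: in_unroot)
      next
        case False
        then obtain p q where "u' = Some p" "v' = Some q" using wT[OF h] bT[OF h] by blast
        then show ?thesis using False h notT unfolding in_unroot edge by auto
      qed
    qed
    then show ?thesis by (auto simp: set_eq_iff)
  qed
  have "rooted_graph D (G, (w, c, b))"
  proof (rule rooted_if_bordered[OF _ av])
    show "bordered D (x, c, y) (unroot x y (G, (w, c, b)))" using T unroot by simp
    show "edges G \<subseteq> white G \<times> {..D} \<times> black G"
      using edge white black wG cD bordered_colour[OF T] by (auto intro: in_whites in_blacks)
    show "(w, c, b) \<in> edges G" by (simp add: edge)
    show "\<exists>c b. (u, c, b) \<in> edges G" if u: "u \<in> white G" for u
    proof -
      obtain d v' where h: "(Some u, d, v') \<in> T" "Some u \<noteq> x" using u by (auto simp: white whites_def)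
      show ?thesis
      proof (cases "v' = y")
        case True
        then show ?thesis using yT[of "Some u" d] h edge by blast
      next
        case False
        then show ?thesis using bT[OF h(1)] h edge by blast
      qed
    qed
    show "\<exists>c w. (w, c, u) \<in> edges G" if u: "u \<in> black G" for u
    proof -
      obtain d v' where h: "(v', d, Some u) \<in> T" "Some u \<noteq> y" using u by (auto simp: black blacks_def)
      show ?thesis
      proof (cases "v' = x")
        case True
        then show ?thesis using xT[of d "Some u"] h edge by blast
      next
        case False
        then show ?thesis using wT[OF h(1)] h edge by blast
      qed
    qed
  qed
  then show thesis using that av unroot by blast
qed

subsection \<open>Melonic graphs as blow-ups\<close>

lemma insert_melon_simps:
  "white (insert_melon D w' b' e G) = insert w' (white G)"
  "black (insert_melon D w' b' e G) = insert b' (black G)"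
  "(u, d, v) \<in> edges (insert_melon D w' b' (w, c, b) G) \<longleftrightarrow>
     (u, d, v) \<in> edges G \<and> (u, d, v) \<noteq> (w, c, b) \<or> u = w' \<and> v = b' \<and> d \<le> D \<and> d \<noteq> c \<or>
     (u, d, v) = (w, c, b') \<or> (u, d, v) = (w', c, b)"
  by (auto simp: insert_melon_def Delta_def split: prod.splits)

lemma avoids_insert_melon:
  "avoids x y (insert_melon D w' b' e G) \<longleftrightarrow> avoids x y G \<and> x \<noteq> Some w' \<and> y \<noteq> Some b'"
  by (auto simp: avoids_def insert_melon_simps)

lemma fresh_unroot:
  assumes "rooted_graph D (G, r)" "avoids x y G" "w' \<notin> white G" "b' \<notin> black G" "x \<noteq> Some w'"
    "y \<noteq> Some b'"
  shows "fresh (Some w') (Some b') (unroot x y (G, r))"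
  using rooted_cover(1,4)[OF assms(1)] assms by (cases r) (auto simp: fresh_def in_unroot)

lemma fresh_unrootD:
  assumes R: "rooted_graph D (G, (w, c, b))" and fr:
    "fresh (Some w') (Some b') (unroot x y (G, (w, c, b)))"
  shows "w' \<notin> white G" "b' \<notin> black G"
proof -
  note cov = rooted_cover[OF R]
  show "w' \<notin> white G"
  proof
    assume "w' \<in> white G"
    then obtain d v where "(w', d, v) \<in> edges G" using cov(2) by blast
    then have "\<exists>v. (Some w', d, v) \<in> unroot x y (G, (w, c, b))" unfolding in_unroot by blast
    then show False using fresh_simps(1)[OF fr] by simp
  qed
  show "b' \<notin> black G"
  proof
    assume "b' \<in> black G"
    then obtain d v where "(v, d, b') \<in> edges G" using cov(3) by blast
    then have "\<exists>v. (v, d, Some b') \<in> unroot x y (G, (w, c, b))" unfolding in_unroot by blast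
    then show False using fresh_simps(2)[OF fr] by simp
  qed
qed

context
  fixes D w c b and G :: cgraph and x y :: "nat option" and w' b' :: nat
  assumes R: "rooted_graph D (G, (w, c, b))" and av: "avoids x y G"
    and new: "w' \<notin> white G" "b' \<notin> black G" "x \<noteq> Some w'" "y \<noteq> Some b'"
begin

private lemma nx: "(u, d, v) \<in> edges G \<Longrightarrow> x \<noteq> Some u \<and> y \<noteq> Some v \<and> u \<noteq> w' \<and> v \<noteq> b'"
  using rooted_cover(1)[OF R] av new by (auto simp: avoids_def)

private lemma root: "(w, c, b) \<in> edges G"
  using R by (simp add: rooted_graph_def)

lemma unroot_insert_nonroot:
  assumes e: "e \<in> edges G" "e \<noteq> (w, c, b)"
  shows "unroot x y (insert_melon D w' b' e G, (w, c, b)) =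
    ins D (Some w') (Some b') (lift e) (unroot x y (G, (w, c, b)))"
proof -
  obtain p q r where pqr: "e = (p, q, r)" by (cases e)
  note n = nx[OF e(1)[unfolded pqr]] nx[OF root]
  have "(u, d, v) \<in> unroot x y (insert_melon D w' b' e G, (w, c, b)) \<longleftrightarrow>
      (u, d, v) \<in> ins D (Some w') (Some b') (lift e) (unroot x y (G, (w, c, b)))" for u d v
    unfolding pqr lift_simp in_ins in_unroot insert_melon_simps using n e(2)[unfolded pqr]
    by (cases u; cases v) auto
  then show ?thesis by (auto simp: set_eq_iff)
qed

text \<open>Cutting the root leaves two edges at the border. With \<open>(w, c, b')\<close> as the
  new root the half at \<open>w\<close> stays as it is, so the melon sits in the half at
  \<open>b\<close>; the other choice is the mirror image.\<close>

lemma unroot_insert_black: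
  "unroot x y (insert_melon D w' b' (w, c, b) G, (w, c, b')) =
    ins D (Some w') (Some b') (x, c, Some b) (unroot x y (G, (w, c, b)))"
proof -
  note n = nx[OF root]
  have "(u, d, v) \<in> unroot x y (insert_melon D w' b' (w, c, b) G, (w, c, b')) \<longleftrightarrow>
      (u, d, v) \<in> ins D (Some w') (Some b') (x, c, Some b) (unroot x y (G, (w, c, b)))" for u d v
    unfolding in_ins in_unroot insert_melon_simps using n by (cases u; cases v) (auto dest: nx)
  then show ?thesis by (auto simp: set_eq_iff)
qed

lemma unroot_insert_white:
  "unroot x y (insert_melon D w' b' (w, c, b) G, (w', c, b)) =
    ins D (Some w') (Some b') (Some w, c, y) (unroot x y (G, (w, c, b)))"
proof -
  note n = nx[OF root]
  have "(u, d, v) \<in> unroot x y (insert_melon D w' b' (w, c, b) G, (w', c, b)) \<longleftrightarrow>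
      (u, d, v) \<in> ins D (Some w') (Some b') (Some w, c, y) (unroot x y (G, (w, c, b)))" for u d v
    unfolding in_ins in_unroot insert_melon_simps using n by (cases u; cases v) (auto dest: nx)
  then show ?thesis by (auto simp: set_eq_iff)
qed

end

lemma insert_melon_unroot:
  assumes R: "rooted_graph D (G, (w, c, b))" and av: "avoids x y G"
    and new: "w' \<notin> white G" "b' \<notin> black G" "x \<noteq> Some w'" "y \<noteq> Some b'"
    and e: "e \<in> edges G"
    and r: "r = (w, c, b) \<and> e \<noteq> (w, c, b) \<or> e = (w, c, b) \<and> (r = (w, c, b') \<or> r = (w', c, b))"
  shows "\<exists>f \<in> unroot x y (G, (w, c, b)).
    unroot x y (insert_melon D w' b' e G, r) = ins D (Some w') (Some b') f (unroot x y (G, (w, c, b)))"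
  using r
proof (elim disjE conjE)
  assume "r = (w, c, b)" "e \<noteq> (w, c, b)"
  then show ?thesis
    using unroot_insert_nonroot[OF R av new e] e by (intro bexI[of _ "lift e"]) (auto simp: unroot_def)
next
  assume "e = (w, c, b)" "r = (w, c, b')"
  then show ?thesis
    using unroot_insert_black[OF R av new] by (intro bexI[of _ "(x, c, Some b)"]) (auto simp: unroot_def)
next
  assume "e = (w, c, b)" "r = (w', c, b)"
  then show ?thesis
    using unroot_insert_white[OF R av new] by (intro bexI[of _ "(Some w, c, y)"]) (auto simp: unroot_def)
qed

text \<open>The edges of the bordered set are the lifted edges other than the root and the two
  halves of the root. These account for the three ways of inserting a melon into a rooted graph,
  none of which changes the root colour.\<close>

lemma ins_unroot:
  assumes R: "rooted_graph D (G, (w, c, b))" and av: "avoids x y G"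
    and new: "w' \<notin> white G" "b' \<notin> black G" "x \<noteq> Some w'" "y \<noteq> Some b'"
    and f: "f \<in> unroot x y (G, (w, c, b))"
  shows "\<exists>e r. e \<in> edges G \<and> fst (snd r) = c \<and>
    (r = (w, c, b) \<and> e \<noteq> (w, c, b) \<or> e = (w, c, b) \<and> (r = (w, c, b') \<or> r = (w', c, b))) \<and>
    unroot x y (insert_melon D w' b' e G, r) = ins D (Some w') (Some b') f (unroot x y (G, (w, c, b)))"
proof -
  have root: "(w, c, b) \<in> edges G" using R by (simp add: rooted_graph_def)
  from f consider e where "e \<in> edges G" "e \<noteq> (w, c, b)" "f = lift e"
    | "f = (x, c, Some b)" | "f = (Some w, c, y)" unfolding unroot_def by auto
  then show ?thesis
  proof cases
    case 1
    then show ?thesis using unroot_insert_nonroot[OF R av new 1(1,2)]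
      by (intro exI[of _ e] exI[of _ "(w, c, b)"]) simp
  next
    case 2
    then show ?thesis using unroot_insert_black[OF R av new] root
      by (intro exI[of _ "(w, c, b)"] exI[of _ "(w, c, b')"]) simp
  next
    case 3
    then show ?thesis using unroot_insert_white[OF R av new] root
      by (intro exI[of _ "(w, c, b)"] exI[of _ "(w', c, b)"]) simp
  qed
qed

text \<open>The detour through bordered sets replaces a direct proof of connectedness for
  \<open>insert_melon\<close>: \<open>bordered_ins\<close> provides it and
  \<open>rooted_if_bordered\<close> carries it back.\<close>

lemma rooted_insert_melon:
  assumes D: "2 \<le> D" and R: "rooted_graph D (G, (w, c, b))"
    and new: "w' \<notin> white G" "b' \<notin> black G" and e: "e \<in> edges G"
    and r: "r = (w, c, b) \<and> e \<noteq> (w, c, b) \<or> e = (w, c, b) \<and> (r = (w, c, b') \<or> r = (w', c, b))"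
  shows "rooted_graph D (insert_melon D w' b' e G, r)"
proof -
  obtain p q s where pqr: "e = (p, q, s)" by (cases e)
  obtain w1 c1 b1 where r1: "r = (w1, c1, b1)" by (cases r)
  note cov = rooted_cover[OF R]
  have c1: "c1 = c" using r r1 by auto
  have D1: "1 \<le> D" using D by simp
  have b: "bordered D (None, c, None) (unroot None None (G, (w, c, b)))"
    by (rule bordered_unroot[OF D1 R avoids_None])
  have fr: "fresh (Some w') (Some b') (unroot None None (G, (w, c, b)))"
    using fresh_unroot[OF R avoids_None new] by simp
  obtain f where f: "f \<in> unroot None None (G, (w, c, b))"
    "unroot None None (insert_melon D w' b' e G, r) =
      ins D (Some w') (Some b') f (unroot None None (G, (w, c, b)))"
    using insert_melon_unroot[OF R avoids_None new _ _ e r] by blast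
  have cD: "q \<le> D" "c \<le> D" "p \<in> white G" "s \<in> black G" using cov(1,4) e pqr by auto
  show ?thesis
    unfolding r1
  proof (rule rooted_if_bordered[OF _ avoids_None])
    show "bordered D (None, c1, None) (unroot None None (insert_melon D w' b' e G, (w1, c1, b1)))"
      using bordered_ins[OF b f(1) fr D1] f(2) r1 c1 by simp
    show "edges (insert_melon D w' b' e G) \<subseteq> white (insert_melon D w' b' e G) \<times> {..D} \<times> black
      (insert_melon D w' b' e G)"
      using cov(1) cD unfolding pqr by (auto simp: insert_melon_simps)
    show "(w1, c1, b1) \<in> edges (insert_melon D w' b' e G)"
      using r r1 cov(4) unfolding pqr by (auto simp: insert_melon_simps)
    show "\<exists>c b. (u, c, b) \<in> edges (insert_melon D w' b' e G)"
      if u: "u \<in> white (insert_melon D w' b' e G)" for u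
    proof (cases "u = w'")
      case True
      then show ?thesis unfolding pqr insert_melon_simps by blast
    next
      case False
      then obtain d v where "(u, d, v) \<in> edges G" using cov(2)[of u] u by (auto simp: insert_melon_simps)
      then show ?thesis unfolding pqr insert_melon_simps by blast
    qed
    show "\<exists>c w. (w, c, u) \<in> edges (insert_melon D w' b' e G)"
      if u: "u \<in> black (insert_melon D w' b' e G)" for u
    proof (cases "u = b'")
      case True
      then show ?thesis unfolding pqr insert_melon_simps by blast
    next
      case False
      then obtain d v where "(v, d, u) \<in> edges G" using cov(3)[of u] u by (auto simp: insert_melon_simps)
      then show ?thesis unfolding pqr insert_melon_simps by blast
    qed
  qed
qed

text \<open>Cut at its root, \<open>Delta\<close> is one melon, that is, one insertion into the
  bordered form of the empty open graph.\<close>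

lemma unroot_Delta:
  assumes "r \<le> D" "x \<noteq> Some w" "y \<noteq> Some b"
  shows "unroot x y (Delta D r w b) = ins D (Some w) (Some b) (x, r, y) {(x, r, y)}"
proof -
  have "(u, d, v) \<in> unroot x y (Delta D r w b) \<longleftrightarrow>
    (u, d, v) \<in> ins D (Some w) (Some b) (x, r, y) {(x, r, y)}" for u d v
    unfolding Delta_def in_unroot in_ins by auto
  then show ?thesis by (auto simp: set_eq_iff)
qed

lemma rooted_Delta:
  assumes "r \<le> D" "2 \<le> D"
  shows "rooted_graph D (Delta D r w b)"
  unfolding Delta_def
proof (rule rooted_if_bordered[OF _ avoids_None])
  have "bordered D (None, r, None) (ins D (Some w) (Some b) (None, r, None) {(None, r, None)})"
    using assms by (intro bordered_ins bordered_single) (auto simp: fresh_def)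
  then show "bordered D (None, r, None)
      (unroot None None (\<lparr>white = {w}, black = {b}, edges = {(w, c, b) |c. c \<le> D}\<rparr>, w, r, b))"
    using unroot_Delta[OF assms(1), of None w None b] by (simp add: Delta_def)
qed (use assms in auto)

text \<open>All admissible border vertices are treated at once, because melonic subgraphs will be
  bordered by their neighbours in a larger graph. Being rooted is part of the induction since the
  translation of an insertion relies on it.\<close>

lemma blowup_of_melonic:
  assumes D: "2 \<le> D" and R: "melonic D R"
  shows "rooted_graph D R \<and>
    (\<forall>x y. avoids x y (fst R) \<longrightarrow> blowup D (x, fst (snd (snd R)), y) (unroot x y R))"
  using R
proof induction
  case (Delta r w b)
  have "blowup D (x, r, y) (unroot x y (Delta D r w b))" if "x \<noteq> Some w" "y \<noteq> Some b" for x y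
    unfolding unroot_Delta[OF Delta that] using that by (intro blowup.intros) (auto simp: fresh_def)
  then show ?case using rooted_Delta[OF Delta D] by (auto simp: Delta_def avoids_def)
next
  case (insert_nonroot G e\<^sub>0 e w' b')
  obtain w c b where e0: "e\<^sub>0 = (w, c, b)" by (cases e\<^sub>0)
  have R: "rooted_graph D (G, (w, c, b))" using insert_nonroot.IH e0 by simp
  have r: "e\<^sub>0 = (w, c, b) \<and> e \<noteq> (w, c, b) \<or> e = (w, c, b) \<and> (e\<^sub>0 = (w, c, b') \<or> e\<^sub>0 = (w', c, b))"
    using insert_nonroot.hyps e0 by simp
  have "blowup D (x, c, y) (unroot x y (insert_melon D w' b' e G, e\<^sub>0))"
    if "avoids x y (insert_melon D w' b' e G)" for x y
  proof -
    have av: "avoids x y G" "x \<noteq> Some w'" "y \<noteq> Some b'" using that by (auto simp: avoids_insert_melon)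
    obtain f where "f \<in> unroot x y (G, (w, c, b))"
      "unroot x y (insert_melon D w' b' e G, e\<^sub>0) =
        ins D (Some w') (Some b') f (unroot x y (G, (w, c, b)))"
      using insert_melon_unroot[OF R av(1) insert_nonroot.hyps(4,5) av(2,3) insert_nonroot.hyps(2)
        r] by blast
    then show ?thesis
      using blowup.ins[of D "(x, c, y)"] fresh_unroot[OF R av(1) insert_nonroot.hyps(4,5) av(2,3)]
        insert_nonroot.IH av(1) e0 by simp
  qed
  then show ?case
    using rooted_insert_melon[OF D R insert_nonroot.hyps(4,5,2) r] e0 by simp
next
  case (insert_root G w c b w' b' e)
  have R: "rooted_graph D (G, (w, c, b))" using insert_root.IH by simp
  have e: "(w, c, b) \<in> edges G" using R by (simp add: rooted_graph_def)
  have r: "e = (w, c, b) \<and> (w, c, b) \<noteq> (w, c, b) \<or> (w, c, b) = (w, c, b) \<and> (e = (w, c, b') \<or> e =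
    (w', c, b))"
    using insert_root.hyps by simp
  have "blowup D (x, c, y) (unroot x y (insert_melon D w' b' (w, c, b) G, e))"
    if "avoids x y (insert_melon D w' b' (w, c, b) G)" for x y
  proof -
    have av: "avoids x y G" "x \<noteq> Some w'" "y \<noteq> Some b'" using that by (auto simp: avoids_insert_melon)
    obtain f where "f \<in> unroot x y (G, (w, c, b))"
      "unroot x y (insert_melon D w' b' (w, c, b) G, e) =
        ins D (Some w') (Some b') f (unroot x y (G, (w, c, b)))"
      using insert_melon_unroot[OF R av(1) insert_root.hyps(2,3) av(2,3) e r] by blast
    then show ?thesis
      using blowup.ins[of D "(x, c, y)"] fresh_unroot[OF R av(1) insert_root.hyps(2,3) av(2,3)]
        insert_root.IH av(1) by simp
  qed
  moreover have "fst (snd e) = c" using r by auto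
  ultimately show ?case
    using rooted_insert_melon[OF D R insert_root.hyps(2,3) e r] by simp
qed

lemma melonic_insert:
  assumes "melonic D (G, (w, c, b))" "w' \<notin> white G" "b' \<notin> black G" "e \<in> edges G"
    "r = (w, c, b) \<and> e \<noteq> (w, c, b) \<or> e = (w, c, b) \<and> (r = (w, c, b') \<or> r = (w', c, b))"
  shows "melonic D (insert_melon D w' b' e G, r)"
  using assms melonic.insert_nonroot[of D G "(w, c, b)" e] melonic.insert_root[of D G w c b] by auto

lemma whites_ins: "f \<in> T \<Longrightarrow> whites (ins D w b f T) = insert w (whites T)"
  and blacks_ins: "f \<in> T \<Longrightarrow> blacks (ins D w b f T) = insert b (blacks T)"
  by (cases f; auto simp: whites_def blacks_def in_ins; metis)+

text \<open>Vertices of graphs are natural numbers, hence the condition that inner vertices have the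
  form \<open>Some\<close>; the border vertices may be anything. The exceptional single edge is the
  empty open graph, and an insertion into it gives \<open>Delta\<close>.\<close>

lemma melonic_of_blowup:
  assumes D: "2 \<le> D" and T: "blowup D (x, c, y) T" and c: "c \<le> D"
    and "inner_whites (x, c, y) T \<subseteq> range Some" "inner_blacks (x, c, y) T \<subseteq> range Some"
  shows "T = {(x, c, y)} \<or>
    (\<exists>G w b. melonic D (G, (w, c, b)) \<and> avoids x y G \<and> unroot x y (G, (w, c, b)) = T)"
  using T assms(4,5)
proof (induction rule: blowup.induct)
  case single
  then show ?case by simp
next
  case (ins T f w b)
  have bT: "bordered D (x, c, y) T" using bordered_blowup[OF ins.hyps(1)] c D by simp
  have xy: "w \<noteq> x" "b \<noteq> y"
    using bordered_border_white[OF bT] bordered_border_black[OF bT] freshD[OF ins.hyps(3)] by blast+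
  then have "w \<in> range Some" "b \<in> range Some"
    using ins.prems whites_ins[OF ins.hyps(2), of D w b] blacks_ins[OF ins.hyps(2), of D w b]
    by (auto simp: inner_whites_def inner_blacks_def)
  then obtain w' b' where wb: "w = Some w'" "b = Some b'" by blast
  have "inner_whites (x, c, y) T \<subseteq> range Some" "inner_blacks (x, c, y) T \<subseteq> range Some"
    using ins.prems whites_ins[OF ins.hyps(2), of D w b] blacks_ins[OF ins.hyps(2), of D w b]
    by (auto simp: inner_whites_def inner_blacks_def)
  from ins.IH[OF this] show ?case
  proof
    assume T: "T = {(x, c, y)}"
    then have "unroot x y (Delta D c w' b') = ins D w b f T"
      using unroot_Delta[OF c, of x w' y b'] xy wb ins.hyps(2) by simp
    moreover have "Delta D c w' b' = (fst (Delta D c w' b'), (w', c, b'))" by (simp add: Delta_def)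
    moreover have "avoids x y (fst (Delta D c w' b'))" using xy wb by (simp add: Delta_def avoids_def)
    ultimately show ?thesis using melonic.Delta[OF c, of w' b'] by metis
  next
    assume "\<exists>G w b. melonic D (G, (w, c, b)) \<and> avoids x y G \<and> unroot x y (G, (w, c, b)) = T"
    then obtain G w1 b1 where G: "melonic D (G, (w1, c, b1))" "avoids x y G"
      "unroot x y (G, (w1, c, b1)) = T"
      by blast
    have R: "rooted_graph D (G, (w1, c, b1))" using blowup_of_melonic[OF D G(1)] by simp
    note cov = rooted_cover[OF R]
    have new: "w' \<notin> white G" "b' \<notin> black G"
      using fresh_unrootD[OF R] ins.hyps(3) G(3) wb by auto
    have xy': "x \<noteq> Some w'" "y \<noteq> Some b'" using xy wb by auto
    obtain e r where er: "e \<in> edges G" "fst (snd r) = c"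
      "r = (w1, c, b1) \<and> e \<noteq> (w1, c, b1) \<or> e = (w1, c, b1) \<and> (r = (w1, c, b') \<or> r = (w', c, b1))"
      "unroot x y (insert_melon D w' b' e G, r) = ins D w b f T"
      using ins_unroot[OF R G(2) new xy', unfolded G(3), OF ins.hyps(2)] wb by blast
    obtain w2 b2 where r: "r = (w2, c, b2)" using er(2) by (cases r) auto
    have "melonic D (insert_melon D w' b' e G, r)" by (rule melonic_insert[OF G(1) new er(1,3)])
    moreover have "avoids x y (insert_melon D w' b' e G)" using G(2) xy'
      by (simp add: avoids_insert_melon)
    ultimately show ?thesis using er(4) r by blast
  qed
qed

subsection \<open>Invariance of the degree\<close>

lemma sym_adj: "sym (adj S)"
  by (rule symI) (auto simp: adj_def)

lemma equiv_adj: "equiv UNIV ((adj S)\<^sup>*)"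
  by (rule equivI) (auto intro: refl_rtrancl sym_rtrancl sym_adj trans_rtrancl)

lemma quotient_image: "A // r = (\<lambda>a. r `` {a}) ` A"
  by (auto simp: quotient_def)

text \<open>\<open>p\<close> retracts the larger set onto the smaller one. It moves points within
  their class of \<open>R'\<close> and carries \<open>R'\<close> into \<open>R\<close>, so classes
  correspond one to one. This is meant for faces that are lengthened by two vertices.\<close>

lemma card_quotient_eq:
  assumes R: "equiv UNIV R" and R': "equiv UNIV R'" and A: "finite A'" "A \<subseteq> A'"
    and p: "\<And>a b. (a, b) \<in> R' \<Longrightarrow> (p a, p b) \<in> R" "\<And>a. a \<in> A' \<Longrightarrow> p a \<in> A \<and> (a, p a) \<in> R'" "\<And>a. a \<in> A \<Longrightarrow>
      p a = a"
    and i: "\<And>a b. (a, b) \<in> R \<Longrightarrow> (a, b) \<in> R'"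
  shows "card (A' // R') = card (A // R)"
proof (rule card_eq_matching[where r = "\<lambda>Y X. \<exists>a \<in> A. X = R `` {a} \<and> Y = R' `` {a}"])
  show "finite (A' // R')" "finite (A // R)"
    using A finite_subset by (auto simp: quotient_image)
  have eq: "R `` {a} = R `` {b} \<longleftrightarrow> (a, b) \<in> R" "R' `` {a} = R' `` {b} \<longleftrightarrow> (a, b) \<in> R'" for a b
    using eq_equiv_class_iff[OF R] eq_equiv_class_iff[OF R'] by blast+
  show "\<exists>X \<in> A // R. \<exists>a \<in> A. X = R `` {a} \<and> Y = R' `` {a}" if Y: "Y \<in> A' // R'" for Y
  proof -
    obtain a where a: "a \<in> A'" "Y = R' `` {a}" using Y by (auto simp: quotient_image)
    then have "Y = R' `` {p a}" using p(2) eq(2) by blast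
    then show ?thesis using p(2)[OF a(1)] by (auto simp: quotient_image)
  qed
  show "\<exists>Y \<in> A' // R'. \<exists>a \<in> A. X = R `` {a} \<and> Y = R' `` {a}" if X: "X \<in> A // R" for X
    using X A(2) by (auto simp: quotient_image)
  show "X = X'" if h: "\<exists>a \<in> A. X = R `` {a} \<and> Y = R' `` {a}" "\<exists>a \<in> A. X' = R `` {a} \<and> Y = R' `` {a}"
    for X X' Y
  proof -
    obtain a a' where a: "a \<in> A" "a' \<in> A" "X = R `` {a}" "X' = R `` {a'}" "R' `` {a} = R' `` {a'}"
      using h by blast
    then have "(p a, p a') \<in> R" using p(1) eq(2) by blast
    then show ?thesis using a p(3) eq(1) by simp
  qed
  show "Y = Y'" if h: "\<exists>a \<in> A. X = R `` {a} \<and> Y = R' `` {a}" "\<exists>a \<in> A. X = R `` {a} \<and> Y' = R' `` {a}"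
    for X Y Y'
  proof -
    obtain a a' where a: "a \<in> A" "a' \<in> A" "Y = R' `` {a}" "Y' = R' `` {a'}" "R `` {a} = R `` {a'}"
      using h by blast
    then show ?thesis using i eq by simp
  qed
qed

lemma card_ordered_pairs:
  fixes A :: "nat set"
  assumes "finite A"
  shows "2 * card {(a, b). a \<in> A \<and> b \<in> A \<and> a < b} = card A * (card A - 1)"
  using assms
proof (induction rule: finite_linorder_max_induct)
  case empty
  then show ?case by simp
next
  case (insert m A)
  let ?P = "\<lambda>A. {(a, b). a \<in> A \<and> b \<in> A \<and> a < (b :: nat)}"
  have "?P (insert m A) = ?P A \<union> (\<lambda>a. (a, m)) ` A" using insert.hyps(2) by force
  moreover have "finite (?P A)" by (rule finite_subset[of _ "A \<times> A"]) (use insert.hyps in auto)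
  moreover have "?P A \<inter> (\<lambda>a. (a, m)) ` A = {}" using insert.hyps(2) by auto
  moreover have "card ((\<lambda>a. (a, m)) ` A) = card A" by (intro card_image inj_onI) auto
  ultimately have "card (?P (insert m A)) = card (?P A) + card A"
    using insert.hyps by (simp add: card_Un_disjoint)
  moreover have "m \<notin> A" using insert.hyps(2) by blast
  ultimately show ?case
    using insert.IH insert.hyps(1) by (cases "card A") (auto simp: algebra_simps)
qed

definition colour_pairs :: "nat \<Rightarrow> (nat \<times> nat) set" where
  "colour_pairs D = {(c, c'). c < c' \<and> c' \<le> D}"

definition pair_adj :: "cgraph \<Rightarrow> nat \<times> nat \<Rightarrow> (nat + nat) rel" where
  "pair_adj G p = (adj {e \<in> edges G. colour e = fst p \<or> colour e = snd p})\<^sup>*"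

lemma card_colour_pairs: "2 * card (colour_pairs D) = (D + 1) * D"
  "c \<le> D \<Longrightarrow> 2 * card {p \<in> colour_pairs D. c \<noteq> fst p \<and> c \<noteq> snd p} = D * (D - 1)"
proof -
  have "colour_pairs D = {(a, b). a \<in> {..D} \<and> b \<in> {..D} \<and> a < b}" by (auto simp: colour_pairs_def)
  then show "2 * card (colour_pairs D) = (D + 1) * D" using card_ordered_pairs[of "{..D}"] by simp
  have "{p \<in> colour_pairs D. c \<noteq> fst p \<and> c \<noteq> snd p} = {(a, b). a \<in> {..D} - {c} \<and> b \<in> {..D} - {c} \<and>
    a < b}"
    by (auto simp: colour_pairs_def)
  then show "2 * card {p \<in> colour_pairs D. c \<noteq> fst p \<and> c \<noteq> snd p} = D * (D - 1)" if "c \<le> D"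
    using card_ordered_pairs[of "{..D} - {c}"] that by simp
qed

lemma finite_colour_pairs: "finite (colour_pairs D)"
  by (rule finite_subset[of _ "{..D} \<times> {..D}"]) (auto simp: colour_pairs_def)

lemma card_faces:
  assumes "finite (vertices G)"
  shows "card (faces D G) = (\<Sum>p \<in> colour_pairs D. card (vertices G // pair_adj G p))"
proof -
  have "faces D G = (\<lambda>(p, X). (fst p, snd p, X)) ` (SIGMA p : colour_pairs D. vertices G // pair_adj
    G p)"
    by (force simp: faces_def colour_pairs_def pair_adj_def image_iff)
  moreover have "inj_on (\<lambda>(p, X). (fst p, snd p, X)) (SIGMA p : colour_pairs D. vertices G //
    pair_adj G p)"
    by (rule inj_onI) (auto simp: prod_eq_iff)
  ultimately have "card (faces D G) = card (SIGMA p : colour_pairs D. vertices G // pair_adj G p)"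
    by (simp add: card_image)
  also have "\<dots> = (\<Sum>p \<in> colour_pairs D. card (vertices G // pair_adj G p))"
    using assms finite_colour_pairs by (intro card_SigmaI) (auto simp: quotient_image)
  finally show ?thesis .
qed

lemma vertices_insert_melon: "vertices (insert_melon D w' b' e G) =
  insert (Inl w') (insert (Inr b') (vertices G))"
  by (auto simp: vertices_def insert_melon_simps)

text \<open>Neither colour of the pair is cut, and both occur among the parallel edges of the melon.
  So the old faces remain, and \<open>w'\<close>, \<open>b'\<close> are the vertices of a new face
  of length two.\<close>

lemma card_faces_other:
  assumes cg: "coloured_graph D G" and e: "(w, c, b) \<in> edges G" and new: "w' \<notin> white G" "b' \<notin> black G"
    and p: "p \<in> colour_pairs D" "c \<noteq> fst p" "c \<noteq> snd p"
  shows "card (vertices (insert_melon D w' b' (w, c, b) G) // pair_adj (insert_melon D w' b' (w, c,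
    b) G) p) =
    card (vertices G // pair_adj G p) + 1"
proof -
  note pg = partial_graphD[OF coloured_graphD(1)[OF cg]]
  let ?G = "insert_melon D w' b' (w, c, b) G"
  let ?S = "{e \<in> edges G. colour e = fst p \<or> colour e = snd p}"
  let ?S' = "{e \<in> edges ?G. colour e = fst p \<or> colour e = snd p}"
  let ?N = "{Inl w', Inr b'}"
  have pD: "fst p \<le> D" "snd p \<le> D" using p(1) by (auto simp: colour_pairs_def)
  have S': "(u, d, v) \<in> ?S' \<longleftrightarrow> (u, d, v) \<in> ?S \<or> u = w' \<and> v = b' \<and> (d = fst p \<or> d = snd p)" for u d v
    using p pD by (auto simp: insert_melon_simps colour_def)
  have V: "vertices ?G = vertices G \<union> ?N" "vertices G \<inter> ?N = {}"
    using new unfolding vertices_insert_melon by (auto simp: vertices_def)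
  have SV: "u \<in> vertices G \<and> v \<in> vertices G" if "(u, v) \<in> adj ?S" for u v
    using that pg(3) by (cases rule: adj_cases) (auto simp: vertices_def)
  have cases': "(u, v) \<in> adj ?S \<or> u \<in> ?N \<and> v \<in> ?N" if "(u, v) \<in> adj ?S'" for u v
    using that
  proof (cases rule: adj_cases)
    case (1 x d y)
    then show ?thesis using S'[of x d y] adj_edge(1)[of x d y ?S] by blast
  next
    case (2 x d y)
    then show ?thesis using S'[of x d y] adj_edge(2)[of x d y ?S] by blast
  qed
  have "?S \<subseteq> ?S'" using S' by auto
  then have sub: "(adj ?S)\<^sup>* \<subseteq> (adj ?S')\<^sup>*" by (intro rtrancl_mono adj_mono)
  have old: "v \<in> vertices G \<and> (u, v) \<in> (adj ?S)\<^sup>*" if "(u, v) \<in> (adj ?S')\<^sup>*" "u \<in> vertices G" for u v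
    using that(1)
  proof induction
    case base
    then show ?case using that(2) by simp
  next
    case (step v z)
    then have "(v, z) \<in> adj ?S" using cases'[of v z] V(2) by blast
    then show ?case using step SV[of v z] by (meson rtrancl.rtrancl_into_rtrancl)
  qed
  have new': "v \<in> ?N" if "(u, v) \<in> (adj ?S')\<^sup>*" "u \<in> ?N" for u v
    using that(1)
  proof induction
    case base
    then show ?case using that(2) by simp
  next
    case (step v z)
    then show ?case using cases'[of v z] V(2) SV[of v z] by blast
  qed
  have "(w', fst p, b') \<in> ?S'" using S'[of w' "fst p" b'] by simp
  note a = adj_edge[OF this]
  have N: "(adj ?S')\<^sup>* `` {u} = ?N" if "u \<in> ?N" for u
    using new'[OF _ that] that a by (auto intro: r_into_rtrancl)
  have O: "(adj ?S')\<^sup>* `` {u} = (adj ?S)\<^sup>* `` {u}" if "u \<in> vertices G" for u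
    using old[OF _ that] sub by blast
  have "(\<lambda>a. (adj ?S')\<^sup>* `` {a}) ` (vertices G \<union> ?N) =
      (\<lambda>a. (adj ?S')\<^sup>* `` {a}) ` vertices G \<union> (\<lambda>a. (adj ?S')\<^sup>* `` {a}) ` ?N" by (rule image_Un)
  also have "(\<lambda>a. (adj ?S')\<^sup>* `` {a}) ` vertices G = (\<lambda>a. (adj ?S)\<^sup>* `` {a}) ` vertices G"
    using O by (rule image_cong[OF refl])
  also have "(\<lambda>a. (adj ?S')\<^sup>* `` {a}) ` ?N = {?N}" using N by auto
  finally have eq: "vertices ?G // (adj ?S')\<^sup>* = insert ?N (vertices G // (adj ?S)\<^sup>*)"
    unfolding quotient_image V(1) by simp
  have "?N \<notin> vertices G // (adj ?S)\<^sup>*"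
  proof
    assume "?N \<in> vertices G // (adj ?S)\<^sup>*"
    then obtain u where "u \<in> vertices G" "?N = (adj ?S)\<^sup>* `` {u}" by (auto simp: quotient_image)
    then have "u \<in> ?N" by blast
    then show False using V(2) \<open>u \<in> vertices G\<close> by blast
  qed
  moreover have "finite (vertices G)" using pg(1,2) by (simp add: vertices_def)
  ultimately show ?thesis unfolding pair_adj_def eq by (simp add: quotient_image)
qed

text \<open>One colour of the pair is that of the cut edge. The face through that edge is lengthened
  by the detour over \<open>b'\<close> and \<open>w'\<close>, and no face is created or
  merged.\<close>

lemma card_faces_through:
  assumes cg: "coloured_graph D G" and e: "(w, c, b) \<in> edges G" and new: "w' \<notin> white G" "b' \<notin> black G"
    and p: "p \<in> colour_pairs D" "c = fst p \<or> c = snd p"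
  shows "card (vertices (insert_melon D w' b' (w, c, b) G) // pair_adj (insert_melon D w' b' (w, c,
    b) G) p) =
    card (vertices G // pair_adj G p)"
proof -
  note pg = partial_graphD[OF coloured_graphD(1)[OF cg]]
  let ?G = "insert_melon D w' b' (w, c, b) G"
  let ?S = "{e \<in> edges G. colour e = fst p \<or> colour e = snd p}"
  let ?S' = "{e \<in> edges ?G. colour e = fst p \<or> colour e = snd p}"
  have wb: "w \<in> white G" "b \<in> black G" using pg(3)[OF e] by auto
  obtain d where d: "d \<noteq> c" "d = fst p \<or> d = snd p" "d \<le> D" "fst p = c \<or> fst p = d" "snd p = c \<or>
    snd p = d"
    using p by (auto simp: colour_pairs_def)
  have S': "(u, k, v) \<in> ?S' \<longleftrightarrow> (u, k, v) \<in> ?S \<and> (u, k, v) \<noteq> (w, c, b) \<or> (u, k, v) = (w', d, b') \<or>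
      (u, k, v) = (w, c, b') \<or> (u, k, v) = (w', c, b)" for u k v
    using p(2) d by (auto simp: insert_melon_simps colour_def)
  have ewb: "(w, c, b) \<in> ?S" using e p(2) by (auto simp: colour_def)
  \<comment> \<open>Each new vertex is sent to its old neighbour along the colour \<open>c\<close>:
    \<open>w'\<close> to \<open>b\<close>, and \<open>b'\<close> to \<open>w\<close>. The inner edge
    of colour \<open>d\<close> is thus mapped to the cut edge.\<close>
  define f where "f u = (if u = Inl w' then Inr b else if u = Inr b' then Inl w else u)" for u
  have fS: "f (Inl u) = Inl u \<and> f (Inr v) = Inr v" if "(u, k, v) \<in> ?S" for u k v
    using that pg(3)[of u k v] new by (auto simp: f_def)
  have edge: "(f (Inl u), f (Inr v)) \<in> (adj ?S)\<^sup>*" if h: "(u, k, v) \<in> ?S'" for u k v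
    using h[unfolded S']
  proof (elim disjE conjE)
    assume uv: "(u, k, v) \<in> ?S"
    show ?thesis
      unfolding conjunct1[OF fS[OF uv]] conjunct2[OF fS[OF uv]] using adj_edge(1)[OF uv]
        by (rule r_into_rtrancl)
  next
    assume "(u, k, v) = (w', d, b')"
    then show ?thesis using adj_edge(2)[OF ewb] by (auto simp: f_def)
  next
    assume "(u, k, v) = (w, c, b')"
    then show ?thesis using wb new by (auto simp: f_def)
  next
    assume "(u, k, v) = (w', c, b)"
    then show ?thesis using wb new by (auto simp: f_def)
  qed
  have symS: "sym ((adj T)\<^sup>*)" for T by (intro sym_rtrancl sym_adj)
  have step: "(f u, f v) \<in> (adj ?S)\<^sup>*" if "(u, v) \<in> adj ?S'" for u v
    using that
  proof (cases rule: adj_cases)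
    case (1 x k y)
    then show ?thesis using edge by simp
  next
    case (2 x k y)
    then show ?thesis using edge symD[OF symS] by simp
  qed
  have e': "(w, c, b') \<in> ?S'" "(w', d, b') \<in> ?S'" "(w', c, b) \<in> ?S'" by (simp_all only: S' simp_thms)
  have path: "(Inl w, Inr b) \<in> (adj ?S')\<^sup>*"
    using adj_edge(1)[OF e'(1)] adj_edge(2)[OF e'(2)] adj_edge(1)[OF e'(3)]
    by (meson converse_rtrancl_into_rtrancl r_into_rtrancl)
  have edge2: "(Inl u, Inr v) \<in> (adj ?S')\<^sup>*" if "(u, k, v) \<in> ?S" for u k v
  proof (cases "(u, k, v) = (w, c, b)")
    case True
    then show ?thesis using path by simp
  next
    case False
    then have "(u, k, v) \<in> ?S'" using that S' by blast
    then show ?thesis by (rule r_into_rtrancl[OF adj_edge(1)])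
  qed
  have step2: "(u, v) \<in> (adj ?S')\<^sup>*" if "(u, v) \<in> adj ?S" for u v
    using that
  proof (cases rule: adj_cases)
    case (1 x k y)
    then show ?thesis using edge2 by simp
  next
    case (2 x k y)
    then show ?thesis using edge2 symD[OF symS] by simp
  qed
  show ?thesis
    unfolding pair_adj_def
  proof (rule card_quotient_eq[OF equiv_adj equiv_adj, where p = f])
    show "finite (vertices ?G)" unfolding vertices_insert_melon using pg(1,2) by (simp add: vertices_def)
    show "vertices G \<subseteq> vertices ?G" by (auto simp: vertices_insert_melon)
    show "(f u, f v) \<in> (adj ?S)\<^sup>*" if "(u, v) \<in> (adj ?S')\<^sup>*" for u v
      using that by induction (auto dest: step intro: rtrancl_trans)
    show "f u \<in> vertices G \<and> (u, f u) \<in> (adj ?S')\<^sup>*" if "u \<in> vertices ?G" for u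
      using that[unfolded vertices_insert_melon] wb adj_edge(1)[OF e'(3)] adj_edge(2)[OF e'(1)]
      by (auto simp: f_def vertices_def)
    show "f u = u" if "u \<in> vertices G" for u using that new by (auto simp: f_def vertices_def)
    show "(u, v) \<in> (adj ?S')\<^sup>*" if "(u, v) \<in> (adj ?S)\<^sup>*" for u v
      using that by induction (auto dest: step2 intro: rtrancl_trans)
  qed
qed

text \<open>Each pair of colours without \<open>c\<close> gains one face. There are
  \<open>D * (D - 1) / 2\<close> such pairs, which is also the coefficient of half the vertex number
  in the degree, and the number of vertices grows by two.\<close>

lemma degree_insert_melon:
  assumes cg: "coloured_graph D G" and e: "e \<in> edges G" and new: "w' \<notin> white G" "b' \<notin> black G"
  shows "degree D (insert_melon D w' b' e G) = degree D G"
proof -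
  obtain w c b where wcb: "e = (w, c, b)" by (cases e)
  note pg = partial_graphD[OF coloured_graphD(1)[OF cg]]
  let ?G = "insert_melon D w' b' e G"
  let ?q = "\<lambda>p. card (vertices G // pair_adj G p)" and ?q' = "\<lambda>p. card (vertices ?G // pair_adj ?G p)"
  let ?N = "{p \<in> colour_pairs D. c \<noteq> fst p \<and> c \<noteq> snd p}"
  have cD: "c \<le> D" using pg(3) e wcb by blast
  have fin: "finite (vertices G)" "finite (vertices ?G)"
    unfolding vertices_insert_melon using pg(1,2) by (simp_all add: vertices_def)
  have card: "card (vertices ?G) = card (vertices G) + 2"
  proof -
    have "Inl w' \<notin> vertices G" "Inr b' \<notin> vertices G" using new by (auto simp: vertices_def)
    then show ?thesis unfolding vertices_insert_melon using fin(1) by simp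
  qed
  have q': "?q' p = ?q p + (if c \<noteq> fst p \<and> c \<noteq> snd p then 1 else 0)" if "p \<in> colour_pairs D" for p
    using card_faces_other[OF cg e[unfolded wcb] new that] card_faces_through[OF cg e[unfolded wcb]
      new that]
    unfolding wcb by auto
  have "card (faces D ?G) = (\<Sum>p \<in> colour_pairs D. ?q p + (if c \<noteq> fst p \<and> c \<noteq> snd p then 1 else 0))"
    unfolding card_faces[OF fin(2)] using q' by (intro sum.cong) auto
  also have "\<dots> = card (faces D G) + card ?N"
    unfolding card_faces[OF fin(1)] sum.distrib
    by (simp add: sum.If_cases finite_colour_pairs Int_def conj_commute)
  finally have "card (faces D ?G) = card (faces D G) + D * (D - 1) div 2"
    using card_colour_pairs(2)[OF cD] by simp
  then show ?thesis unfolding degree_def card by (simp add: algebra_simps)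
qed

text \<open>Each of the \<open>D * (D + 1) / 2\<close> pairs of colours has a single face, and
  \<open>D * (D - 1) / 2 + D\<close> is the same number.\<close>

lemma degree_Delta: "1 \<le> D \<Longrightarrow> degree D (fst (Delta D r w b)) = 0"
proof -
  assume D: "1 \<le> D"
  let ?G = "fst (Delta D r w b)"
  have V: "vertices ?G = {Inl w, Inr b}" by (auto simp: Delta_def vertices_def)
  have "card (vertices ?G // pair_adj ?G p) = 1" if p: "p \<in> colour_pairs D" for p
  proof -
    let ?S = "{e \<in> edges ?G. colour e = fst p \<or> colour e = snd p}"
    have "fst p \<le> D" using p by (auto simp: colour_pairs_def)
    then have "(w, fst p, b) \<in> ?S" by (auto simp: Delta_def colour_def)
    then have "(Inl w, Inr b) \<in> pair_adj ?G p" unfolding pair_adj_def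
      by (rule r_into_rtrancl[OF adj_edge(1)])
    then have "pair_adj ?G p `` {Inl w} = pair_adj ?G p `` {Inr b}"
      using equiv_class_eq[OF equiv_adj] unfolding pair_adj_def by blast
    then show ?thesis unfolding V quotient_image by simp
  qed
  then have "card (faces D ?G) = card (colour_pairs D)" by (simp add: card_faces V)
  \<comment> \<open>The product is even, so the division in \<open>degree\<close> loses nothing and
    the identity can be checked after doubling.\<close>
  moreover have "even (D * (D - 1))" by (cases D) auto
  then have "2 * (D * (D - 1) div 2) = D * (D - 1)" by (rule dvd_mult_div_cancel)
  then have "2 * int (D * (D - 1) div 2) = int (D * (D - 1))" by linarith
  moreover have "2 * int (card (colour_pairs D)) = int ((D + 1) * D)"
    using card_colour_pairs(1)[of D] by linarith
  ultimately have "2 * degree D ?G = int (D * (D - 1)) + 2 * int D - int ((D + 1) * D)"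
    unfolding degree_def V by simp
  also have "\<dots> = 0" using D by (cases D) (auto simp: algebra_simps)
  finally show ?thesis by simp
qed

subsection \<open>The core decomposition of a blown-up core\<close>

lemma subgraph_antisym: "subgraph H K \<Longrightarrow> subgraph K H \<Longrightarrow> H = K" for H K :: cgraph
  by (intro cgraph.equality) (auto simp: subgraph_def)

lemma unroot_not_single:
  assumes "rooted_graph D (G, (w, c, b))" "avoids x y G"
  shows "unroot x y (G, (w, c, b)) \<noteq> {e}"
proof
  assume s: "unroot x y (G, (w, c, b)) = {e}"
  have "w \<in> white G" using rooted_cover(1,4)[OF assms(1)] by auto
  then have "Some w \<noteq> x" using assms(2) by (auto simp: avoids_def)
  moreover have "(Some w, c, y) \<in> unroot x y (G, (w, c, b))" "(x, c, Some b) \<in> unroot x y (G, (w, c, b))"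
    by (auto simp: in_unroot)
  ultimately show False using s by (metis Pair_inject singletonD)
qed

lemma whites_unroot:
  assumes "rooted_graph D (G, (w, c, b))"
  shows "Some u \<in> whites (unroot None None (G, (w, c, b))) \<longleftrightarrow> u \<in> white G"
    and "Some u \<in> blacks (unroot None None (G, (w, c, b))) \<longleftrightarrow> u \<in> black G"
proof -
  have "white (graph_of (None, c, None) (unroot None None (G, (w, c, b)))) = white G"
    "black (graph_of (None, c, None) (unroot None None (G, (w, c, b)))) = black G"
    using graph_of_unroot[OF assms avoids_None] by simp_all
  then show "Some u \<in> whites (unroot None None (G, (w, c, b))) \<longleftrightarrow> u \<in> white G"
    "Some u \<in> blacks (unroot None None (G, (w, c, b))) \<longleftrightarrow> u \<in> black G"
    by (auto simp: graph_of_def inner_whites_def inner_blacks_def)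
qed

text \<open>Some melon-free core \<open>C\<close> with blow-ups \<open>F\<close> for the graph cut
  at its root. The decomposition will be computed from an arbitrary such pair, so uniqueness of the
  core is a by-product: \<open>core_decomposition\<close> is a function of the graph alone.\<close>

locale decomposed =
  fixes D :: nat and G :: cgraph and w c b :: nat and C :: "(nat option \<times> nat \<times> nat option) set"
    and F :: "nat option \<times> nat \<times> nat option \<Rightarrow> (nat option \<times> nat \<times> nat option) set"
  assumes D: "2 \<le> D" and R: "rooted_graph D (G, (w, c, b))" and C: "bordered D (None, c, None) C"
    and nm: "no_melon D C" and fam: "family D C F (unroot None None (G, (w, c, b)))"
begin

abbreviation E where "E \<equiv> unroot None None (G, (w, c, b))"

abbreviation Go where "Go \<equiv> op_graph (G, (w, c, b))"

sublocale blown_up D "(None, c, None)" C F E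
  by (rule blown_up.intro[OF D C fam])

definition comp :: "nat option \<times> nat \<times> nat option \<Rightarrow> cgraph" where
  "comp e = graph_of e (F e)"

lemma D1: "1 \<le> D"
  using D by simp

lemma None_C: "None \<in> whites C" "None \<in> blacks C"
  using bordered_border_white[OF C] bordered_border_black[OF C] by (auto intro: in_whites in_blacks)

lemma E_edge: "(Some u, d, Some v) \<in> E \<longleftrightarrow> (u, d, v) \<in> edges Go"
  by (auto simp: in_unroot)

lemma E_None: "(Some u, d, None) \<in> E \<longleftrightarrow> u = w \<and> d = c" "(None, d, Some v) \<in> E \<longleftrightarrow> v = b \<and> d = c"
  by (auto simp: in_unroot)

lemma inner_Some: "e \<in> C \<Longrightarrow> inner_whites e (F e) \<subseteq> range Some"
  "e \<in> C \<Longrightarrow> inner_blacks e (F e) \<subseteq> range Some"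
proof -
  assume "e \<in> C"
  then have "inner_whites e (F e) \<inter> whites C = {}" "inner_blacks e (F e) \<inter> blacks C = {}"
    using fam unfolding family_def by blast+
  then have "None \<notin> inner_whites e (F e)" "None \<notin> inner_blacks e (F e)" using None_C by auto
  then show "inner_whites e (F e) \<subseteq> range Some" "inner_blacks e (F e) \<subseteq> range Some"
    by (metis (no_types) option.exhaust rangeI subsetI)+
qed

lemma comp_single: "F e = {e} \<Longrightarrow> comp e = empty_graph"
  by (cases e) (auto simp: comp_def graph_of_def empty_graph_def inner_whites_def inner_blacks_def
    whites_def blacks_def)

lemma white_comp: "u \<in> white (comp e) \<longleftrightarrow> Some u \<in> inner_whites e (F e)"
  and black_comp: "u \<in> black (comp e) \<longleftrightarrow> Some u \<in> inner_blacks e (F e)"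
  by (simp_all add: comp_def graph_of_def)

lemma F_sub: "e \<in> C \<Longrightarrow> whites (F e) \<subseteq> whites E" "e \<in> C \<Longrightarrow> blacks (F e) \<subseteq> blacks E"
  using in_E unfolding whites_def blacks_def by blast+

lemma comp_subgraph: "e \<in> C \<Longrightarrow> subgraph (comp e) Go"
proof -
  assume e: "e \<in> C"
  have "white (comp e) \<subseteq> white G" "black (comp e) \<subseteq> black G"
    using whites_unroot[OF R] F_sub[OF e]
      by (auto simp: white_comp black_comp inner_whites_def inner_blacks_def)
  moreover have "(u, d, v) \<in> edges Go" if "(u, d, v) \<in> edges (comp e)" for u d v
  proof -
    have "(Some u, d, Some v) \<in> F e" using that by (simp add: comp_def graph_of_def)
    then show ?thesis using in_E[OF e] E_edge by blast
  qed
  then have "edges (comp e) \<subseteq> edges Go" by auto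
  ultimately show ?thesis by (simp add: subgraph_def)
qed

lemma F_unroot:
  assumes e: "(x, k, y) \<in> C" and ne: "F (x, k, y) \<noteq> {(x, k, y)}"
  obtains G1 w1 b1 where "melonic D (G1, (w1, k, b1))" "rooted_graph D (G1, (w1, k, b1))"
    "comp (x, k, y) = op_graph (G1, (w1, k, b1))" "unroot x y (G1, (w1, k, b1)) = F (x, k, y)"
proof -
  obtain G1 w1 b1 where m: "melonic D (G1, (w1, k, b1))" "avoids x y G1"
    "unroot x y (G1, (w1, k, b1)) = F (x, k, y)"
    using melonic_of_blowup[OF D F_blowup[OF e] C_colour[OF e] inner_Some[OF e]] ne by blast
  have R1: "rooted_graph D (G1, (w1, k, b1))" using blowup_of_melonic[OF D m(1)] by simp
  have "comp (x, k, y) = op_graph (G1, (w1, k, b1))"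
    using graph_of_unroot[OF R1 m(2)] m(3) by (simp add: comp_def)
  then show thesis using that m(1,3) R1 by blast
qed

lemma comp_props:
  assumes e: "(x, k, y) \<in> C" and ne: "F (x, k, y) \<noteq> {(x, k, y)}"
  obtains w1 b1 where "open_melonic D (comp (x, k, y))" "free_white D (comp (x, k, y)) = {(w1, k)}"
    "free_black D (comp (x, k, y)) = {(b1, k)}" "(Some w1, k, y) \<in> F (x, k, y)"
      "(x, k, Some b1) \<in> F (x, k, y)"
    "w1 \<in> white (comp (x, k, y))"
proof -
  obtain G1 w1 b1 where m: "melonic D (G1, (w1, k, b1))" "rooted_graph D (G1, (w1, k, b1))"
    and comp: "comp (x, k, y) = op_graph (G1, (w1, k, b1))" and un: "unroot x y (G1, (w1, k, b1)) =
      F (x, k, y)"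
    by (rule F_unroot[OF assms])
  note op = open_op_graph[OF D1 m(2)]
  have om: "open_melonic D (comp (x, k, y))" using op(1,4) m(1) by (simp add: open_melonic_def comp)
  have fr: "free_white D (comp (x, k, y)) = {(w1, k)}" "free_black D (comp (x, k, y)) = {(b1, k)}"
    using op(2,3) unfolding comp by auto
  have in_F: "(Some w1, k, y) \<in> F (x, k, y)" "(x, k, Some b1) \<in> F (x, k, y)"
    unfolding un[symmetric] in_unroot by simp_all
  have "(w1, k) \<in> free_white D (comp (x, k, y))" unfolding fr by simp
  then have "w1 \<in> white (comp (x, k, y))" by (simp add: free_white_def)
  then show thesis by (rule that[OF om fr in_F])
qed

lemma E_at_white: "u \<in> white G \<Longrightarrow> d \<le> D \<Longrightarrow> \<exists>v. (Some u, d, v) \<in> E"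
proof -
  assume "u \<in> white G" and d: "d \<le> D"
  then obtain d' v' where "(Some u, d', v') \<in> E" using whites_unroot(1)[OF R, of u]
    by (auto simp: whites_def)
  then show ?thesis using bordered_white_full[OF E_bordered _ _ d, of "Some u" d' v'] by simp
qed

lemma E_at_black: "v \<in> black G \<Longrightarrow> d \<le> D \<Longrightarrow> \<exists>u. (u, d, Some v) \<in> E"
proof -
  assume "v \<in> black G" and d: "d \<le> D"
  then obtain d' u' where "(u', d', Some v) \<in> E" using whites_unroot(2)[OF R, of v]
    by (auto simp: blacks_def)
  then show ?thesis using bordered_black_full[OF E_bordered _ _ d, of u' d' "Some v"] by simp
qed

text \<open>\<open>K\<close> is bordered by the ends \<open>x\<close> and \<open>y\<close> that its
  two unmatched half-edges have in \<open>E\<close>. Once these are known not to be vertices of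
  \<open>K\<close>, this makes \<open>K\<close> a blow-up contained in \<open>E\<close>, and
  \<open>blowup_in_family\<close> puts it into one \<open>F e\<close>.\<close>

lemma open_melonic_in_comp:
  assumes K: "open_subgraph D K Go" "open_melonic D K"
  shows "\<exists>e \<in> C. F e \<noteq> {e} \<and> subgraph K (comp e)"
proof -
  have oK: "open_graph D K" and sub: "white K \<subseteq> white G" "black K \<subseteq> black G" "edges K \<subseteq> edges Go"
    using K(1) by (auto simp: open_subgraph_def subgraph_def)
  obtain w1 k b1 where cl: "cl_graph D K = (K\<lparr>edges := insert (w1, k, b1) (edges K)\<rparr>, (w1, k, b1))"
    and fr: "free_white D K = {(w1, k)}" "free_black D K = {(b1, k)}"
    and RK: "rooted_graph D (cl_graph D K)" and op: "op_graph (cl_graph D K) = K"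
    by (rule rooted_cl_graph[OF oK])
  let ?K = "K\<lparr>edges := insert (w1, k, b1) (edges K)\<rparr>"
  have RK': "rooted_graph D (?K, (w1, k, b1))" using RK cl by simp
  have pK: "partial_graph D K" using oK by (simp add: open_graph_def)
  note pg = partial_graphD[OF pK]
  have w1: "w1 \<in> white K" "k \<le> D" "\<And>v. (w1, k, v) \<notin> edges K" using fr(1) by (auto simp: free_white_def)
  have b1: "b1 \<in> black K" "\<And>u. (u, k, b1) \<notin> edges K" using fr(2) by (auto simp: free_black_def)
  have mw: "(\<exists>v. (u, d, v) \<in> edges K) \<or> u = w1 \<and> d = k" if "u \<in> white K" "d \<le> D" for u d
    using that fr(1) by (auto simp: free_white_def)
  have mb: "(\<exists>u. (u, d, v) \<in> edges K) \<or> v = b1 \<and> d = k" if "v \<in> black K" "d \<le> D" for v d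
    using that fr(2) by (auto simp: free_black_def)
  have KE: "(Some u, d, Some v) \<in> E" if "(u, d, v) \<in> edges K" for u d v using sub(3) that E_edge by blast
  obtain y where y: "(Some w1, k, y) \<in> E" using E_at_white[of w1 k] w1 sub(1) by blast
  obtain x where x: "(x, k, Some b1) \<in> E" using E_at_black[of b1 k] b1 w1(2) sub(2) by blast
  \<comment> \<open>Otherwise that edge would join the two unmatched half-edges of \<open>K\<close>,
    so no edge of \<open>E\<close> would leave \<open>K\<close>; but \<open>E\<close> is connected
    and contains the border vertex \<open>None\<close>.\<close>
  have no: "(Some w1, k, Some b1) \<notin> E"
  proof
    assume h: "(Some w1, k, Some b1) \<in> E"
    have PQ: "(p \<in> Some ` white K) = (q \<in> Some ` black K)" if pq: "(p, d, q) \<in> E" for p d q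
    proof
      assume "p \<in> Some ` white K"
      then obtain u where u: "p = Some u" "u \<in> white K" by blast
      have "d \<le> D" using bordered_colour[OF E_bordered pq] .
      from mw[OF u(2) this] show "q \<in> Some ` black K"
      proof
        assume "\<exists>v. (u, d, v) \<in> edges K"
        then obtain v where v: "(u, d, v) \<in> edges K" by blast
        then have "q = Some v" using bordered_white_unique[OF E_bordered, of p d q
          "Some v"] pq KE u(1) by simp
        then show ?thesis using pg(3)[OF v] by blast
      next
        assume "u = w1 \<and> d = k"
        then have "q = Some b1" using bordered_white_unique[OF E_bordered, of p d q
          "Some b1"] pq h u(1) by simp
        then show ?thesis using b1 by blast
      qed
    next
      assume "q \<in> Some ` black K"
      then obtain v where v: "q = Some v" "v \<in> black K" by blast
      have "d \<le> D" using bordered_colour[OF E_bordered pq] .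
      from mb[OF v(2) this] show "p \<in> Some ` white K"
      proof
        assume "\<exists>u. (u, d, v) \<in> edges K"
        then obtain u where u: "(u, d, v) \<in> edges K" by blast
        then have "p = Some u" using bordered_black_unique[OF E_bordered, of p d q
          "Some u"] pq KE v(1) by simp
        then show ?thesis using pg(3)[OF u] by blast
      next
        assume "v = b1 \<and> d = k"
        then have "p = Some w1" using bordered_black_unique[OF E_bordered, of p d q
          "Some w1"] pq h v(1) by simp
        then show ?thesis using w1 by blast
      qed
    qed
    obtain z where z: "\<And>p d q. (p, d, q) \<in> E \<Longrightarrow> (p \<in> Some ` white K) = z \<and> (q \<in> Some ` black K) = z"
      by (rule bordered_connected[OF E_bordered, of "\<lambda>p. p \<in> Some ` white K"
        "\<lambda>q. q \<in> Some ` black K"], erule PQ, rule that)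
    obtain q where "(None, c, q) \<in> E" using bordered_border_white[OF E_bordered] by blast
    from z[OF this] z[OF h] w1(1) show False by auto
  qed
  have av: "avoids x y ?K"
    unfolding avoids_def
  proof
    show "x \<notin> Some ` white ?K"
    proof
      assume "x \<in> Some ` white ?K"
      then obtain u where u: "x = Some u" "u \<in> white K" by auto
      from mw[OF u(2) w1(2)] show False
      proof
        assume "\<exists>v. (u, k, v) \<in> edges K"
        then obtain v where v: "(u, k, v) \<in> edges K" by blast
        then have "Some b1 = Some v"
          using bordered_white_unique[OF E_bordered, of x k "Some b1" "Some v"] x KE u(1) by simp
        then show False using v b1(2) by blast
      next
        assume "u = w1 \<and> k = k"
        then show False using no x u(1) by simp
      qed
    qed
    show "y \<notin> Some ` black ?K"
    proof
      assume "y \<in> Some ` black ?K"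
      then obtain v where v: "y = Some v" "v \<in> black K" by auto
      from mb[OF v(2) w1(2)] show False
      proof
        assume "\<exists>u. (u, k, v) \<in> edges K"
        then obtain u where u: "(u, k, v) \<in> edges K" by blast
        then have "Some w1 = Some u"
          using bordered_black_unique[OF E_bordered, of "Some w1" k y "Some u"] y KE v(1) by simp
        then show False using u w1(3) by blast
      next
        assume "v = b1 \<and> k = k"
        then show False using no y v(1) by simp
      qed
    qed
  qed
  let ?S = "unroot x y (?K, (w1, k, b1))"
  have bl: "blowup D (x, k, y) ?S"
    using blowup_of_melonic[OF D, of "(?K, (w1, k, b1))"] K(2) av cl by (simp add: open_melonic_def)
  have SE: "?S \<subseteq> E"
  proof
    fix z assume z: "z \<in> ?S"
    obtain p d q where "z = (p, d, q)" by (cases z)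
    then show "z \<in> E" using z x y KE by (auto simp: in_unroot[of _ _ _ x y])
  qed
  have ne: "?S \<noteq> {(x, k, y)}" by (rule unroot_not_single[OF RK' av])
  obtain e where e: "e \<in> C" "?S \<subseteq> F e" using blowup_in_family[OF nm bl SE ne] by blast
  obtain p q r where pqr: "e = (p, q, r)" by (cases e)
  note Fb = F_bordered[OF e(1), unfolded pqr]
  have bS: "bordered D (x, k, y) ?S" using bordered_unroot[OF D1 RK' av] .
  have wS: "Some u \<in> inner_whites e (F e)" if u: "u \<in> white K" for u
  proof -
    obtain d v where dv: "(u, d, v) \<in> edges ?K" using rooted_cover(2)[OF RK', of u] u by auto
    have "\<exists>v. (Some u, d, v) \<in> ?S" using dv unfolding in_unroot by blast
    then obtain v where v: "(Some u, d, v) \<in> ?S" by blast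
    have "Some u \<noteq> x" using av u by (auto simp: avoids_def)
    then have f: "\<exists>v. (Some u, d', v) \<in> F e" if "d' \<le> D" for d'
      using bordered_white_full[OF bS v _ that] e(2) by blast
    \<comment> \<open>The vertex has edges of the colours 0 and 1 in \<open>F e\<close>, whereas a
      border vertex has one colour only.\<close>
    have "Some u \<noteq> p"
      using f[of 0] f[of 1] D1 bordered_border_white_colour[OF Fb] pqr by (metis le0 zero_neq_one)
    then show ?thesis using f[of 0] pqr by (auto simp: inner_whites_def whites_def)
  qed
  have bS': "Some v \<in> inner_blacks e (F e)" if v: "v \<in> black K" for v
  proof -
    obtain d u where du: "(u, d, v) \<in> edges ?K" using rooted_cover(3)[OF RK', of v] v by auto
    have "\<exists>u. (u, d, Some v) \<in> ?S" using du unfolding in_unroot by blast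
    then obtain u where u: "(u, d, Some v) \<in> ?S" by blast
    have "Some v \<noteq> y" using av v by (auto simp: avoids_def)
    then have f: "\<exists>u. (u, d', Some v) \<in> F e" if "d' \<le> D" for d'
      using bordered_black_full[OF bS u _ that] e(2) by blast
    have "Some v \<noteq> r"
      using f[of 0] f[of 1] D1 bordered_border_black_colour[OF Fb] pqr by (metis le0 zero_neq_one)
    then show ?thesis using f[of 0] pqr by (auto simp: inner_blacks_def blacks_def)
  qed
  have "F e \<noteq> {e}" using wS[OF w1(1)] pqr by (auto simp: inner_whites_def whites_def)
  moreover have "edges K \<subseteq> edges (comp e)"
  proof
    fix z assume z: "z \<in> edges K"
    obtain u d v where uv: "z = (u, d, v)" by (cases z)
    have "(u, d, v) \<noteq> (w1, k, b1)" using z uv w1(3) by auto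
    then have "(Some u, d, Some v) \<in> ?S" using z uv by (simp add: in_unroot)
    moreover have "Some u \<noteq> fst e" "Some v \<noteq> snd (snd e)"
      using wS[of u] bS'[of v] pg(3)[of u d v] z uv by (auto simp: inner_whites_def inner_blacks_def)
    ultimately show "z \<in> edges (comp e)" using e(2) uv by (auto simp: comp_def graph_of_def)
  qed
  ultimately show ?thesis using e(1) wS bS' by (auto simp: subgraph_def white_comp black_comp)
qed

lemma comp_open: "e \<in> C \<Longrightarrow> F e \<noteq> {e} \<Longrightarrow> open_subgraph D (comp e) Go \<and> open_melonic D (comp e)"
proof -
  assume e: "e \<in> C" "F e \<noteq> {e}"
  obtain x k y where xky: "e = (x, k, y)" by (cases e)
  have "open_melonic D (comp e)"
    using e unfolding xky by (rule comp_props)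
  then show ?thesis using comp_subgraph[OF e(1)] by (simp add: open_subgraph_def open_melonic_def)
qed

lemma comp_nonempty: "e \<in> C \<Longrightarrow> F e \<noteq> {e} \<Longrightarrow> \<exists>u. u \<in> white (comp e)"
  by (cases e) (metis comp_props)

lemma comp_disjoint:
  assumes "e \<in> C" "e' \<in> C" "u \<in> white (comp e)" "u \<in> white (comp e')"
  shows "e = e'"
  using fam assms unfolding family_def white_comp by blast

lemma comp_disjoint_black:
  assumes "e \<in> C" "e' \<in> C" "u \<in> black (comp e)" "u \<in> black (comp e')"
  shows "e = e'"
  using fam assms unfolding family_def black_comp by blast

text \<open>Every open melonic subgraph lies in a nonempty component, these components are
  themselves open melonic subgraphs, and different ones have no common vertex, so none contains
  another.\<close>

lemma maximal_iff: "maximal_melonic_subgraph D K Go \<longleftrightarrow> (\<exists>e \<in> C. F e \<noteq> {e} \<and> K = comp e)"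
proof
  assume K: "maximal_melonic_subgraph D K Go"
  then obtain e where "e \<in> C" "F e \<noteq> {e}" "subgraph K (comp e)"
    using open_melonic_in_comp unfolding maximal_melonic_subgraph_def by blast
  then show "\<exists>e \<in> C. F e \<noteq> {e} \<and> K = comp e"
    using K comp_open unfolding maximal_melonic_subgraph_def by metis
next
  assume "\<exists>e \<in> C. F e \<noteq> {e} \<and> K = comp e"
  then obtain e where e: "e \<in> C" "F e \<noteq> {e}" "K = comp e" by blast
  have "H' = comp e" if h: "open_subgraph D H' Go" "open_melonic D H'" "subgraph (comp e) H'" for H'
  proof -
    obtain e' where e': "e' \<in> C" "subgraph H' (comp e')" using open_melonic_in_comp[OF h(1,2)] by blast
    obtain u where u: "u \<in> white (comp e)" using comp_nonempty[OF e(1,2)] by blast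
    then have "u \<in> white (comp e')" using h(3) e'(2) by (auto simp: subgraph_def)
    then have "e' = e" using comp_disjoint[OF e'(1) e(1)] u by blast
    then show ?thesis using e'(2) h(3) by (intro subgraph_antisym) auto
  qed
  then show "maximal_melonic_subgraph D K Go"
    using comp_open[OF e(1,2)] e(3) unfolding maximal_melonic_subgraph_def by blast
qed

text \<open>The place \<open>e\<close> may be an unchanged edge of the graph. Then no maximal
  melonic subgraph satisfies \<open>P\<close>, and both sides are the empty graph.\<close>

lemma piece_eq:
  assumes e: "e \<in> C" and P: "\<And>e'. e' \<in> C \<Longrightarrow> F e' \<noteq> {e'} \<Longrightarrow> P (comp e') \<longleftrightarrow> e' = e"
  shows "piece D Go P = comp e"
proof -
  have iff: "maximal_melonic_subgraph D H Go \<and> P H \<longleftrightarrow> F e \<noteq> {e} \<and> H = comp e" for H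
  proof
    assume h: "maximal_melonic_subgraph D H Go \<and> P H"
    then obtain e' where e': "e' \<in> C" "F e' \<noteq> {e'}" "H = comp e'" unfolding maximal_iff by blast
    then have "e' = e" using P[OF e'(1,2)] h by simp
    then show "F e \<noteq> {e} \<and> H = comp e" using e' by simp
  next
    assume h: "F e \<noteq> {e} \<and> H = comp e"
    then show "maximal_melonic_subgraph D H Go \<and> P H" using P[OF e] e unfolding maximal_iff by blast
  qed
  show ?thesis
    unfolding piece_def iff using comp_single[of e] by (cases "F e = {e}") auto
qed

text \<open>In \<open>E\<close> the white unmatched half-edge of the component ends in the black end
  of \<open>e\<close>, and the black one in the white end. So the edge created by deleting the
  component is \<open>e\<close>.\<close>

lemma at_place_comp:
  assumes "e \<in> C" "F e \<noteq> {e}"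
  shows "at_place D Go (p, k, q) (comp e) \<longleftrightarrow> e = (Some p, k, Some q)"
proof -
  obtain x l y where e: "e = (x, l, y)" by (cases e)
  obtain w1 b1 where fr: "free_white D (comp e) = {(w1, l)}" "free_black D (comp e) = {(b1, l)}"
    and in_F: "(Some w1, l, y) \<in> F e" "(x, l, Some b1) \<in> F e"
    using assms unfolding e by (rule comp_props) 
  have inE: "(Some w1, l, y) \<in> E" "(x, l, Some b1) \<in> E" using in_E[OF assms(1)] in_F by blast+
  have "at_place D Go (p, k, q) (comp e) \<longleftrightarrow> k = l \<and> (p, l, b1) \<in> edges Go \<and> (w1, l, q) \<in> edges Go"
    unfolding at_place_def prod.case fr by auto
  also have "\<dots> \<longleftrightarrow> k = l \<and> (Some p, l, Some b1) \<in> E \<and> (Some w1, l, Some q) \<in> E" unfolding E_edge ..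
  also have "\<dots> \<longleftrightarrow> k = l \<and> x = Some p \<and> y = Some q"
    using inE bordered_white_unique[OF E_bordered inE(1)] bordered_black_unique[OF E_bordered
      inE(2)] by metis
  finally show ?thesis using e by auto
qed

text \<open>The white unmatched half-edge leads to the black end of \<open>e\<close>; it is
  unmatched in the cut graph as well iff that end is the border vertex \<open>None\<close>.\<close>

lemma free_white_comp:
  assumes "e \<in> C" "F e \<noteq> {e}"
  shows "free_white D (comp e) = free_white D Go \<longleftrightarrow> snd (snd e) = None"
proof -
  obtain x l y where e: "e = (x, l, y)" by (cases e)
  obtain w1 where fr: "free_white D (comp e) = {(w1, l)}" and in_F: "(Some w1, l, y) \<in> F e"
    using assms unfolding e by (rule comp_props)
  have inE: "(Some w1, l, y) \<in> E" using in_E[OF assms(1)] in_F by blast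
  have "(w1 = w \<and> l = c) \<longleftrightarrow> y = None"
    using inE bordered_white_unique[OF E_bordered inE, of None] by (cases y) (auto simp: E_None(1))
  then show ?thesis unfolding fr open_op_graph(2)[OF D1 R] using e by simp
qed

lemma free_black_comp:
  assumes "e \<in> C" "F e \<noteq> {e}"
  shows "free_black D (comp e) = free_black D Go \<longleftrightarrow> fst e = None"
proof -
  obtain x l y where e: "e = (x, l, y)" by (cases e)
  obtain b1 where fr: "free_black D (comp e) = {(b1, l)}" and in_F: "(x, l, Some b1) \<in> F e"
    using assms unfolding e by (rule comp_props)
  have inE: "(x, l, Some b1) \<in> E" using in_E[OF assms(1)] in_F by blast
  have "(b1 = b \<and> l = c) \<longleftrightarrow> x = None"
    using inE bordered_black_unique[OF E_bordered inE, of None] by (cases x) (auto simp: E_None(2))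
  then show ?thesis unfolding fr open_op_graph(3)[OF D1 R] using e by simp
qed

lemma white_G_cases: "u \<in> white G \<longleftrightarrow> Some u \<in> whites C \<or> (\<exists>e \<in> C. u \<in> white (comp e))"
proof -
  have "Some u \<in> whites E \<longleftrightarrow> Some u \<in> whites C \<or> (\<exists>e \<in> C. Some u \<in> inner_whites e (F e))"
  proof
    assume "Some u \<in> whites E"
    then obtain e d v where "e \<in> C" "(Some u, d, v) \<in> F e" using E_eq by (auto simp: whites_def)
    then show "Some u \<in> whites C \<or> (\<exists>e \<in> C. Some u \<in> inner_whites e (F e))" using inner_white_iff
      by blast
  next
    assume "Some u \<in> whites C \<or> (\<exists>e \<in> C. Some u \<in> inner_whites e (F e))"
    then show "Some u \<in> whites E" using whites_C F_sub(1) unfolding inner_whites_def by blast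
  qed
  then show ?thesis unfolding whites_unroot(1)[OF R] white_comp .
qed

lemma black_G_cases: "u \<in> black G \<longleftrightarrow> Some u \<in> blacks C \<or> (\<exists>e \<in> C. u \<in> black (comp e))"
proof -
  have "Some u \<in> blacks E \<longleftrightarrow> Some u \<in> blacks C \<or> (\<exists>e \<in> C. Some u \<in> inner_blacks e (F e))"
  proof
    assume "Some u \<in> blacks E"
    then obtain e d v where "e \<in> C" "(v, d, Some u) \<in> F e" using E_eq by (auto simp: blacks_def)
    then show "Some u \<in> blacks C \<or> (\<exists>e \<in> C. Some u \<in> inner_blacks e (F e))" using inner_black_iff
      by blast
  next
    assume "Some u \<in> blacks C \<or> (\<exists>e \<in> C. Some u \<in> inner_blacks e (F e))"
    then show "Some u \<in> blacks E" using blacks_C F_sub(2) unfolding inner_blacks_def by blast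
  qed
  then show ?thesis unfolding whites_unroot(2)[OF R] black_comp .
qed

lemma comp_not_C: "e \<in> C \<Longrightarrow> u \<in> white (comp e) \<Longrightarrow> Some u \<notin> whites C"
  "e \<in> C \<Longrightarrow> u \<in> black (comp e) \<Longrightarrow> Some u \<notin> blacks C"
  using fam unfolding family_def white_comp black_comp by blast+

text \<open>With a single edge as core, the only blow-up is all of \<open>E\<close>, so the cut
  graph is melonic as a whole.\<close>

lemma core_single:
  assumes "C = {(None, c, None)}"
  shows "core_decomposition D L (G, (w, c, b)) = (None, [Go])" "comp (None, c, None) = Go"
proof -
  have FE: "F (None, c, None) = E" using E_eq assms by simp
  have "comp (None, c, None) = Go" unfolding comp_def FE by (rule graph_of_unroot[OF R avoids_None])
  moreover have "F (None, c, None) \<noteq> {(None, c, None)}"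
    unfolding FE by (rule unroot_not_single[OF R avoids_None])
  ultimately have "open_melonic D Go" using comp_open[of "(None, c, None)"] assms by simp
  then show "core_decomposition D L (G, (w, c, b)) = (None, [Go])"
    by (simp add: core_decomposition_def core_def)
  show "comp (None, c, None) = Go" by fact
qed

text \<open>The root of the core is represented by the two edges of \<open>C\<close> at
  \<open>None\<close>. As half-edges lead to ends of the opposite colour, the subgraph with the
  white unmatched half-edge of the cut graph sits at \<open>(Some w', c, None)\<close>, the one with
  the black at \<open>(None, c, Some b')\<close>.\<close>

lemma core_Some:
  assumes Cr: "rooted_graph D (G', (w', c, b'))" and CE: "C = unroot None None (G', (w', c, b'))"
    and L: "set (L (G', (w', c, b'))) = edges G' - {(w', c, b')}"
  shows "core_decomposition D L (G, (w, c, b)) = (Some (G', (w', c, b')),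
    map comp ((Some w', c, None) # (None, c, Some b') # map lift (L (G', (w', c, b')))))"
proof -
  note wC = whites_unroot[OF Cr, folded CE]
  have C_edge: "(Some p, k, Some q) \<in> C \<longleftrightarrow> (p, k, q) \<in> edges G' \<and> (p, k, q) \<noteq> (w', c, b')" for p k q
    unfolding CE by (auto simp: in_unroot)
  have C_root: "(Some w', c, None) \<in> C" "(None, c, Some b') \<in> C" unfolding CE by (auto simp: in_unroot)
  have w': "w' \<in> white G'" using rooted_cover(1,4)[OF Cr] by auto
  \<comment> \<open>A vertex of the core lies in no component, but a melonic cut graph would be
    contained in one.\<close>
  have nom: "\<not> open_melonic D Go"
  proof
    assume m: "open_melonic D Go"
    have "open_subgraph D Go Go" using open_op_graph(1)[OF D1 R]
      by (simp add: open_subgraph_def subgraph_def)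
    then obtain e where e: "e \<in> C" "subgraph Go (comp e)" using open_melonic_in_comp m by blast
    have "w' \<in> white G" using white_G_cases wC w' by blast
    then have "w' \<in> white (comp e)" using e(2) by (auto simp: subgraph_def)
    then show False using comp_not_C(1)[OF e(1)] wC w' by blast
  qed
  let ?M = "{H. maximal_melonic_subgraph D H Go}"
  have ne: "u \<in> white (comp e) \<Longrightarrow> F e \<noteq> {e}" "u \<in> black (comp e) \<Longrightarrow> F e \<noteq> {e}" for e u
    using comp_single[of e] by (auto simp: empty_graph_def)
  have M: "?M = {comp e |e. e \<in> C \<and> F e \<noteq> {e}}"
    unfolding maximal_iff by blast
  have M_in: "comp e \<in> ?M" if "e \<in> C" "F e \<noteq> {e}" for e unfolding M using that by blast
  have UM: "(\<Union>H \<in> ?M. white H) = (\<Union>e \<in> C. white (comp e))" "(\<Union>H \<in> ?M. black H) =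
    (\<Union>e \<in> C. black (comp e))"
  proof -
    show "(\<Union>H \<in> ?M. white H) = (\<Union>e \<in> C. white (comp e))"
    proof
      show "(\<Union>H \<in> ?M. white H) \<subseteq> (\<Union>e \<in> C. white (comp e))" unfolding M by blast
      show "(\<Union>e \<in> C. white (comp e)) \<subseteq> (\<Union>H \<in> ?M. white H)" using M_in[OF _ ne(1)]
        by (intro UN_least subsetI) blast
    qed
    show "(\<Union>H \<in> ?M. black H) = (\<Union>e \<in> C. black (comp e))"
    proof
      show "(\<Union>H \<in> ?M. black H) \<subseteq> (\<Union>e \<in> C. black (comp e))" unfolding M by blast
      show "(\<Union>e \<in> C. black (comp e)) \<subseteq> (\<Union>H \<in> ?M. black H)" using M_in[OF _ ne(2)]
        by (intro UN_least subsetI) blast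
    qed
  qed
  have W: "white Go - (\<Union>H \<in> ?M. white H) = white G'"
    unfolding UM using white_G_cases wC comp_not_C by auto
  have B: "black Go - (\<Union>H \<in> ?M. black H) = black G'"
    unfolding UM using black_G_cases wC comp_not_C by auto
  \<comment> \<open>Both sides describe the edges of \<open>C\<close> away from \<open>None\<close>:
    an edge that is not blown up is still an edge of the graph between core vertices, and a blown-up
    one is recovered from its component.\<close>
  have Eg: "(p, k, q) \<in> edges Go \<and> p \<in> white G' \<and> q \<in> black G' \<or> (\<exists>H \<in> ?M. at_place D Go (p, k, q) H) \<longleftrightarrow>
      (p, k, q) \<in> edges G' - {(w', c, b')}" for p k q
  proof
    assume "(p, k, q) \<in> edges G' - {(w', c, b')}"
    then have pC: "(Some p, k, Some q) \<in> C" using C_edge by blast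
    show "(p, k, q) \<in> edges Go \<and> p \<in> white G' \<and> q \<in> black G' \<or> (\<exists>H \<in> ?M. at_place D Go (p, k, q) H)"
    proof (cases "F (Some p, k, Some q) = {(Some p, k, Some q)}")
      case True
      then have "(Some p, k, Some q) \<in> E" using in_E[OF pC] by blast
      then have "(p, k, q) \<in> edges Go" unfolding E_edge .
      moreover have "p \<in> white G'" "q \<in> black G'" using wC in_whites[OF pC] in_blacks[OF pC] by blast+
      ultimately show ?thesis by blast
    next
      case False
      then show ?thesis using at_place_comp[OF pC False, of p k q] pC maximal_iff by blast
    qed
  next
    assume "(p, k, q) \<in> edges Go \<and> p \<in> white G' \<and> q \<in> black G' \<or> (\<exists>H \<in> ?M. at_place D Go (p, k, q) H)"
    then have "(Some p, k, Some q) \<in> C"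
    proof
      assume h: "(p, k, q) \<in> edges Go \<and> p \<in> white G' \<and> q \<in> black G'"
      then have "(Some p, k, Some q) \<in> E" unfolding E_edge by blast
      then obtain e where e: "e \<in> C" "(Some p, k, Some q) \<in> F e" using E_eq by blast
      then show ?thesis using outer_edge(1)[OF e] h wC by simp
    next
      assume "\<exists>H \<in> ?M. at_place D Go (p, k, q) H"
      then obtain e where e: "e \<in> C" "F e \<noteq> {e}" "at_place D Go (p, k, q) (comp e)" unfolding M by blast
      then show ?thesis using at_place_comp[OF e(1,2)] by simp
    qed
    then show "(p, k, q) \<in> edges G' - {(w', c, b')}" using C_edge by blast
  qed
  have "edges (open_core D Go) = edges G' - {(w', c, b')}"
    unfolding open_core_def Let_def W B using Eg by (auto simp: set_eq_iff)
  then have "open_core D Go = op_graph (G', (w', c, b'))"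
    using W B by (intro cgraph.equality) (simp_all add: open_core_def Let_def)
  then have core: "core D (G, (w, c, b)) = Some (G', (w', c, b'))"
    using nom open_op_graph(4)[OF D1 Cr] by (simp add: core_def)
  have 1: "piece D Go (\<lambda>H. free_white D H = free_white D Go) = comp (Some w', c, None)"
  proof (rule piece_eq[OF C_root(1)])
    fix e assume e: "e \<in> C" "F e \<noteq> {e}"
    have "snd (snd e) = None \<longleftrightarrow> e = (Some w', c, None)"
      using e(1) unfolding CE by (cases e) (auto simp: in_unroot)
    then show "free_white D (comp e) = free_white D Go \<longleftrightarrow> e = (Some w', c, None)"
      using free_white_comp[OF e] by simp
  qed
  have 2: "piece D Go (\<lambda>H. free_black D H = free_black D Go) = comp (None, c, Some b')"
  proof (rule piece_eq[OF C_root(2)])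
    fix e assume e: "e \<in> C" "F e \<noteq> {e}"
    have "fst e = None \<longleftrightarrow> e = (None, c, Some b')"
      using e(1) unfolding CE by (cases e) (auto simp: in_unroot)
    then show "free_black D (comp e) = free_black D Go \<longleftrightarrow> e = (None, c, Some b')"
      using free_black_comp[OF e] by simp
  qed
  have 3: "piece D Go (at_place D Go f) = comp (lift f)" if f: "f \<in> set (L (G', (w', c, b')))" for f
  proof -
    obtain p k q where pkq: "f = (p, k, q)" by (cases f)
    have "(Some p, k, Some q) \<in> C" using f L C_edge pkq by auto
    from piece_eq[OF this] show ?thesis using at_place_comp pkq by simp
  qed
  show ?thesis
    unfolding core_decomposition_def Let_def core option.case using 1 2 3 by simp
qed

end

section \<open>Possibly empty cores as bordered sets, and the lists of their places\<close>

lemma canonical_listingD: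
  assumes "canonical_listing D L" "rooted_graph D R"
  shows "distinct (L R)" "set (L R) = edges (fst R) - {snd R}"
    "rooted_graph D R' \<Longrightarrow> is_rooted_iso f g R R' \<Longrightarrow> L R' = map (map_edge f g) (L R)"
  using assms unfolding canonical_listing_def by blast+

text \<open>The empty rooted graph corresponds to a single edge between the two new vertices.\<close>

definition skel :: "nat \<Rightarrow> rgraph option \<Rightarrow> (nat option \<times> nat \<times> nat option) set" where
  "skel c Q = (case Q of None \<Rightarrow> {(None, c, None)} | Some R \<Rightarrow> unroot None None R)"

text \<open>The order is that of \<open>core_decomposition\<close>: the half of the root at its
  white end, the half at its black end, then the other edges in the canonical order. For the empty
  core the whole root is one place.\<close>

definition places :: "(rgraph \<Rightarrow> edge list) \<Rightarrow> nat \<Rightarrow> rgraph option \<Rightarrow> (nat option \<times> nat \<times> nat option)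
  list" where
  "places L c Q = (case Q of None \<Rightarrow> [(None, c, None)] | Some R \<Rightarrow>
     (Some (fst (snd R)), fst (snd (snd R)), None) # (None, fst (snd (snd R)), Some (snd (snd (snd
       R)))) #
     map lift (L R))"

text \<open>The root colour \<open>c\<close> is carried along separately, because an empty core does
  not record it.\<close>

definition valid_core :: "nat \<Rightarrow> nat \<Rightarrow> rgraph option \<Rightarrow> bool" where
  "valid_core D c Q \<longleftrightarrow> c \<le> D \<and> (\<forall>R. Q = Some R \<longrightarrow> rooted_graph D R \<and> fst (snd (snd R)) = c)"

lemma places_skel:
  assumes "canonical_listing D L" "valid_core D c Q"
  shows "set (places L c Q) = skel c Q" "distinct (places L c Q)"
proof -
  have *: "set (places L c Q) = skel c Q \<and> distinct (places L c Q)"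
  proof (cases Q)
    case None
    then show ?thesis by (simp add: places_def skel_def)
  next
    case (Some R)
    obtain G w b where R: "R = (G, (w, c, b))" using assms(2) Some
      by (cases R) (auto simp: valid_core_def)
    have "rooted_graph D R" using assms(2) Some by (simp add: valid_core_def)
    then have L: "distinct (L R)" "set (L R) = edges G - {(w, c, b)}"
      using canonical_listingD(1,2)[OF assms(1)] by (simp_all add: R)
    have dl: "distinct (map lift (L R))" using L(1) inj_on_subset[OF inj_lift]
      by (simp add: distinct_map)
    have nl: "(x, k, None) \<notin> lift ` S" "(None, k, y) \<notin> lift ` S" for x y k S by (simp_all add: in_lift)
    have p: "places L c Q = (Some w, c, None) # (None, c, Some b) # map lift (L R)"
      using Some R by (simp add: places_def)
    have s: "skel c Q = lift ` set (L R) \<union> {(Some w, c, None), (None, c, Some b)}"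
      unfolding L(2) using Some R by (simp add: skel_def unroot_def)
    have "set (places L c Q) = skel c Q" unfolding p s by auto
    moreover have "distinct (places L c Q)" unfolding p using dl nl by simp
    ultimately show ?thesis by simp
  qed
  then show "set (places L c Q) = skel c Q" "distinct (places L c Q)" by auto
qed

lemma bordered_skel:
  assumes "1 \<le> D" "valid_core D c Q"
  shows "bordered D (None, c, None) (skel c Q)"
proof (cases Q)
  case None
  then show ?thesis using assms(2) by (simp add: skel_def valid_core_def bordered_single)
next
  case (Some R)
  then obtain G w b where R: "R = (G, (w, c, b))" "rooted_graph D (G, (w, c, b))"
    using assms(2) by (cases R) (auto simp: valid_core_def)
  show ?thesis using bordered_unroot[OF assms(1) R(2) avoids_None] Some R(1) by (simp add: skel_def)
qed

lemma skel_of_bordered: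
  assumes C: "bordered D (None, c, None) C"
  obtains Q where "valid_core D c Q" "C = skel c Q"
proof -
  have cD: "c \<le> D" using bordered_border_white[OF C] bordered_colour[OF C] by blast
  show thesis
  proof (cases "C = {(None, c, None)}")
    case True
    then show thesis using that[of None] cD by (simp add: valid_core_def skel_def)
  next
    case False
    have *: "x \<in> range Some" if "x \<noteq> None" for x :: "nat option" using that by (cases x) auto
    have i: "inner_whites (None, c, None) C \<subseteq> range Some" "inner_blacks (None, c, None) C \<subseteq> range Some"
      unfolding inner_whites_def inner_blacks_def fst_conv snd_conv using * by blast+
    obtain G w b where "rooted_graph D (G, (w, c, b))" "unroot None None (G, (w, c, b)) = C"
      by (rule rooted_of_bordered[OF C False i]) blast
    then show thesis using that[of "Some (G, (w, c, b))"] cD by (simp add: valid_core_def skel_def)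
  qed
qed

context decomposed
begin

lemma core_decomposition_skel:
  assumes L: "canonical_listing D L" and Q: "valid_core D c Q" "C = skel c Q"
  shows "core_decomposition D L (G, (w, c, b)) = (Q, map comp (places L c Q))"
proof (cases Q)
  case None
  then show ?thesis using core_single(1)[of L] core_single(2) Q by (simp add: skel_def places_def)
next
  case (Some R')
  then obtain G' w' b' where R': "R' = (G', (w', c, b'))" "rooted_graph D (G', (w', c, b'))"
    using Q(1) by (cases R') (auto simp: valid_core_def)
  have "set (L (G', (w', c, b'))) = edges G' - {(w', c, b')}"
    using canonical_listingD(2)[OF L R'(2)] by simp
  then show ?thesis using core_Some[of G' w' b' L] R' Some Q(2) by (simp add: skel_def places_def)
qed

lemma comp_possibly_empty: "e \<in> C \<Longrightarrow> possibly_empty_open_melonic D (comp e)"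
  using comp_open comp_single unfolding possibly_empty_open_melonic_def by blast

lemma comp_colour:
  assumes "(x, k, y) \<in> C"
  shows "comp (x, k, y) = empty_graph \<or> open_colour D (comp (x, k, y)) = k"
proof (cases "F (x, k, y) = {(x, k, y)}")
  case False
  obtain w1 where "free_white D (comp (x, k, y)) = {(w1, k)}" by (rule comp_props[OF assms False])
  then show ?thesis by (simp add: open_colour_def)
qed (simp add: comp_single)

lemma finite_C: "finite C"
  using bordered_finite[OF C] .

lemma finite_G: "finite (white G)" "finite (black G)"
  using R by (auto simp: rooted_graph_def coloured_graph_def partial_graph_def)

lemma card_vertices_G:
  "card (vertices G) = card {u. Some u \<in> whites C} + card {u. Some u \<in> blacks C} + (\<Sum>e \<in> C. card
    (vertices (comp e)))"
proof -
  have W: "white G = {u. Some u \<in> whites C} \<union> (\<Union>e \<in> C. white (comp e))" using white_G_cases by blast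
  have B: "black G = {u. Some u \<in> blacks C} \<union> (\<Union>e \<in> C. black (comp e))" using black_G_cases by blast
  have finW: "finite {u. Some u \<in> whites C}" "finite (\<Union>e \<in> C. white (comp e))"
    using finite_G(1) unfolding W by simp_all
  have finB: "finite {u. Some u \<in> blacks C}" "finite (\<Union>e \<in> C. black (comp e))"
    using finite_G(2) unfolding B by simp_all
  have fin: "finite (white (comp e))" "finite (black (comp e))" if "e \<in> C" for e
    using finW(2) finB(2) that finite_C by auto
  have "card (white G) = card {u. Some u \<in> whites C} + card (\<Union>e \<in> C. white (comp e))"
    unfolding W using finW comp_not_C(1) by (intro card_Un_disjoint) auto
  also have "card (\<Union>e \<in> C. white (comp e)) = (\<Sum>e \<in> C. card (white (comp e)))"
    using finite_C fin(1) comp_disjoint by (intro card_UN_disjoint) blast+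
  finally have W': "card (white G) = card {u. Some u \<in> whites C} + (\<Sum>e \<in> C. card (white (comp e)))" .
  have "card (black G) = card {u. Some u \<in> blacks C} + card (\<Union>e \<in> C. black (comp e))"
    unfolding B using finB comp_not_C(2) by (intro card_Un_disjoint) auto
  also have "card (\<Union>e \<in> C. black (comp e)) = (\<Sum>e \<in> C. card (black (comp e)))"
    using finite_C fin(2) comp_disjoint_black by (intro card_UN_disjoint) blast+
  finally have B': "card (black G) = card {u. Some u \<in> blacks C} + (\<Sum>e \<in> C. card (black (comp e)))" .
  have "(\<Sum>e \<in> C. card (vertices (comp e))) = (\<Sum>e \<in> C. card (white (comp e)) + card (black (comp e)))"
    using fin by (intro sum.cong) (simp_all add: vertices_def card_Plus)
  then show ?thesis
    using W' B' finite_G by (simp add: vertices_def card_Plus sum.distrib)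
qed

end

lemma size_skel:
  assumes "valid_core D c Q"
  shows "card {u. Some u \<in> whites (skel c Q)} + card {u. Some u \<in> blacks (skel c Q)} = size_opt Q"
proof (cases Q)
  case None
  then show ?thesis by (simp add: skel_def whites_def blacks_def size_opt_def)
next
  case (Some R)
  then obtain G w b where R: "R = (G, (w, c, b))" "rooted_graph D (G, (w, c, b))"
    using assms by (cases R) (auto simp: valid_core_def)
  have "finite (white G)" "finite (black G)"
    using R(2) by (auto simp: rooted_graph_def coloured_graph_def partial_graph_def)
  then show ?thesis
    using whites_unroot[OF R(2)] Some R(1) by (simp add: skel_def size_opt_def vertices_def card_Plus)
qed

text \<open>The edges of colour 0 match the white with the black vertices, and an edge is determined
  by its white half-edge, of which each white vertex has \<open>D + 1\<close>.\<close>

lemma card_coloured_graph: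
  assumes "coloured_graph D G"
  shows "card (black G) = card (white G)" "card (edges G) = (D + 1) * card (white G)"
proof -
  note pg = partial_graphD[OF coloured_graphD(1)[OF assms]] and full = coloured_graphD(2,3)[OF assms]
  have "card (white G) = card (black G)"
  proof (rule card_eq_matching[where r = "\<lambda>w b. (w, 0, b) \<in> edges G"])
    show "\<exists>b \<in> black G. (w, 0, b) \<in> edges G" if "w \<in> white G" for w
      using full(1)[OF that le0] pg(3) by blast
    show "\<exists>w \<in> white G. (w, 0, b) \<in> edges G" if "b \<in> black G" for b
      using full(2)[OF that le0] pg(3) by blast
  qed (use pg(1,2) in simp_all, (erule (1) pg(4) | erule (1) pg(5))+)
  then show "card (black G) = card (white G)" by simp
  have sub: "edges G \<subseteq> white G \<times> {..D} \<times> black G" using pg(3) by auto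
  have "card (edges G) = card (white G \<times> {..D})"
  proof (rule card_eq_matching[where r = "\<lambda>e p. p = (fst e, fst (snd e)) \<and> e \<in> edges G"])
    show "finite (edges G)" by (rule finite_subset[OF sub]) (use pg(1,2) in simp)
    show "finite (white G \<times> {..D})" using pg(1) by simp
    show "\<exists>p \<in> white G \<times> {..D}. p = (fst e, fst (snd e)) \<and> e \<in> edges G" if "e \<in> edges G" for e
      using that sub by auto
    show "\<exists>e \<in> edges G. p = (fst e, fst (snd e)) \<and> e \<in> edges G" if h: "p \<in> white G \<times> {..D}" for p
    proof -
      obtain u d where p: "p = (u, d)" "u \<in> white G" "d \<le> D" using h by auto
      obtain v where "(u, d, v) \<in> edges G" using full(1)[OF p(2,3)] by blast
      then show ?thesis using p(1) by (intro bexI[of _ "(u, d, v)"]) auto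
    qed
    show "e = e'" if "p = (fst e, fst (snd e)) \<and> e \<in> edges G" "p = (fst e', fst (snd e')) \<and>
      e' \<in> edges G" for e e' p
    proof -
      obtain u d v where e: "e = (u, d, v)" by (cases e)
      obtain u' d' v' where e': "e' = (u', d', v')" by (cases e')
      have "u' = u" "d' = d" using that e e' by auto
      then show ?thesis using that e e' pg(4)[of u d v v'] by auto
    qed
  qed auto
  then show "card (edges G) = (D + 1) * card (white G)" by (simp add: card_cartesian_product)
qed

text \<open>A core with \<open>p\<close> white vertices has \<open>(D + 1) * p\<close> edges, and
  the root counts twice since it is cut into two places. The empty core fits with
  \<open>p = 0\<close> and a single place.\<close>

lemma length_places:
  assumes L: "canonical_listing D L" and Q: "valid_core D c Q"
  shows "\<exists>p. size_opt Q = 2 * p \<and> length (places L c Q) = (D + 1) * p + 1"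
proof (cases Q)
  case None
  then show ?thesis by (simp add: size_opt_def places_def)
next
  case (Some R)
  then have R: "rooted_graph D R" using Q by (simp add: valid_core_def)
  then have cg: "coloured_graph D (fst R)" and root: "snd R \<in> edges (fst R)"
    by (simp_all add: rooted_graph_def)
  note pg = partial_graphD[OF coloured_graphD(1)[OF cg]] and card = card_coloured_graph[OF cg]
  have sub: "edges (fst R) \<subseteq> white (fst R) \<times> {..D} \<times> black (fst R)" using pg(3) by auto
  have fin: "finite (edges (fst R))" by (rule finite_subset[OF sub]) (use pg(1,2) in simp)
  note LR = canonical_listingD(1,2)[OF L R]
  then have "length (L R) = card (edges (fst R) - {snd R})" using distinct_card by metis
  then have "length (L R) + 1 = card (edges (fst R))" using card_Suc_Diff1[OF fin root] by simp
  then have "length (places L c Q) = (D + 1) * card (white (fst R)) + 1"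
    using Some card(2) by (simp add: places_def)
  moreover have "size_opt Q = 2 * card (white (fst R))"
    using Some pg(1,2) card(1) by (simp add: size_opt_def vertices_def card_Plus)
  ultimately show ?thesis by blast
qed

text \<open>The two notions describe the same edges by different data: \<open>D\<close> parallel
  edges among \<open>D + 1\<close> colours leave out exactly one colour, the parameter of
  \<open>melon_at\<close>. Parallel edges of a melon avoid the border, just as those of
  \<open>is_melon_in\<close> avoid the root edge.\<close>

lemma no_melon_skel:
  assumes D: "2 \<le> D" and Q: "valid_core D c Q"
  shows "no_melon D (skel c Q) \<longleftrightarrow> melon_free D Q"
proof -
  have bord: "bordered D (None, c, None) (skel c Q)" using bordered_skel[OF _ Q] D by simp
  show ?thesis
  proof (cases Q)
    case None
    have "\<not> melon_at D x y k (skel c Q)" for x y k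
    proof
      assume m: "melon_at D x y k (skel c Q)"
      obtain d where d: "d \<le> D" "d \<noteq> k" "d \<noteq> k" by (rule exists_third_colour[OF D])
      then have "x = None" using m None by (auto simp: melon_at_def skel_def)
      then show False using melon_at_border(1)[OF D bord m] by simp
    qed
    then show ?thesis using None by (simp add: no_melon_def melon_free_def)
  next
    case (Some R)
    then obtain G w b where R: "R = (G, (w, c, b))" "rooted_graph D (G, (w, c, b))"
      using Q by (cases R) (auto simp: valid_core_def)
    note cov = rooted_cover[OF R(2)]
    have edge: "(Some p, k, Some q) \<in> skel c Q \<longleftrightarrow> (p, k, q) \<in> edges G - {(w, c, b)}" for p k q
      using Some R(1) by (auto simp: skel_def in_unroot)
    show ?thesis
    proof
      assume nm: "no_melon D (skel c Q)"
      have "\<not> is_melon_in D R u v S" for u v S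
      proof
        assume "is_melon_in D R u v S"
        then have S: "S \<subseteq> edges G - {(w, c, b)}" "card S = D" "\<And>x k y. (x, k, y) \<in> S \<Longrightarrow> x = u \<and> y = v"
          using R(1) by (auto simp: is_melon_in_def)
        define K where "K = (\<lambda>e. fst (snd e)) ` S"
        have inK: "(u, k, v) \<in> S" if "k \<in> K" for k
          using that S(3) by (force simp: K_def)
        have "inj_on (\<lambda>e. fst (snd e)) S"
        proof (rule inj_onI)
          fix e e' assume h: "e \<in> S" "e' \<in> S" "fst (snd e) = fst (snd e')"
          obtain x k y where e: "e = (x, k, y)" by (cases e)
          obtain x' k' y' where e': "e' = (x', k', y')" by (cases e')
          show "e = e'" using S(3)[of x k y] S(3)[of x' k' y'] h e e' by simp
        qed
        then have cK: "card K = D" using S(2) by (simp add: K_def card_image)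
        have KD: "K \<subseteq> {..D}" using inK S(1) cov(1) by blast
        have "card ({..D} - K) = 1" using cK KD by (simp add: card_Diff_subset finite_subset)
        then obtain k where k: "{..D} - K = {k}" by (auto simp: card_1_singleton_iff)
        have "(Some u, d, Some v) \<in> skel c Q" if "d \<le> D" "d \<noteq> k" for d
        proof -
          have "d \<in> K" using k that by blast
          then show ?thesis unfolding edge using inK S(1) by blast
        qed
        moreover have "k \<le> D" using k by blast
        ultimately have "melon_at D (Some u) (Some v) k (skel c Q)" by (simp add: melon_at_def)
        then show False using nm by (auto simp: no_melon_def)
      qed
      then show "melon_free D Q" using Some by (simp add: melon_free_def)
    next
      assume mf: "melon_free D Q"
      have "\<not> melon_at D x y k (skel c Q)" for x y k
      proof
        assume m: "melon_at D x y k (skel c Q)"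
        obtain u v where uv: "x = Some u" "y = Some v" using melon_at_border[OF D bord m]
          by (cases x; cases y) auto
        have k: "k \<le> D" "\<And>d. d \<le> D \<Longrightarrow> d \<noteq> k \<Longrightarrow> (u, d, v) \<in> edges G - {(w, c, b)}"
          using m uv edge by (auto simp: melon_at_def)
        let ?S = "(\<lambda>d. (u, d, v)) ` ({..D} - {k})"
        have "card ?S = D" using k(1) by (subst card_image) (auto intro: inj_onI)
        moreover have "?S \<subseteq> edges G - {(w, c, b)}" using k(2) by auto
        moreover have "u \<in> white G" "v \<in> black G"
        proof -
          obtain d where "d \<le> D" "d \<noteq> k" "d \<noteq> k" by (rule exists_third_colour[OF D])
          then show "u \<in> white G" "v \<in> black G" using k(2)[of d] cov(1) by auto
        qed
        ultimately have "is_melon_in D R u v ?S" using R(1) by (auto simp: is_melon_in_def)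
        then show False using mf Some by (auto simp: melon_free_def)
      qed
      then show "no_melon D (skel c Q)" by (simp add: no_melon_def)
    qed
  qed
qed

text \<open>To serve as the invariant in \<open>exists_family\<close>, the degree has to be a
  function of the bordered set. The value 0 for a single edge agrees with \<open>degree_opt\<close>
  on the empty core.\<close>

definition ext_degree :: "nat \<Rightarrow> nat \<Rightarrow> (nat option \<times> nat \<times> nat option) set \<Rightarrow> int" where
  "ext_degree D c T = (if T = {(None, c, None)} then 0 else degree D (fst (cl_graph D (graph_of
    (None, c, None) T))))"

lemma ext_degree_unroot:
  assumes "1 \<le> D" "rooted_graph D (G, (w, c, b))"
  shows "ext_degree D c (unroot None None (G, (w, c, b))) = degree D G"
  using unroot_not_single[OF assms(2) avoids_None] graph_of_unroot[OF assms(2) avoids_None]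
    open_op_graph(4)[OF assms]
  by (simp add: ext_degree_def)

lemma ext_degree_skel: "1 \<le> D \<Longrightarrow> valid_core D c Q \<Longrightarrow> ext_degree D c (skel c Q) = degree_opt D Q"
proof (cases Q)
  case (Some R)
  assume D: "1 \<le> D" and Q: "valid_core D c Q"
  obtain G w b where R: "R = (G, (w, c, b))" "rooted_graph D (G, (w, c, b))"
    using Q Some by (cases R) (auto simp: valid_core_def)
  then show ?thesis using ext_degree_unroot[OF D R(2)] Some by (simp add: skel_def degree_opt_def)
qed (simp add: skel_def ext_degree_def degree_opt_def)

text \<open>Inserting into the single edge gives \<open>Delta\<close>, whose degree is 0 like that
  of the empty graph; in all other cases the insertion is one into a rooted graph.\<close>

lemma ext_degree_ins:
  assumes D: "2 \<le> D" and T: "bordered D (None, c, None) T" and f: "f \<in> T" and fr: "fresh w b T"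
  shows "ext_degree D c (ins D w b f T) = ext_degree D c T"
proof -
  have D1: "1 \<le> D" using D by simp
  obtain x y where "(None, c, y) \<in> T" "(x, c, None) \<in> T"
    using bordered_border_white[OF T] bordered_border_black[OF T] by blast
  then have "w \<noteq> None" "b \<noteq> None" using freshD[OF fr] by metis+
  then obtain w' b' where wb: "w = Some w'" "b = Some b'" by blast
  obtain Q where Q: "valid_core D c Q" "T = skel c Q" by (rule skel_of_bordered[OF T])
  show ?thesis
  proof (cases Q)
    case None
    have cD: "c \<le> D" using Q(1) by (simp add: valid_core_def)
    have T1: "T = {(None, c, None)}" using Q(2) None by (simp add: skel_def)
    have "ins D w b f T = unroot None None (Delta D c w' b')"
      using unroot_Delta[OF cD, of None w' None b'] wb f T1 by simp
    moreover have "Delta D c w' b' = (fst (Delta D c w' b'), (w', c, b'))" by (simp add: Delta_def)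
    ultimately have "ext_degree D c (ins D w b f T) = degree D (fst (Delta D c w' b'))"
      using ext_degree_unroot[OF D1, of
        "fst (Delta D c w' b')" w' c b'] rooted_Delta[OF cD D, of w' b'] by simp
    then show ?thesis using degree_Delta[OF D1] T1 by (simp add: ext_degree_def)
  next
    case (Some R)
    then obtain G w1 b1 where R: "R = (G, (w1, c, b1))" "rooted_graph D (G, (w1, c, b1))"
      using Q(1) by (cases R) (auto simp: valid_core_def)
    have TR: "T = unroot None None (G, (w1, c, b1))" using Q(2) Some R(1) by (simp add: skel_def)
    have new: "w' \<notin> white G" "b' \<notin> black G" using fresh_unrootD[OF R(2)] fr TR wb by auto
    obtain e r where er: "e \<in> edges G" "fst (snd r) = c"
      "r = (w1, c, b1) \<and> e \<noteq> (w1, c, b1) \<or> e = (w1, c, b1) \<and> (r = (w1, c, b') \<or> r = (w', c, b1))"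
      "unroot None None (insert_melon D w' b' e G, r) = ins D w b f T"
      using ins_unroot[OF R(2) avoids_None new option.distinct(1) option.distinct(1), folded TR, OF
        f] wb by blast
    obtain w2 b2 where r: "r = (w2, c, b2)" using er(2) by (cases r) auto
    have "rooted_graph D (insert_melon D w' b' e G, r)"
      by (rule rooted_insert_melon[OF D R(2) new er(1,3)])
    then have "ext_degree D c (ins D w b f T) = degree D (insert_melon D w' b' e G)"
      using ext_degree_unroot[OF D1] er(4) r by metis
    also have "\<dots> = degree D G"
      using R(2) by (intro degree_insert_melon[OF _ er(1) new]) (simp add: rooted_graph_def)
    also have "\<dots> = ext_degree D c T" using ext_degree_unroot[OF D1 R(2)] TR by simp
    finally show ?thesis .
  qed
qed

text \<open>Melons are contracted until none is left; \<open>ext_degree\<close> as the invariant of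
  this process makes the degree of the core that of \<open>G\<close>.\<close>

lemma exists_decomposed:
  assumes D: "2 \<le> D" and R: "rooted_graph D (G, (w, c, b))"
  obtains Q F where "valid_core D c Q" "decomposed D G w c b (skel c Q) F" "degree_opt D Q = degree D G"
proof -
  have D1: "1 \<le> D" using D by simp
  have b: "bordered D (None, c, None) (unroot None None (G, (w, c, b)))"
    by (rule bordered_unroot[OF D1 R avoids_None])
  obtain C F where C: "bordered D (None, c, None) C" "no_melon D C"
    "family D C F (unroot None None (G, (w, c, b)))"
    "ext_degree D c C = ext_degree D c (unroot None None (G, (w, c, b)))"
    using exists_family[OF D b, of "ext_degree D c", OF ext_degree_ins[OF D]] by blast
  obtain Q where Q: "valid_core D c Q" "C = skel c Q" by (rule skel_of_bordered[OF C(1)])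
  have "degree_opt D Q = degree D G"
    using C(4) ext_degree_unroot[OF D1 R] ext_degree_skel[OF D1 Q(1)] Q(2) by simp
  moreover have "decomposed D G w c b (skel c Q) F"
    using D R C(1-3) Q(2) by unfold_locales auto
  ultimately show thesis using that Q(1) by blast
qed

lemma (in decomposed) core_decomposition_in_core_pairs:
  assumes L: "canonical_listing D L" and Q: "valid_core D c Q" "C = skel c Q"
    and deg: "degree_opt D Q = degree D G" and k: "card (vertices G) = 2 * k" and \<delta>: "degree D G = int \<delta>"
  shows "core_decomposition D L (G, (w, c, b)) \<in> core_pairs D L k \<delta>"
proof -
  note pl = places_skel[OF L Q(1)]
  obtain p where p: "size_opt Q = 2 * p" "length (places L c Q) = (D + 1) * p + 1"
    using length_places[OF L Q(1)] by blast
  have mf: "melon_free D Q" using no_melon_skel[OF D Q(1)] nm Q(2) by simp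
  have fit: "colours_fit D L Q (map comp (places L c Q))"
  proof (cases Q)
    case None
    then show ?thesis by (simp add: colours_fit_def)
  next
    case (Some R')
    obtain G' w' b' where R': "R' = (G', (w', c, b'))" using Q(1) Some
      by (cases R') (auto simp: valid_core_def)
    have in_C: "(Some w', c, None) \<in> C" "(None, c, Some b') \<in> C" "\<And>f. f \<in> set (L R') \<Longrightarrow> lift f \<in> C"
      using pl(1) Q(2) Some R' by (auto simp: places_def)
    have "comp (lift f) = empty_graph \<or> open_colour D (comp (lift f)) = colour f"
      if "f \<in> set (L R')" for f
      using comp_colour[of "Some (fst f)" "fst (snd f)" "Some (snd (snd f))"] in_C(3)[OF that]
      by (cases f) (simp add: colour_def)
    then have "list_all2 (\<lambda>e H. H = empty_graph \<or> open_colour D H =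
      colour e) (L R') (map comp (map lift (L R')))"
      by (simp add: list_all2_conv_all_nth)
    then show ?thesis
      using comp_colour[OF in_C(1)] comp_colour[OF in_C(2)] Some R'
        by (simp add: colours_fit_def places_def colour_def)
  qed
  have "(\<Sum>H \<leftarrow> map comp (places L c Q). card (vertices H)) = (\<Sum>e \<in> C. card (vertices (comp e)))"
    using pl Q(2) by (simp add: sum_list_distinct_conv_sum_set o_def)
  then have "2 * p + (\<Sum>H \<leftarrow> map comp (places L c Q). card (vertices H)) = 2 * k"
    using card_vertices_G size_skel[OF Q(1)] Q(2) p(1) k by simp
  moreover have "\<forall>H \<in> set (map comp (places L c Q)). possibly_empty_open_melonic D H"
    using pl(1) Q(2) comp_possibly_empty by auto
  ultimately show ?thesis
    unfolding core_decomposition_skel[OF L Q] core_pairs_def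
    using p mf fit deg \<delta> Q(1) by (auto simp: valid_core_def)
qed

subsection \<open>Isomorphisms\<close>

text \<open>Renaming of vertices, used with maps that are injective on the whole type so that it
  commutes with differences and intersections of sets. \<open>None\<close> may be moved too: this is
  how a component with border \<open>None\<close> is attached to the ends of its place.\<close>

definition mapx :: "('a \<Rightarrow> 'c) \<Rightarrow> ('b \<Rightarrow> 'd) \<Rightarrow> 'a \<times> nat \<times> 'b \<Rightarrow> 'c \<times> nat \<times> 'd" where
  "mapx p q = (\<lambda>(x, c, y). (p x, c, q y))"

lemma mapx_simp[simp]: "mapx p q (x, c, y) = (p x, c, q y)"
  by (simp add: mapx_def)

lemma fst_mapx: "fst (mapx p q e) = p (fst e)" "fst (snd (mapx p q e)) = fst (snd e)"
  "snd (snd (mapx p q e)) = q (snd (snd e))"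
  by (cases e; simp)+

lemma in_mapx: "(x, c, y) \<in> mapx p q ` T \<longleftrightarrow> (\<exists>u v. x = p u \<and> y = q v \<and> (u, c, v) \<in> T)"
  by (force simp: mapx_def)

lemma mapx_image: "(u, c, v) \<in> T \<Longrightarrow> (p u, c, q v) \<in> mapx p q ` T"
  unfolding in_mapx by blast

lemma inj_mapx: "inj p \<Longrightarrow> inj q \<Longrightarrow> inj (mapx p q)"
  by (rule injI) (auto simp: mapx_def inj_eq split: prod.splits)

lemma whites_mapx: "whites (mapx p q ` T) = p ` whites T"
  and blacks_mapx: "blacks (mapx p q ` T) = q ` blacks T"
  unfolding whites_def blacks_def in_mapx by blast+

lemma inner_mapx:
  assumes "inj p" "inj q"
  shows "inner_whites (mapx p q e) (mapx p q ` T) = p ` inner_whites e T"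
    "inner_blacks (mapx p q e) (mapx p q ` T) = q ` inner_blacks e T"
  by (simp_all add: inner_whites_def inner_blacks_def whites_mapx blacks_mapx fst_mapx
    image_set_diff assms)

lemma ins_mapx:
  assumes "inj p" "inj q"
  shows "mapx p q ` ins D w b f T = ins D (p w) (q b) (mapx p q f) (mapx p q ` T)"
proof -
  obtain x c y where f: "f = (x, c, y)" by (cases f)
  have "mapx p q ` (T - {(x, c, y)}) = mapx p q ` T - {(p x, c, q y)}"
    by (simp add: image_set_diff inj_mapx assms)
  moreover have "mapx p q ` {(w, c', b) |c'. c' \<le> D \<and> c' \<noteq> c} = {(p w, c', q b) |c'. c' \<le> D \<and> c' \<noteq> c}"
    by (force simp: mapx_def)
  ultimately show ?thesis by (simp add: ins_def f image_Un)
qed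

lemma blowup_mapx:
  assumes "blowup D e T" and inj: "inj p" "inj q"
  shows "blowup D (mapx p q e) (mapx p q ` T)"
  using assms(1)
proof induction
  case single
  then show ?case by (simp add: blowup.single)
next
  case (ins T f w b)
  have "fresh (p w) (q b) (mapx p q ` T)"
    using ins.hyps(3) inj by (force simp: fresh_def mapx_def inj_eq)
  then show ?case
    unfolding ins_mapx[OF inj] using ins.IH ins.hyps(2) by (intro blowup.ins) auto
qed

lemma bordered_mapx:
  fixes T :: "('a \<times> nat \<times> 'b) set" and p :: "'a \<Rightarrow> 'c" and q :: "'b \<Rightarrow> 'd"
  assumes T: "bordered D e T" and inj: "inj p" "inj q"
  shows "bordered D (mapx p q e) (mapx p q ` T)"
proof -
  obtain x\<^sub>0 c\<^sub>0 y\<^sub>0 where e: "e = (x\<^sub>0, c\<^sub>0, y\<^sub>0)" by (cases e)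
  note B = T[unfolded e]
  have "bordered D (p x\<^sub>0, c\<^sub>0, q y\<^sub>0) (mapx p q ` T)"
  proof (rule borderedI)
    show "finite (mapx p q ` T)" using bordered_finite[OF B] by simp
    show "c \<le> D" if "(x, c, y) \<in> mapx p q ` T" for x c y
      using that bordered_colour[OF B] unfolding in_mapx by blast
    show "y = y'" if "(x, c, y) \<in> mapx p q ` T" "(x, c, y') \<in> mapx p q ` T" for x c y y'
      using that bordered_white_unique[OF B] injD[OF inj(1)] unfolding in_mapx by metis
    show "x = x'" if "(x, c, y) \<in> mapx p q ` T" "(x', c, y) \<in> mapx p q ` T" for x x' c y
      using that bordered_black_unique[OF B] injD[OF inj(2)] unfolding in_mapx by metis
    show "\<exists>y. (p x\<^sub>0, c\<^sub>0, y) \<in> mapx p q ` T" using bordered_border_white[OF B] unfolding in_mapx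
      by blast
    show "\<exists>x. (x, c\<^sub>0, q y\<^sub>0) \<in> mapx p q ` T" using bordered_border_black[OF B] unfolding in_mapx
      by blast
    show "c = c\<^sub>0" if "(p x\<^sub>0, c, y) \<in> mapx p q ` T" for c y
      using that bordered_border_white_colour[OF B] injD[OF inj(1)] unfolding in_mapx by metis
    show "c = c\<^sub>0" if "(x, c, q y\<^sub>0) \<in> mapx p q ` T" for c x
      using that bordered_border_black_colour[OF B] injD[OF inj(2)] unfolding in_mapx by metis
    show "\<exists>y'. (x, c', y') \<in> mapx p q ` T" if h: "(x, c, y) \<in> mapx p q ` T" "x \<noteq> p x\<^sub>0" "c' \<le> D"
      for x c y c'
    proof -
      obtain u v where uv: "x = p u" "(u, c, v) \<in> T" using h(1) unfolding in_mapx by blast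
      then obtain v' where "(u, c', v') \<in> T" using bordered_white_full[OF B uv(2) _ h(3)] h(2) by blast
      from mapx_image[OF this, of p q] show ?thesis using uv(1) by blast
    qed
    show "\<exists>x'. (x', c', y) \<in> mapx p q ` T" if h: "(x, c, y) \<in> mapx p q ` T" "y \<noteq> q y\<^sub>0" "c' \<le> D"
      for x c y c'
    proof -
      obtain u v where uv: "y = q v" "(u, c, v) \<in> T" using h(1) unfolding in_mapx by blast
      then obtain u' where "(u', c', v) \<in> T" using bordered_black_full[OF B uv(2) _ h(3)] h(2) by blast
      from mapx_image[OF this, of p q] show ?thesis using uv(1) by blast
    qed
    fix P :: "'c \<Rightarrow> bool" and Q assume PQ: "\<And>x c y. (x, c, y) \<in> mapx p q ` T \<Longrightarrow> P x = Q y"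
    have PQ': "(P \<circ> p) x = (Q \<circ> q) y" if "(x, c, y) \<in> T" for x c y
      using PQ[OF mapx_image[OF that]] by simp
    obtain z where z: "\<And>x c y. (x, c, y) \<in> T \<Longrightarrow> (P \<circ> p) x = z \<and> (Q \<circ> q) y = z"
      by (rule bordered_connected[OF B, of "P \<circ> p" "Q \<circ> q"], erule PQ', rule that)
    have "P x = z" if h: "(x, c, y) \<in> mapx p q ` T" for x c y
    proof -
      obtain u v where "x = p u" "(u, c, v) \<in> T" using h unfolding in_mapx by blast
      then show ?thesis using z[of u c v] by simp
    qed
    then show "\<exists>z. \<forall>x c y. (x, c, y) \<in> mapx p q ` T \<longrightarrow> P x = z" by (intro exI[of _ z]) simp
  qed
  then show ?thesis by (simp add: e)
qed

lemma family_mapx: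
  assumes fam: "family D C F E" and inj: "inj p" "inj q"
  shows "family D (mapx p q ` C) (\<lambda>e. mapx p q ` F (inv (mapx p q) e)) (mapx p q ` E)"
proof -
  have inv: "inv (mapx p q) (mapx p q e) = e" for e using inj_mapx[OF inj] by (rule inv_f_f)
  have disj: "p ` A \<inter> p ` B = {}" if "A \<inter> B = {}" for A B using that inj(1)
    by (simp add: image_Int[symmetric])
  have disj': "q ` A \<inter> q ` B = {}" if "A \<inter> B = {}" for A B using that inj(2)
    by (simp add: image_Int[symmetric])
  have f: "E = (\<Union>e \<in> C. F e)" "\<And>e. e \<in> C \<Longrightarrow> blowup D e (F e)"
    "\<And>e. e \<in> C \<Longrightarrow> inner_whites e (F e) \<inter> whites C = {}" "\<And>e. e \<in> C \<Longrightarrow> inner_blacks e (F e) \<inter> blacks C = {}"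
    "\<And>e e'. e \<in> C \<Longrightarrow> e' \<in> C \<Longrightarrow> e \<noteq> e' \<Longrightarrow> inner_whites e (F e) \<inter> inner_whites e' (F e') = {}"
    "\<And>e e'. e \<in> C \<Longrightarrow> e' \<in> C \<Longrightarrow> e \<noteq> e' \<Longrightarrow> inner_blacks e (F e) \<inter> inner_blacks e' (F e') = {}"
    using fam unfolding family_def by blast+
  show ?thesis
    unfolding family_def
  proof (intro conjI ballI impI)
    show "mapx p q ` E = (\<Union>e \<in> mapx p q ` C. mapx p q ` F (inv (mapx p q) e))"
      by (simp add: f(1) inv image_UN)
    fix m assume "m \<in> mapx p q ` C"
    then obtain e where e: "e \<in> C" "m = mapx p q e" by blast
    show "blowup D m (mapx p q ` F (inv (mapx p q) m))"
      using blowup_mapx[OF f(2)[OF e(1)] inj] by (simp add: e(2) inv)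
    show "inner_whites m (mapx p q ` F (inv (mapx p q) m)) \<inter> whites (mapx p q ` C) = {}"
      unfolding e(2) inv inner_mapx[OF inj] whites_mapx using f(3)[OF e(1)] by (rule disj)
    show "inner_blacks m (mapx p q ` F (inv (mapx p q) m)) \<inter> blacks (mapx p q ` C) = {}"
      unfolding e(2) inv inner_mapx[OF inj] blacks_mapx using f(4)[OF e(1)] by (rule disj')
    fix m' assume "m' \<in> mapx p q ` C"
    then obtain e' where e': "e' \<in> C" "m' = mapx p q e'" by blast
    assume "m \<noteq> m'"
    then have ne: "e \<noteq> e'" using e(2) e'(2) by blast
    show "inner_whites m (mapx p q ` F (inv (mapx p q) m)) \<inter> inner_whites m' (mapx p q ` F (inv
      (mapx p q) m')) = {}"
      unfolding e(2) e'(2) inv inner_mapx[OF inj] using f(5)[OF e(1) e'(1) ne] by (rule disj)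
    show "inner_blacks m (mapx p q ` F (inv (mapx p q) m)) \<inter> inner_blacks m' (mapx p q ` F (inv
      (mapx p q) m')) = {}"
      unfolding e(2) e'(2) inv inner_mapx[OF inj] using f(6)[OF e(1) e'(1) ne] by (rule disj')
  qed
qed

lemma no_melon_mapx:
  assumes D: "2 \<le> D" and inj: "inj p" "inj q" and nm: "no_melon D C"
  shows "no_melon D (mapx p q ` C)"
  unfolding no_melon_def
proof
  assume "\<exists>w b c. melon_at D w b c (mapx p q ` C)"
  then obtain w b c where m: "melon_at D w b c (mapx p q ` C)" by blast
  have c: "c \<le> D" and par: "\<And>d. d \<le> D \<Longrightarrow> d \<noteq> c \<Longrightarrow> (w, d, b) \<in> mapx p q ` C"
    using m by (auto simp: melon_at_def)
  obtain d where "d \<le> D" "d \<noteq> c" "d \<noteq> c" by (rule exists_third_colour[OF D])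
  then obtain u v where uv: "w = p u" "b = q v" using par[of d] unfolding in_mapx by blast
  have "(u, d, v) \<in> C" if "d \<le> D" "d \<noteq> c" for d
    using par[OF that] uv injD[OF inj(1)] injD[OF inj(2)] unfolding in_mapx by metis
  then have "melon_at D u v c C" using c by (simp add: melon_at_def)
  then show False using nm by (auto simp: no_melon_def)
qed

lemma Some_in_image:
  assumes A: "A \<subseteq> range Some" and p: "\<And>u. p (Some u) = Some (f u)"
  shows "Some v \<in> p ` A \<longleftrightarrow> (\<exists>u. v = f u \<and> Some u \<in> A)"
proof
  assume "Some v \<in> p ` A"
  then obtain x where x: "x \<in> A" "Some v = p x" by blast
  obtain u where "x = Some u" using A x(1) by blast
  then show "\<exists>u. v = f u \<and> Some u \<in> A" using x p by auto
next
  assume "\<exists>u. v = f u \<and> Some u \<in> A"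
  then obtain u where "v = f u" "Some u \<in> A" by blast
  then show "Some v \<in> p ` A" using p by (intro image_eqI[of _ _ "Some u"]) simp_all
qed

text \<open>\<open>graph_of\<close> does not see the border, so only the action of \<open>p\<close>
  and \<open>q\<close> on inner vertices matters, all of which have the form \<open>Some\<close>;
  the image of \<open>None\<close> is left open.\<close>

lemma graph_of_iso:
  assumes inj: "inj p" "inj q" and p: "\<And>u. p (Some u) = Some (f u)" and q: "\<And>u. q (Some u) = Some (g u)"
    and i: "inner_whites e T \<subseteq> range Some" "inner_blacks e T \<subseteq> range Some"
  shows "is_iso f g (graph_of e T) (graph_of (mapx p q e) (mapx p q ` T))"
proof -
  have injf: "inj f" by (rule injI) (metis inj(1) injD option.inject p)
  have injg: "inj g" by (rule injI) (metis inj(2) injD option.inject q)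
  have W: "Some v \<in> p ` inner_whites e T \<longleftrightarrow> (\<exists>u. v = f u \<and> Some u \<in> inner_whites e T)" for v
    using i(1) p by (rule Some_in_image)
  have B: "Some v \<in> q ` inner_blacks e T \<longleftrightarrow> (\<exists>u. v = g u \<and> Some u \<in> inner_blacks e T)" for v
    using i(2) q by (rule Some_in_image)
  have white: "white (graph_of (mapx p q e) (mapx p q ` T)) = f ` white (graph_of e T)"
    by (auto simp: graph_of_def inner_mapx[OF inj] W)
  have black: "black (graph_of (mapx p q e) (mapx p q ` T)) = g ` black (graph_of e T)"
    by (auto simp: graph_of_def inner_mapx[OF inj] B)
  have edge: "(u', d, v') \<in> edges (graph_of (mapx p q e) (mapx p q ` T)) \<longleftrightarrow>
      (\<exists>u v. u' = f u \<and> v' = g v \<and> (u, d, v) \<in> edges (graph_of e T))" for u' d v'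
  proof
    assume "(u', d, v') \<in> edges (graph_of (mapx p q e) (mapx p q ` T))"
    then have h: "(Some u', d, Some v') \<in> mapx p q ` T" "Some u' \<noteq> p (fst e)" "Some v' \<noteq> q (snd (snd e))"
      by (simp_all add: graph_of_def fst_mapx)
    then obtain x y where xy: "Some u' = p x" "Some v' = q y" "(x, d, y) \<in> T" unfolding in_mapx by blast
    then have ne: "x \<noteq> fst e" "y \<noteq> snd (snd e)" using h(2,3) by auto
    then have "x \<in> range Some" "y \<in> range Some"
      using i in_whites[OF xy(3)] in_blacks[OF xy(3)] by (auto simp: inner_whites_def inner_blacks_def)
    then obtain u v where "x = Some u" "y = Some v" by blast
    then show "\<exists>u v. u' = f u \<and> v' = g v \<and> (u, d, v) \<in> edges (graph_of e T)"
      using xy ne p q by (intro exI[of _ u] exI[of _ v]) (simp add: graph_of_def)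
  next
    assume "\<exists>u v. u' = f u \<and> v' = g v \<and> (u, d, v) \<in> edges (graph_of e T)"
    then obtain u v where uv: "u' = f u" "v' =
      g v" "(Some u, d, Some v) \<in> T" "Some u \<noteq> fst e" "Some v \<noteq> snd (snd e)"
      by (auto simp: graph_of_def)
    have "p (Some u) \<noteq> p (fst e)" "q (Some v) \<noteq> q (snd (snd e))" using uv inj by (simp_all add: inj_eq)
    then show "(u', d, v') \<in> edges (graph_of (mapx p q e) (mapx p q ` T))"
      using mapx_image[OF uv(3), of p q] uv(1,2) p q by (simp add: graph_of_def fst_mapx)
  qed
  have "edges (graph_of (mapx p q e) (mapx p q ` T)) = map_edge f g ` edges (graph_of e T)"
    using edge by (force simp: map_edge_def image_iff)
  then show ?thesis
    unfolding is_iso_def white black using injf injg by (auto intro: inj_on_imp_bij_betw inj_on_subset)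
qed

lemma map_edge_simp: "map_edge f g (w, c, b) = (f w, c, g b)"
  by (simp add: map_edge_def)

lemma unroot_mapx:
  assumes R: "rooted_graph D (G, (w, c, b))" and i: "is_rooted_iso f g (G, (w, c, b)) R'"
    and p: "\<And>u. u \<in> white G \<Longrightarrow> p (Some u) = Some (f u)" and q: "\<And>u. u \<in> black G \<Longrightarrow> q (Some u) = Some (g u)"
  shows "unroot (p x) (q y) R' = mapx p q ` unroot x y (G, (w, c, b))"
proof -
  obtain G' r' where R': "R' = (G', r')" by (cases R')
  note cov = rooted_cover[OF R]
  have r': "r' = (f w, c, g b)" using i R' by (simp add: is_rooted_iso_def map_edge_simp)
  have e': "edges G' = map_edge f g ` edges G" and bij: "inj_on f (white G)" "inj_on g (black G)"
    using i R' by (auto simp: is_rooted_iso_def is_iso_def bij_betw_def)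
  have "inj_on (map_edge f g) (edges G)"
  proof (rule inj_onI)
    fix x y assume "x \<in> edges G" "y \<in> edges G" "map_edge f g x = map_edge f g y"
    then show "x = y"
      using cov(1) bij by (cases x; cases y) (auto simp: map_edge_def dest!: inj_onD)
  qed
  then have r: "map_edge f g ` (edges G - {(w, c, b)}) = edges G' - {r'}"
    using cov(4) by (subst inj_on_image_set_diff) (auto simp: e' r' map_edge_simp)
  have "lift (map_edge f g e) = mapx p q (lift e)" if "e \<in> edges G - {(w, c, b)}" for e
    using that cov(1) p q by (cases e) (auto simp: map_edge_simp)
  then have "lift ` map_edge f g ` (edges G - {(w, c, b)}) = mapx p q ` lift ` (edges G - {(w, c, b)})"
    unfolding image_image by (rule image_cong[OF refl])
  then have "lift ` (edges G' - {r'}) = mapx p q ` lift ` (edges G - {(w, c, b)})" unfolding r .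
  moreover have "w \<in> white G" "b \<in> black G" using cov(1,4) by auto
  ultimately show ?thesis using p q r' by (simp add: unroot_def R' image_Un)
qed

lemma Some_in_map_option: "Some v \<in> map_option f ` A \<longleftrightarrow> (\<exists>u. v = f u \<and> Some u \<in> A)"
proof
  assume "Some v \<in> map_option f ` A"
  then obtain x where "x \<in> A" "Some v = map_option f x" by blast
  then show "\<exists>u. v = f u \<and> Some u \<in> A" by (cases x) auto
qed force

lemma Some_in_mapx_map_option:
  "(Some u, d, Some v) \<in> mapx (map_option f) (map_option g) ` T \<longleftrightarrow>
    (\<exists>u' v'. u = f u' \<and> v = g v' \<and> (Some u', d, Some v') \<in> T)"
proof
  assume "(Some u, d, Some v) \<in> mapx (map_option f) (map_option g) ` T"
  then obtain x y where "Some u = map_option f x" "Some v = map_option g y" "(x, d, y) \<in> T"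
    unfolding in_mapx by blast
  then show "\<exists>u' v'. u = f u' \<and> v = g v' \<and> (Some u', d, Some v') \<in> T" by (cases x; cases y) auto
next
  assume "\<exists>u' v'. u = f u' \<and> v = g v' \<and> (Some u', d, Some v') \<in> T"
  then obtain u' v' where "u = f u'" "v = g v'" "(Some u', d, Some v') \<in> T" by blast
  then show "(Some u, d, Some v) \<in> mapx (map_option f) (map_option g) ` T"
    using mapx_image[of "Some u'" d "Some v'" T "map_option f" "map_option g"] by simp
qed

text \<open>The root is recovered from the two edges at \<open>None\<close>, which
  \<open>map_option\<close> fixes, and all other edges from those between vertices of the form
  \<open>Some\<close>.\<close>

lemma rooted_iso_of_unroot:
  assumes R: "rooted_graph D (G, (w, c, b))" and R': "rooted_graph D (G', (w', c', b'))"
    and E: "unroot None None (G', (w', c', b')) =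
      mapx (map_option f) (map_option g) ` unroot None None (G, (w, c, b))"
    and inj: "inj_on f (white G)" "inj_on g (black G)"
  shows "is_rooted_iso f g (G, (w, c, b)) (G', (w', c', b'))" "c' = c"
proof -
  let ?E = "unroot None None (G, (w, c, b))" and ?E' = "unroot None None (G', (w', c', b'))"
  let ?m = "mapx (map_option f) (map_option g)"
  have "(Some w, c, None) \<in> ?E" "(None, c, Some b) \<in> ?E" by (auto simp: in_unroot)
  then have "(Some (f w), c, None) \<in> ?E'" "(None, c, Some (g b)) \<in> ?E'" unfolding E by force+
  then have r: "w' = f w" "c' = c" "b' = g b" by (auto simp: in_unroot)
  then show "c' = c" by simp
  have W: "u \<in> white G' \<longleftrightarrow> u \<in> f ` white G" for u
  proof -
    have "u \<in> white G' \<longleftrightarrow> Some u \<in> map_option f ` whites ?E"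
      unfolding whites_unroot(1)[OF R', symmetric] E whites_mapx ..
    also have "\<dots> \<longleftrightarrow> (\<exists>v. Some v \<in> whites ?E \<and> u = f v)"
      unfolding Some_in_map_option by blast
    finally show ?thesis using whites_unroot(1)[OF R] by auto
  qed
  have B: "u \<in> black G' \<longleftrightarrow> u \<in> g ` black G" for u
  proof -
    have "u \<in> black G' \<longleftrightarrow> Some u \<in> map_option g ` blacks ?E"
      unfolding whites_unroot(2)[OF R', symmetric] E blacks_mapx ..
    also have "\<dots> \<longleftrightarrow> (\<exists>v. Some v \<in> blacks ?E \<and> u = g v)"
      unfolding Some_in_map_option by blast
    finally show ?thesis using whites_unroot(2)[OF R] by auto
  qed
  have e: "(u, d, v) \<in> edges G \<longleftrightarrow> (u, d, v) = (w, c, b) \<or> (Some u, d, Some v) \<in> ?E" for u d v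
    using rooted_cover(4)[OF R] by (auto simp: in_unroot)
  have e': "(u, d, v) \<in> edges G' \<longleftrightarrow> (u, d, v) = (f w, c, g b) \<or> (Some u, d, Some v) \<in> ?E'" for u d v
    using rooted_cover(4)[OF R'] r by (auto simp: in_unroot)
  have "(u, d, v) \<in> edges G' \<longleftrightarrow> (u, d, v) \<in> map_edge f g ` edges G" for u d v
  proof -
    have "(Some u, d, Some v) \<in> ?E' \<longleftrightarrow> (\<exists>u' v'. u = f u' \<and> v = g v' \<and> (Some u', d, Some v') \<in> ?E)"
      unfolding E by (rule Some_in_mapx_map_option)
    then have "(u, d, v) \<in> edges G' \<longleftrightarrow> (\<exists>u' v'. u = f u' \<and> v = g v' \<and> (u', d, v') \<in> edges G)"
      unfolding e' e by blast
    also have "\<dots> \<longleftrightarrow> (u, d, v) \<in> map_edge f g ` edges G" by (force simp: map_edge_def image_iff)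
    finally show ?thesis .
  qed
  then have "edges G' = map_edge f g ` edges G" by auto
  moreover have "white G' = f ` white G" "black G' = g ` black G" using W B by blast+
  ultimately show "is_rooted_iso f g (G, (w, c, b)) (G', (w', c', b'))"
    using inj r by (simp add: is_rooted_iso_def is_iso_def map_edge_simp bij_betw_def)
qed

text \<open>The unmatched half-edges of an open graph are determined by its vertices and edges, so
  an isomorphism respects them and hence the root edge that joins them.\<close>

lemma cl_graph_iso:
  assumes H: "open_graph D H" and H': "open_graph D H'" and i: "is_iso f g H H'"
  shows "is_rooted_iso f g (cl_graph D H) (cl_graph D H')"
proof -
  obtain w c b where cl: "cl_graph D H = (H\<lparr>edges := insert (w, c, b) (edges H)\<rparr>, (w, c, b))"
    and fr: "free_white D H = {(w, c)}" "free_black D H = {(b, c)}"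
    by (rule rooted_cl_graph[OF H])
  obtain w' c' b' where cl': "cl_graph D H' =
    (H'\<lparr>edges := insert (w', c', b') (edges H')\<rparr>, (w', c', b'))"
    and fr': "free_white D H' = {(w', c')}" "free_black D H' = {(b', c')}"
    by (rule rooted_cl_graph[OF H'])
  have bij: "bij_betw f (white H) (white H')" "bij_betw g (black H) (black H')"
    and e: "edges H' = map_edge f g ` edges H" using i by (auto simp: is_iso_def)
  have sub: "u \<in> white H \<and> v \<in> black H" if "(u, d, v) \<in> edges H" for u d v
    using H that partial_graphD(3)[of D H u d v] by (simp add: open_graph_def)
  have w: "w \<in> white H" "c \<le> D" "\<And>v. (w, c, v) \<notin> edges H" using fr(1) by (auto simp: free_white_def)
  have b: "b \<in> black H" "\<And>v. (v, c, b) \<notin> edges H" using fr(2) by (auto simp: free_black_def)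
  have "(f w, c, v) \<notin> edges H'" for v
  proof
    assume "(f w, c, v) \<in> edges H'"
    then obtain u v' where uv: "(u, c, v') \<in> edges H" "f u = f w" unfolding e
      by (auto simp: map_edge_def)
    then have "u = w" using sub[OF uv(1)] w(1) bij(1) by (auto simp: bij_betw_def dest: inj_onD)
    then show False using uv(1) w(3) by blast
  qed
  then have "(f w, c) \<in> free_white D H'" using w bij(1) by (auto simp: free_white_def bij_betw_def)
  then have 1: "w' = f w" "c' = c" using fr'(1) by auto
  have "(v, c, g b) \<notin> edges H'" for v
  proof
    assume "(v, c, g b) \<in> edges H'"
    then obtain u v' where uv: "(v', c, u) \<in> edges H" "g u = g b" unfolding e
      by (auto simp: map_edge_def)
    then have "u = b" using sub[OF uv(1)] b(1) bij(2) by (auto simp: bij_betw_def dest: inj_onD)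
    then show False using uv(1) b(2) by blast
  qed
  then have "(g b, c) \<in> free_black D H'" using w b bij(2) by (auto simp: free_black_def bij_betw_def)
  then have 2: "b' = g b" using fr'(2) by auto
  show ?thesis unfolding cl cl' 1 2 using bij e by (simp add: is_rooted_iso_def is_iso_def map_edge_simp)
qed

lemma is_iso_trans:
  assumes "is_iso f g H H'" "is_iso f' g' H' H''"
  shows "is_iso (f' \<circ> f) (g' \<circ> g) H H''"
  using is_iso_comp[of f g "(H, r)" "(H', map_edge f g r)" f' g'
    "(H'', map_edge f' g' (map_edge f g r))" for r] assms
  by (auto simp: is_rooted_iso_def)

lemma is_iso_sym:
  assumes i: "is_iso f g H H'" and sub: "\<And>u d v. (u, d, v) \<in> edges H \<Longrightarrow> u \<in> white H \<and> v \<in> black H"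
  shows "is_iso (inv_into (white H) f) (inv_into (black H) g) H' H"
proof -
  have b: "bij_betw f (white H) (white H')" "bij_betw g (black H) (black H')"
    and e: "edges H' = map_edge f g ` edges H" using i by (auto simp: is_iso_def)
  have "map_edge (inv_into (white H) f) (inv_into (black H) g) (map_edge f g x) = x"
    if "x \<in> edges H" for x
    using that sub b by (cases x) (auto simp: map_edge_def bij_betw_def inv_into_f_f)
  then have "map_edge (inv_into (white H) f) (inv_into (black H) g) ` edges H' = edges H"
    unfolding e by (force simp: image_image)
  then show ?thesis using b by (simp add: is_iso_def bij_betw_inv_into)
qed

lemma open_iso_class:
  assumes i: "is_iso f g H H'" and H: "H = empty_graph \<or> open_graph D H" and H': "H' = empty_graph \<or>
    open_graph D H'"
  shows "open_iso D `` {H} = open_iso D `` {H'}"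
proof -
  have sub: "u \<in> white H \<and> v \<in> black H" if "(u, d, v) \<in> edges H" for u d v
    using H that partial_graphD(3)[of D H u d v] by (auto simp: open_graph_def empty_graph_def)
  have j: "is_iso (inv_into (white H) f) (inv_into (black H) g) H' H" using i sub by (rule is_iso_sym)
  show ?thesis
  proof (intro set_eqI iffI)
    fix K assume "K \<in> open_iso D `` {H}"
    then obtain f' g' where k: "K = empty_graph \<or> open_graph D K" "is_iso f' g' H K"
      by (auto simp: open_iso_def)
    then show "K \<in> open_iso D `` {H'}" using is_iso_trans[OF j k(2)] H' unfolding open_iso_def by blast
  next
    fix K assume "K \<in> open_iso D `` {H'}"
    then obtain f' g' where k: "K = empty_graph \<or> open_graph D K" "is_iso f' g' H' K"
      by (auto simp: open_iso_def)
    then show "K \<in> open_iso D `` {H}" using is_iso_trans[OF i k(2)] H unfolding open_iso_def by blast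
  qed
qed

lemma open_iso_classD:
  assumes "open_iso D `` {H} = open_iso D `` {H'}" "H' = empty_graph \<or> open_graph D H'"
  shows "\<exists>f g. is_iso f g H H'"
proof -
  have "is_iso id id H' H'" by (simp add: is_iso_def bij_betw_id map_edge_def case_prod_beta)
  then have "H' \<in> open_iso D `` {H'}" using assms(2) by (auto simp: open_iso_def)
  then have "H' \<in> open_iso D `` {H}" using assms(1) by simp
  then show ?thesis by (auto simp: open_iso_def)
qed

lemma equiv_rooted_iso: "equiv {R. rooted_graph D R} (rooted_iso D)"
proof (rule equivI)
  show "rooted_iso D \<subseteq> {R. rooted_graph D R} \<times> {R. rooted_graph D R}" by (auto simp: rooted_iso_def)
  show "refl_on {R. rooted_graph D R} (rooted_iso D)"
  proof (rule refl_onI)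
    fix R assume "R \<in> {R. rooted_graph D R}"
    moreover have "is_rooted_iso id id R R"
      by (simp add: is_rooted_iso_def is_iso_def bij_betw_id map_edge_def case_prod_beta)
    ultimately show "(R, R) \<in> rooted_iso D" by (auto simp: rooted_iso_def)
  qed
  show "sym (rooted_iso D)" by (rule symI) (auto simp: rooted_iso_def dest: is_iso_inverse)
  show "trans (rooted_iso D)" by (rule transI) (auto simp: rooted_iso_def dest: is_iso_comp)
qed

text \<open>Isomorphisms are only injective on the vertex sets, while the lemmas on
  \<open>mapx\<close> work with injectivity everywhere.\<close>

lemma extend_inj:
  fixes f :: "nat \<Rightarrow> nat"
  assumes "finite A" "inj_on f A"
  obtains h where "inj h" "\<And>a. a \<in> A \<Longrightarrow> h a = f a"
proof -
  obtain N where N: "\<And>a. a \<in> A \<Longrightarrow> f a < N"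
    using assms(1) finite_nat_set_iff_bounded[of "f ` A"] by auto
  \<comment> \<open>Outside \<open>A\<close> the values are shifted beyond the bound
    \<open>N\<close> of the image of \<open>A\<close>.\<close>
  define h where "h a = (if a \<in> A then f a else N + a)" for a
  have "inj h"
  proof (rule injI)
    fix x y assume "h x = h y"
    then show "x = y"
      using N[of x] N[of y] assms(2) by (auto simp: h_def dest: inj_onD split: if_splits)
  qed
  then show thesis using that[of h] by (simp add: h_def)
qed

text \<open>Canonicity of \<open>L\<close> makes the lists of places correspond entry by entry, with
  the halves of the root at the front. An empty core can only be mapped to an empty core.\<close>

lemma skel_mapx:
  assumes L: "canonical_listing D L" and Q: "valid_core D c Q" and Q': "valid_core D c Q'"
    and s: "skel c Q' = mapx (map_option f) (map_option g) ` skel c Q" and inj: "inj f" "inj g"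
  shows "map_option (\<lambda>R. rooted_iso D `` {R}) Q = map_option (\<lambda>R. rooted_iso D `` {R}) Q'"
    "places L c Q' = map (mapx (map_option f) (map_option g)) (places L c Q)"
proof -
  let ?m = "mapx (map_option f) (map_option g)"
  have "map_option (\<lambda>R. rooted_iso D `` {R}) Q = map_option (\<lambda>R. rooted_iso D `` {R}) Q' \<and>
    places L c Q' = map ?m (places L c Q)"
  proof (cases Q)
    case None
    then have "skel c Q' = {(None, c, None)}" using s by (simp add: skel_def)
    then have "Q' = None"
      using Q' unroot_not_single[OF _ avoids_None] by (cases Q') (auto simp: skel_def valid_core_def)
    then show ?thesis using None by (simp add: places_def)
  next
    case (Some R)
    then obtain G w b where R: "R = (G, (w, c, b))" "rooted_graph D (G, (w, c, b))"
      using Q by (cases R) (auto simp: valid_core_def)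
    have "(Some w, c, None) \<in> skel c Q" using Some R(1) by (simp add: skel_def in_unroot)
    then have "(Some (f w), c, None) \<in> skel c Q'" unfolding s by force
    then obtain R' where "Q' = Some R'" by (cases Q') (auto simp: skel_def)
    then obtain G' w' b' where R': "Q' = Some (G', (w', c, b'))" "rooted_graph D (G', (w', c, b'))"
      using Q' by (cases R') (auto simp: valid_core_def)
    have "unroot None None (G', (w', c, b')) = ?m ` unroot None None (G, (w, c, b))"
      using s Some R(1) R'(1) by (simp add: skel_def)
    from rooted_iso_of_unroot(1)[OF R(2) R'(2) this] have i:
      "is_rooted_iso f g (G, (w, c, b)) (G', (w', c, b'))"
      using inj inj_on_subset by blast
    then have "(R, (G', (w', c, b'))) \<in> rooted_iso D" using R R'(2) by (auto simp: rooted_iso_def)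
    then have "rooted_iso D `` {R} = rooted_iso D `` {(G', (w', c, b'))}"
      by (rule equiv_class_eq[OF equiv_rooted_iso])
    moreover have "L (G', (w', c, b')) = map (map_edge f g) (L (G, (w, c, b)))"
      using canonical_listingD(3)[OF L R(2) R'(2) i] .
    moreover have "lift (map_edge f g e) = ?m (lift e)" for e by (cases e) (simp add: map_edge_simp)
    moreover have "w' = f w" "b' = g b" using i by (simp_all add: is_rooted_iso_def map_edge_simp)
    ultimately show ?thesis using Some R(1) R'(1) by (simp add: places_def)
  qed
  then show "map_option (\<lambda>R. rooted_iso D `` {R}) Q = map_option (\<lambda>R. rooted_iso D `` {R}) Q'"
    "places L c Q' = map ?m (places L c Q)" by auto
qed

lemma (in decomposed) comp_empty_or_open: "e \<in> C \<Longrightarrow> comp e = empty_graph \<or> open_graph D (comp e)"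
  using comp_possibly_empty unfolding possibly_empty_open_melonic_def open_melonic_def by blast

text \<open>A renaming carries a core with blow-ups for \<open>R\<close> to one for
  \<open>R'\<close>. As \<open>core_decomposition\<close> can be read off from any such pair, both
  decompositions correspond under the renaming.\<close>

lemma core_decomposition_respects:
  assumes D: "2 \<le> D" and L: "canonical_listing D L" and RR: "(R, R') \<in> rooted_iso D"
  shows "pair_class D (core_decomposition D L R) = pair_class D (core_decomposition D L R')"
proof -
  obtain G w c b where R: "R = (G, (w, c, b))" by (cases R)
  obtain f0 g0 where rg: "rooted_graph D (G, (w, c, b))" "rooted_graph D R'" and i0:
    "is_rooted_iso f0 g0 (G, (w, c, b)) R'"
    using RR R by (auto simp: rooted_iso_def)
  obtain G' w' b' where R': "R' = (G', (w', c, b'))"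
    using i0 by (cases R') (auto simp: is_rooted_iso_def map_edge_simp)
  have fin: "finite (white G)" "finite (black G)"
    using rg(1) by (auto simp: rooted_graph_def coloured_graph_def partial_graph_def)
  have inj0: "inj_on f0 (white G)" "inj_on g0 (black G)"
    using i0 by (auto simp: is_rooted_iso_def is_iso_def bij_betw_def)
  obtain f where f: "inj f" "\<And>u. u \<in> white G \<Longrightarrow> f u = f0 u" by (rule extend_inj[OF fin(1) inj0(1)]) blast
  obtain g where g: "inj g" "\<And>u. u \<in> black G \<Longrightarrow> g u = g0 u" by (rule extend_inj[OF fin(2) inj0(2)]) blast
  let ?p = "map_option f" and ?q = "map_option g"
  have inj: "inj ?p" "inj ?q" using f(1) g(1) by (auto intro!: option.inj_map)
  have E': "unroot None None R' = mapx ?p ?q ` unroot None None (G, (w, c, b))"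
    using unroot_mapx[OF rg(1) i0, of ?p ?q None None] f(2) g(2) by simp
  obtain Q F where Q: "valid_core D c Q" "decomposed D G w c b (skel c Q) F"
    by (rule exists_decomposed[OF D rg(1)])
  interpret d: decomposed D G w c b "skel c Q" F by (rule Q(2))
  let ?C' = "mapx ?p ?q ` skel c Q" and ?F' = "\<lambda>e. mapx ?p ?q ` F (inv (mapx ?p ?q) e)"
  have bC': "bordered D (None, c, None) ?C'" using bordered_mapx[OF d.C inj] by simp
  obtain Q' where Q': "valid_core D c Q'" "?C' = skel c Q'" by (rule skel_of_bordered[OF bC'])
  interpret d': decomposed D G' w' c b' ?C' ?F'
  proof
    show "rooted_graph D (G', (w', c, b'))" using rg(2) R' by simp
    show "family D ?C' ?F' (unroot None None (G', (w', c, b')))"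
      using family_mapx[OF d.fam inj] E' R' by simp
    show "no_melon D ?C'" by (rule no_melon_mapx[OF D inj d.nm])
  qed (use D bC' in auto)
  note sk = skel_mapx[OF L Q(1) Q'(1) Q'(2)[symmetric] f(1) g(1)]
  have inv: "inv (mapx ?p ?q) (mapx ?p ?q e) = e" for e using inj_mapx[OF inj] by (rule inv_f_f)
  have "open_iso D `` {d.comp e} = open_iso D `` {d'.comp (mapx ?p ?q e)}" if e: "e \<in> skel c Q" for e
  proof (rule open_iso_class)
    show "is_iso f g (d.comp e) (d'.comp (mapx ?p ?q e))"
      unfolding d.comp_def d'.comp_def inv using d.inner_Some[OF e] by (intro graph_of_iso inj) auto
  qed (use d.comp_empty_or_open[OF e] d'.comp_empty_or_open[of "mapx ?p ?q e"] e in auto)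
  then have "map (\<lambda>H. open_iso D `` {H}) (map d.comp (places L c Q)) =
      map (\<lambda>H. open_iso D `` {H}) (map d'.comp (places L c Q'))"
    unfolding sk(2) using places_skel(1)[OF L Q(1)] by simp
  then show ?thesis
    unfolding R R' d.core_decomposition_skel[OF L Q(1) refl] d'.core_decomposition_skel[OF L Q']
      pair_class_def
    using sk(1) by simp
qed

subsection \<open>Injectivity and surjectivity\<close>

text \<open>Two empty cores may come from roots of different colours, which only the component
  records; a nonempty core determines the colour.\<close>

lemma rooted_iso_skel:
  assumes Q: "valid_core D c Q" and Q': "valid_core D c' Q'"
    and eq: "map_option (\<lambda>R. rooted_iso D `` {R}) Q =
      map_option (\<lambda>R. rooted_iso D `` {R}) Q'" and ne: "Q \<noteq> None"
  obtains f g where "inj f" "inj g" "c' = c" "skel c Q' = mapx (map_option f) (map_option g) ` skel c Q"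
proof -
  obtain R where R: "Q = Some R" using ne by auto
  then obtain R' where R': "Q' = Some R'" using eq by (cases Q') auto
  obtain G w b where RG: "R = (G, (w, c, b))" "rooted_graph D (G, (w, c, b))"
    using Q R by (cases R) (auto simp: valid_core_def)
  obtain G' w' b' where RG': "R' = (G', (w', c', b'))" "rooted_graph D (G', (w', c', b'))"
    using Q' R' by (cases R') (auto simp: valid_core_def)
  have "rooted_iso D `` {R} = rooted_iso D `` {R'}" using eq R R' by simp
  then have "(R, R') \<in> rooted_iso D" using eq_equiv_class[OF _ equiv_rooted_iso] RG' by blast
  then obtain f0 g0 where i: "is_rooted_iso f0 g0 (G, (w, c, b)) (G', (w', c', b'))"
    using RG(1) RG'(1) by (auto simp: rooted_iso_def)
  have fin: "finite (white G)" "finite (black G)"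
    using RG(2) by (auto simp: rooted_graph_def coloured_graph_def partial_graph_def)
  have inj0: "inj_on f0 (white G)" "inj_on g0 (black G)"
    using i by (auto simp: is_rooted_iso_def is_iso_def bij_betw_def)
  obtain f where f: "inj f" "\<And>u. u \<in> white G \<Longrightarrow> f u = f0 u" by (rule extend_inj[OF fin(1) inj0(1)]) blast
  obtain g where g: "inj g" "\<And>u. u \<in> black G \<Longrightarrow> g u = g0 u" by (rule extend_inj[OF fin(2) inj0(2)]) blast
  have "unroot None None R' = mapx (map_option f) (map_option g) ` unroot None None R"
    using unroot_mapx[OF RG(2) i, of "map_option f" "map_option g" None None] f(2) g(2) RG(1) RG'(1)
      by simp
  moreover have "c' = c" using i by (simp add: is_rooted_iso_def map_edge_simp)
  ultimately show thesis using that[OF f(1) g(1)] R R' by (simp add: skel_def)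
qed

lemma is_iso_empty: "is_iso f g H H' \<Longrightarrow> white H' = {} \<longleftrightarrow> white H = {}"
  by (auto simp: is_iso_def bij_betw_def)

text \<open>The isomorphisms of the cores and of the melonic components fit together.\<close>

lemma core_decomposition_inj:
  assumes D: "2 \<le> D" and L: "canonical_listing D L" and R: "rooted_graph D R" and R': "rooted_graph D R'"
    and eq: "pair_class D (core_decomposition D L R) = pair_class D (core_decomposition D L R')"
  shows "(R, R') \<in> rooted_iso D"
proof -
  have D1: "1 \<le> D" using D by simp
  obtain G w c b where RG: "R = (G, (w, c, b))" by (cases R)
  obtain G' w' c' b' where RG': "R' = (G', (w', c', b'))" by (cases R')
  note rg = R[unfolded RG] and rg' = R'[unfolded RG']
  obtain Q F where Q: "valid_core D c Q" "decomposed D G w c b (skel c Q) F"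
    by (rule exists_decomposed[OF D rg])
  obtain Q' F' where Q': "valid_core D c' Q'" "decomposed D G' w' c' b' (skel c' Q') F'"
    by (rule exists_decomposed[OF D rg'])
  interpret d: decomposed D G w c b "skel c Q" F by (rule Q(2))
  interpret d': decomposed D G' w' c' b' "skel c' Q'" F' by (rule Q'(2))
  have eqQ: "map_option (\<lambda>R. rooted_iso D `` {R}) Q = map_option (\<lambda>R. rooted_iso D `` {R}) Q'"
    and eqH: "map (\<lambda>H. open_iso D `` {H}) (map d.comp (places L c Q)) =
      map (\<lambda>H. open_iso D `` {H}) (map d'.comp (places L c' Q'))"
    using eq unfolding RG RG' d.core_decomposition_skel[OF L Q(1) refl]
      d'.core_decomposition_skel[OF L Q'(1) refl]
    by (simp_all add: pair_class_def)
  have "\<exists>f g. is_rooted_iso f g (G, (w, c, b)) (G', (w', c', b'))"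
  proof (cases "Q = None")
    case True
    \<comment> \<open>Here the only components are the cut graphs themselves, and closing them
      carries their isomorphism over to the rooted graphs.\<close>
    then have "Q' = None" using eqQ by simp
    then have "open_iso D `` {op_graph (G, (w, c, b))} = open_iso D `` {op_graph (G', (w', c', b'))}"
      using eqH True d.core_single(2) d'.core_single(2) by (simp add: places_def skel_def)
    then obtain f g where "is_iso f g (op_graph (G, (w, c, b))) (op_graph (G', (w', c', b')))"
      using open_iso_classD open_op_graph(1)[OF D1 rg'] by blast
    from cl_graph_iso[OF open_op_graph(1)[OF D1 rg] open_op_graph(1)[OF D1 rg'] this] show ?thesis
      using open_op_graph(4)[OF D1 rg] open_op_graph(4)[OF D1 rg'] by auto
  next
    case False
    obtain f0 g0 where inj: "inj f0" "inj g0" and c': "c' = c"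
      and sk: "skel c Q' = mapx (map_option f0) (map_option g0) ` skel c Q"
      by (rule rooted_iso_skel[OF Q(1) Q'(1) eqQ False])
    let ?n = "mapx (map_option f0) (map_option g0)" and ?C = "skel c Q"
    have injo: "inj (map_option f0)" "inj (map_option g0)" using inj by (auto intro!: option.inj_map)
    have inj0: "inj ?n" using inj_mapx[OF injo] .
    have Q'c: "valid_core D c Q'" using Q'(1) c' by simp
    have "places L c Q' = map ?n (places L c Q)" by (rule skel_mapx(2)[OF L Q(1) Q'c sk inj])
    \<comment> \<open>The canonical listing aligns the places of both cores under \<open>?n\<close>,
      so equality of the lists compares the component at \<open>e\<close> with the one at
      \<open>?n e\<close>.\<close>
    then have cls: "open_iso D `` {d.comp e} = open_iso D `` {d'.comp (?n e)}" if "e \<in> ?C" for e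
      using eqH that places_skel(1)[OF L Q(1)] unfolding c' by auto
    have m0C: "?n e \<in> skel c' Q'" if "e \<in> ?C" for e using that sk c' by blast
    have "\<exists>f g. is_iso f g (d.comp e) (d'.comp (?n e))" if "e \<in> ?C" for e
      using open_iso_classD[OF cls[OF that] d'.comp_empty_or_open[OF m0C[OF that]]] .
    then obtain fe ge where fg: "\<And>e. e \<in> ?C \<Longrightarrow> is_iso (fe e) (ge e) (d.comp e) (d'.comp (?n e))" by metis
    define f where "f u = (if Some u \<in> whites ?C then f0 u else fe (SOME e. e \<in> ?C \<and>
      u \<in> white (d.comp e)) u)" for u
    define g where "g u = (if Some u \<in> blacks ?C then g0 u else ge (SOME e. e \<in> ?C \<and>
      u \<in> black (d.comp e)) u)" for u
    \<comment> \<open>Components have disjoint vertex sets, so the choice in the definition of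
      \<open>f\<close> can only return \<open>e\<close>.\<close>
    have fe: "f u = fe e u" if e: "e \<in> ?C" "u \<in> white (d.comp e)" for e u
    proof -
      have "(SOME e. e \<in> ?C \<and> u \<in> white (d.comp e)) = e" using e d.comp_disjoint
        by (intro some_equality) blast+
      then show ?thesis using d.comp_not_C(1)[OF e] by (simp add: f_def)
    qed
    have ge: "g u = ge e u" if e: "e \<in> ?C" "u \<in> black (d.comp e)" for e u
    proof -
      have "(SOME e. e \<in> ?C \<and> u \<in> black (d.comp e)) = e" using e d.comp_disjoint_black
        by (intro some_equality) blast+
      then show ?thesis using d.comp_not_C(2)[OF e] by (simp add: g_def)
    qed
    let ?m = "mapx (map_option f) (map_option g)"
    have fC: "map_option f x = map_option f0 x" if "x \<in> whites ?C" for x using that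
      by (cases x) (simp_all add: f_def)
    have gC: "map_option g x = map_option g0 x" if "x \<in> blacks ?C" for x using that
      by (cases x) (simp_all add: g_def)
    have mC: "?m e = ?n e" if "e \<in> ?C" for e
      using fC[OF d.fst_in_whites_C[OF that]] gC[OF d.snd_in_blacks_C[OF that]] by (cases e) simp
    \<comment> \<open>An isomorphism of components respects the unmatched half-edges, and at the
      border \<open>f\<close> and \<open>g\<close> agree with the isomorphism of the cores, so the
      bordered components correspond too.\<close>
    have F': "F' (?n e) = ?m ` F e" if e: "e \<in> ?C" for e
    proof (cases "F e = {e}")
      case True
      then have "white (d'.comp (?n e)) = {}"
        using is_iso_empty[OF fg[OF e]] d.comp_single[OF True] by (simp add: empty_graph_def)
      then have "F' (?n e) = {?n e}" using d'.comp_nonempty[OF m0C[OF e]] by blast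
      then show ?thesis using True mC[OF e] by simp
    next
      case ne: False
      obtain x k y where xky: "e = (x, k, y)" by (cases e)
      have "white (d'.comp (?n e)) \<noteq> {}" using is_iso_empty[OF fg[OF e]] d.comp_nonempty[OF e ne]
        by blast
      then have ne': "F' (?n e) \<noteq> {?n e}" using d'.comp_single[of "?n e"] by (auto simp: empty_graph_def)
      obtain G1 w1 b1 where R1: "rooted_graph D (G1, (w1, k, b1))" "d.comp e =
        op_graph (G1, (w1, k, b1))"
        "unroot x y (G1, (w1, k, b1)) = F e"
        using e ne unfolding xky by (rule d.F_unroot)
      have m0e: "?n e = (map_option f0 x, k, map_option g0 y)" by (simp add: xky)
      obtain G2 w2 b2 where R2: "rooted_graph D (G2, (w2, k, b2))" "d'.comp (?n e) =
        op_graph (G2, (w2, k, b2))"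
        "unroot (map_option f0 x) (map_option g0 y) (G2, (w2, k, b2)) = F' (?n e)"
        using m0C[OF e] ne' unfolding m0e by (rule d'.F_unroot)
      have "is_rooted_iso (fe e) (ge e) (cl_graph D (d.comp e)) (cl_graph D (d'.comp (?n e)))"
        using fg[OF e] open_op_graph(1)[OF D1 R1(1)] open_op_graph(1)[OF D1 R2(1)] unfolding R1(2) R2(2)
        by (intro cl_graph_iso)
      then have i: "is_rooted_iso (fe e) (ge e) (G1, (w1, k, b1)) (G2, (w2, k, b2))"
        unfolding R1(2) R2(2) open_op_graph(4)[OF D1 R1(1)] open_op_graph(4)[OF D1 R2(1)] .
      have "map_option f (Some u) = Some (fe e u)" if "u \<in> white G1" for u using fe[OF e] that R1(2)
        by simp
      moreover have "map_option g (Some u) = Some (ge e u)" if "u \<in> black G1" for u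
        using ge[OF e] that R1(2) by simp
      ultimately have "unroot (map_option f x) (map_option g y) (G2, (w2, k, b2)) =
        ?m ` unroot x y (G1, (w1, k, b1))"
        by (rule unroot_mapx[OF R1(1) i])
      moreover have "map_option f x = map_option f0 x" "map_option g y = map_option g0 y"
        using mC[OF e] xky by simp_all
      ultimately show ?thesis using R1(3) R2(3) by simp
    qed
    have "unroot None None (G', (w', c', b')) = (\<Union>e' \<in> skel c' Q'. F' e')" by (rule d'.E_eq)
    also have "\<dots> = (\<Union>e \<in> ?C. F' (?n e))" unfolding c' sk by simp
    also have "\<dots> = (\<Union>e \<in> ?C. ?m ` F e)" using F' by simp
    also have "\<dots> = ?m ` unroot None None (G, (w, c, b))" unfolding d.E_eq by blast
    finally have E': "unroot None None (G', (w', c', b')) = ?m ` unroot None None (G, (w, c, b))" .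
    have sk': "skel c' Q' = ?n ` ?C" using sk c' by simp
    have f_comp: "f u \<in> white (d'.comp (?n e))" if "e \<in> ?C" "u \<in> white (d.comp e)" for e u
      using fg[OF that(1)] that(2) fe[OF that] by (auto simp: is_iso_def bij_betw_def)
    have g_comp: "g u \<in> black (d'.comp (?n e))" if "e \<in> ?C" "u \<in> black (d.comp e)" for e u
      using fg[OF that(1)] that(2) ge[OF that] by (auto simp: is_iso_def bij_betw_def)
    have f_C: "Some (f u) \<in> whites (skel c' Q')" if "Some u \<in> whites ?C" for u
      using that unfolding sk' whites_mapx f_def by (auto simp: Some_in_map_option)
    have g_C: "Some (g u) \<in> blacks (skel c' Q')" if "Some u \<in> blacks ?C" for u
      using that unfolding sk' blacks_mapx g_def by (auto simp: Some_in_map_option)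
    \<comment> \<open>Core vertices go to core vertices and each component to its own counterpart,
      so equal images can only arise within one of these parts.\<close>
    have "inj_on f (white G)"
    proof (rule inj_onI)
      fix u v assume uv: "u \<in> white G" "v \<in> white G" "f u = f v"
      consider "Some u \<in> whites ?C" "Some v \<in> whites ?C"
        | e where "Some u \<in> whites ?C" "e \<in> ?C" "v \<in> white (d.comp e)"
        | e where "Some v \<in> whites ?C" "e \<in> ?C" "u \<in> white (d.comp e)"
        | e e' where "e \<in> ?C" "u \<in> white (d.comp e)" "e' \<in> ?C" "v \<in> white (d.comp e')"
        using uv(1,2) d.white_G_cases by blast
      then show "u = v"
      proof cases
        case 1
        then show ?thesis using uv(3) inj(1) by (simp add: f_def inj_eq)
      next
        case (2 e)
        then show ?thesis using f_C[of u] f_comp[of e v] d'.comp_not_C(1)[OF m0C] uv(3) by metis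
      next
        case (3 e)
        then show ?thesis using f_C[of v] f_comp[of e u] d'.comp_not_C(1)[OF m0C] uv(3) by metis
      next
        case (4 e e')
        have "?n e = ?n e'"
          using d'.comp_disjoint[OF m0C[OF 4(1)] m0C[OF 4(3)] f_comp[OF 4(1,2)]] f_comp[OF 4(3,4)]
            uv(3) by simp
        then have "e = e'" using inj0 by (simp add: inj_eq)
        then show ?thesis using fg[OF 4(1)] fe[OF 4(1,2)] fe[OF 4(3,4)] uv(3) 4
          by (auto simp: is_iso_def bij_betw_def dest: inj_onD)
      qed
    qed
    moreover have "inj_on g (black G)"
    proof (rule inj_onI)
      fix u v assume uv: "u \<in> black G" "v \<in> black G" "g u = g v"
      consider "Some u \<in> blacks ?C" "Some v \<in> blacks ?C"
        | e where "Some u \<in> blacks ?C" "e \<in> ?C" "v \<in> black (d.comp e)"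
        | e where "Some v \<in> blacks ?C" "e \<in> ?C" "u \<in> black (d.comp e)"
        | e e' where "e \<in> ?C" "u \<in> black (d.comp e)" "e' \<in> ?C" "v \<in> black (d.comp e')"
        using uv(1,2) d.black_G_cases by blast
      then show "u = v"
      proof cases
        case 1
        then show ?thesis using uv(3) inj(2) by (simp add: g_def inj_eq)
      next
        case (2 e)
        then show ?thesis using g_C[of u] g_comp[of e v] d'.comp_not_C(2)[OF m0C] uv(3) by metis
      next
        case (3 e)
        then show ?thesis using g_C[of v] g_comp[of e u] d'.comp_not_C(2)[OF m0C] uv(3) by metis
      next
        case (4 e e')
        have "?n e = ?n e'"
          using d'.comp_disjoint_black[OF m0C[OF 4(1)] m0C[OF 4(3)] g_comp[OF 4(1,2)]] g_comp[OF
            4(3,4)] uv(3) by simp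
        then have "e = e'" using inj0 by (simp add: inj_eq)
        then show ?thesis using fg[OF 4(1)] ge[OF 4(1,2)] ge[OF 4(3,4)] uv(3) 4
          by (auto simp: is_iso_def bij_betw_def dest: inj_onD)
      qed
    qed
    ultimately show ?thesis using rooted_iso_of_unroot(1)[OF rg rg' E'] by blast
  qed
  then show ?thesis using rg rg' by (auto simp: rooted_iso_def RG RG')
qed

section \<open>Surjectivity: substitution of components into a core\<close>

lemma exists_map_eq:
  assumes "distinct xs" "length xs = length ys"
  shows "\<exists>h. map h xs = ys"
  using assms
proof (induction xs arbitrary: ys)
  case (Cons x xs)
  obtain y ys' where ys: "ys = y # ys'" using Cons.prems(2) by (cases ys) auto
  obtain h where "map h xs = ys'" using Cons.IH[of ys'] Cons.prems ys by auto
  then have "map (h(x := y)) (x # xs) = ys" using Cons.prems(1) ys by auto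
  then show ?case by blast
qed simp

lemma card_vertices_iso:
  assumes "is_iso f g H H'" "finite (white H)" "finite (black H)"
  shows "card (vertices H') = card (vertices H)"
proof -
  have b: "bij_betw f (white H) (white H')" "bij_betw g (black H) (black H')" using assms(1)
    by (auto simp: is_iso_def)
  then have "finite (white H')" "finite (black H')" using assms(2,3) bij_betw_finite by blast+
  then show ?thesis using bij_betw_same_card[OF b(1)] bij_betw_same_card[OF b(2)] assms
    by (simp add: vertices_def card_Plus)
qed

text \<open>The inverse image is built by substituting copies with disjoint vertex names.\<close>

lemma exists_core_decomposition:
  assumes D: "2 \<le> D" and L: "canonical_listing D L" and Q: "valid_core D c Q" and mf: "melon_free D Q"
    and H: "\<And>e. e \<in> skel c Q \<Longrightarrow> possibly_empty_open_melonic D (H e)"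
    and col: "\<And>e. e \<in> skel c Q \<Longrightarrow> H e = empty_graph \<or> open_colour D (H e) = fst (snd e)"
    and ne: "Q = None \<Longrightarrow> H (None, c, None) \<noteq> empty_graph"
  obtains G w b where "rooted_graph D (G, (w, c, b))" "fst (core_decomposition D L (G, (w, c, b))) = Q"
    "pair_class D (core_decomposition D L (G, (w, c, b))) = pair_class D (Q, map H (places L c Q))"
    "card (vertices G) = size_opt Q + (\<Sum>e \<in> skel c Q. card (vertices (H e)))"
proof -
  have D1: "1 \<le> D" using D by simp
  let ?C = "skel c Q"
  have C: "bordered D (None, c, None) ?C" by (rule bordered_skel[OF D1 Q])
  have finC: "finite ?C" using bordered_finite[OF C] .
  have C_colour: "fst (snd e) \<le> D" if "e \<in> ?C" for e
    using bordered_colour[OF C, of "fst e" "fst (snd e)" "snd (snd e)"] that by simp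
  \<comment> \<open>The components as blow-ups of an edge from \<open>None\<close> to
    \<open>None\<close> in the colour of their place; by \<open>col\<close> this is the colour of
    their unmatched half-edges.\<close>
  define X where "X e = (if H e = empty_graph then {(None, fst (snd e), None)} else unroot None None
    (cl_graph D (H e)))" for e
  have X: "blowup D (None, fst (snd e), None) (X e) \<and> graph_of (None, fst (snd e), None) (X e) = H e"
    if e: "e \<in> ?C" for e
  proof (cases "H e = empty_graph")
    case True
    then show ?thesis
      by (auto simp: X_def blowup.single graph_of_def empty_graph_def inner_whites_def
        inner_blacks_def whites_def blacks_def)
  next
    case False
    then have om: "open_melonic D (H e)" using H[OF e] by (simp add: possibly_empty_open_melonic_def)
    then have oH: "open_graph D (H e)" by (simp add: open_melonic_def)
    obtain w k b where cl: "cl_graph D (H e) = (H e\<lparr>edges := insert (w, k, b) (edges (H e))\<rparr>, (w, k, b))"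
      and fr: "free_white D (H e) = {(w, k)}" and R: "rooted_graph D (cl_graph D (H e))"
      and op: "op_graph (cl_graph D (H e)) = H e"
      by (rule rooted_cl_graph[OF oH])
    have k: "k = fst (snd e)" using col[OF e] False fr by (simp add: open_colour_def)
    have XR: "X e = unroot None None (cl_graph D (H e))" using False by (simp add: X_def)
    have "blowup D (None, k, None) (X e)"
      using blowup_of_melonic[OF D, of "cl_graph D (H e)"] om unfolding XR
        by (simp add: open_melonic_def cl)
    moreover have "graph_of (None, k, None) (X e) = H e"
      unfolding XR using graph_of_unroot[OF R[unfolded cl] avoids_None] op by (simp add: cl)
    ultimately show ?thesis using k by simp
  qed
  obtain i :: "nat option \<times> nat \<times> nat option \<Rightarrow> nat" where i: "inj_on i ?C"
    using finite_imp_inj_to_nat_seg[OF finC] by metis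
  have "finite (Option.these (whites ?C) \<union> Option.these (blacks ?C))"
  proof -
    have "whites ?C = fst ` ?C" "blacks ?C = (\<lambda>e. snd (snd e)) ` ?C"
      by (force simp: whites_def blacks_def)+
    then show ?thesis using finC by (simp add: Option.these_def)
  qed
  then obtain N where N': "\<forall>u \<in> Option.these (whites ?C) \<union> Option.these (blacks ?C). u < N"
    unfolding finite_nat_set_iff_bounded by (elim exE)
  have N: "u < N" if "Some u \<in> whites ?C \<or> Some u \<in> blacks ?C" for u
    using N'[rule_format, of u] that by (auto simp: in_these_eq)
  define r where "r e u = N + prod_encode (i e, u)" for e u
  have r_inj: "r e u = r e' u' \<longleftrightarrow> e = e' \<and> u = u'" if "e \<in> ?C" "e' \<in> ?C" for e e' u u'
    using that i by (auto simp: r_def dest: inj_onD)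
  define p where "p e z = (case z of None \<Rightarrow> fst e | Some u \<Rightarrow> Some (r e u))" for e z
  define q where "q e z = (case z of None \<Rightarrow> snd (snd e) | Some u \<Rightarrow> Some (r e u))" for e z
  have nr: "fst e \<noteq> Some (r e' u)" "snd (snd e) \<noteq> Some (r e' u)" if "e \<in> ?C" for e e' u
    using N[of "r e' u"] that in_whites[of "fst e" "fst (snd e)" "snd (snd e)" ?C]
      in_blacks[of "fst e" "fst (snd e)" "snd (snd e)" ?C] by (auto simp: r_def)
  have inj: "inj (p e)" "inj (q e)" if e: "e \<in> ?C" for e
  proof -
    have n: "fst e \<noteq> Some (r e u)" "snd (snd e) \<noteq> Some (r e u)" for u using nr[OF e, of e u] by auto
    note n' = n[symmetric]
    show "inj (p e)" by (rule injI) (auto simp: p_def n n' r_inj[OF e e] split: option.splits)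
    show "inj (q e)" by (rule injI) (auto simp: q_def n n' r_inj[OF e e] split: option.splits)
  qed
  define T where "T e = mapx (p e) (q e) ` X e" for e
  have me: "mapx (p e) (q e) (None, fst (snd e), None) = e" for e by (simp add: p_def q_def)
  have T: "blowup D e (T e)" if e: "e \<in> ?C" for e
    using blowup_mapx[OF conjunct1[OF X[OF e]] inj[OF e]] unfolding me T_def .
  have iX: "inner_whites (None, k, None) S \<subseteq> range Some"
    "inner_blacks (None, k, None) S \<subseteq> range Some" for k and S :: "(nat option \<times> nat \<times> nat option) set"
    unfolding inner_whites_def inner_blacks_def by (auto simp: image_iff)
  have innerT: "inner_whites e (T e) \<subseteq> range (\<lambda>u. Some (r e u))"
    "inner_blacks e (T e) \<subseteq> range (\<lambda>u. Some (r e u))"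
    if e: "e \<in> ?C" for e
  proof -
    have "inner_whites e (T e) = p e ` inner_whites (None, fst (snd e), None) (X e)"
      "inner_blacks e (T e) = q e ` inner_blacks (None, fst (snd e), None) (X e)"
      using inner_mapx[OF inj[OF e], of "(None, fst (snd e), None)" "X e"] unfolding me T_def by simp_all
    then show "inner_whites e (T e) \<subseteq> range (\<lambda>u. Some (r e u))"
      "inner_blacks e (T e) \<subseteq> range (\<lambda>u. Some (r e u))"
      using iX[of "fst (snd e)" "X e"] by (force simp: p_def q_def)+
  qed
  define E where "E = (\<Union>e \<in> ?C. T e)"
  have fam: "family D ?C T E"
    unfolding family_def
  proof (intro conjI ballI impI)
    show "E = (\<Union>e \<in> ?C. T e)" by (fact E_def)
    fix e assume e: "e \<in> ?C"
    show "blowup D e (T e)" by (rule T[OF e])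
    have "Some (r e u) \<notin> whites ?C" "Some (r e u) \<notin> blacks ?C" for u using N[of "r e u"]
      by (auto simp: r_def)
    then show "inner_whites e (T e) \<inter> whites ?C = {}" "inner_blacks e (T e) \<inter> blacks ?C = {}"
      using innerT[OF e] by blast+
    fix e' assume e': "e' \<in> ?C" "e \<noteq> e'"
    have d: "range (\<lambda>u. Some (r e u)) \<inter> range (\<lambda>u. Some (r e' u)) = {}"
      using r_inj[OF e e'(1)] e'(2) by auto
    show "inner_whites e (T e) \<inter> inner_whites e' (T e') = {}"
      using Int_mono[OF innerT(1)[OF e] innerT(1)[OF e'(1)]] unfolding d
        by (rule subset_empty[THEN iffD1])
    show "inner_blacks e (T e) \<inter> inner_blacks e' (T e') = {}"
      using Int_mono[OF innerT(2)[OF e] innerT(2)[OF e'(1)]] unfolding d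
        by (rule subset_empty[THEN iffD1])
  qed
  interpret bu: blown_up D "(None, c, None)" ?C T E by (rule blown_up.intro[OF D C fam])
  \<comment> \<open>A single edge would stand for the empty graph. It is excluded by a vertex of the
    core or, if the core is empty, by a vertex of its only component.\<close>
  have Ene: "E \<noteq> {(None, c, None)}"
  proof
    assume E1: "E = {(None, c, None)}"
    show False
    proof (cases Q)
      case None
      then have e0: "(None, c, None) \<in> ?C" by (simp add: skel_def)
      have "H (None, c, None) \<noteq> empty_graph" using ne None by simp
      then have oH: "open_graph D (H (None, c, None))" "X (None, c, None) =
        unroot None None (cl_graph D (H (None, c, None)))"
        using H[OF e0] by (simp_all add: possibly_empty_open_melonic_def open_melonic_def X_def)
      obtain w k b where "cl_graph D (H (None, c, None)) =
        (H (None, c, None)\<lparr>edges := insert (w, k, b) (edges (H (None, c, None)))\<rparr>, (w, k, b))"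
        by (rule rooted_cl_graph[OF oH(1)])
      then have "(Some w, k, None) \<in> X (None, c, None)" unfolding oH(2) by (simp add: in_unroot)
      from mapx_image[OF this, of "p (None, c, None)" "q (None, c, None)"]
      have "(Some (r (None, c, None) w), k, None) \<in> E" using bu.in_E[OF e0]
        by (simp add: T_def p_def q_def)
      then show False using E1 by simp
    next
      case (Some R)
      then obtain G w b where R: "R = (G, (w, c, b))" using Q by (cases R) (auto simp: valid_core_def)
      have "(Some w, c, None) \<in> ?C" using Some R by (simp add: skel_def in_unroot)
      then have "Some w \<in> whites E" by (rule subsetD[OF bu.whites_C in_whites])
      then show False using E1 by (auto simp: whites_def)
    qed
  qed
  obtain G w b where R: "rooted_graph D (G, (w, c, b))" and EG: "unroot None None (G, (w, c, b)) = E"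
    by (rule rooted_of_bordered[OF bu.E_bordered Ene iX]) blast
  interpret d: decomposed D G w c b ?C T
    using D R C no_melon_skel[OF D Q] mf fam EG by unfold_locales auto
  have iso: "is_iso (r e) (r e) (H e) (d.comp e)" if e: "e \<in> ?C" for e
    using graph_of_iso[OF inj[OF e], of "r e" "r e" "(None, fst (snd e), None)" "X e"] iX X[OF e]
    unfolding me d.comp_def T_def[symmetric] by (simp add: p_def q_def)
  have oH: "H e = empty_graph \<or> open_graph D (H e)" if "e \<in> ?C" for e
    using H[OF that] by (auto simp: possibly_empty_open_melonic_def open_melonic_def)
  have "map (\<lambda>K. open_iso D `` {K}) (map d.comp (places L c Q)) =
    map (\<lambda>K. open_iso D `` {K}) (map H (places L c Q))"
    using open_iso_class[OF iso oH d.comp_empty_or_open] places_skel(1)[OF L Q] by simp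
  then have "pair_class D (core_decomposition D L (G, (w, c, b))) =
    pair_class D (Q, map H (places L c Q))"
    unfolding d.core_decomposition_skel[OF L Q refl] pair_class_def by simp
  moreover have "card (vertices (d.comp e)) = card (vertices (H e))" if e: "e \<in> ?C" for e
  proof (rule card_vertices_iso[OF iso[OF e]])
    show "finite (white (H e))" "finite (black (H e))"
      using oH[OF e] by (auto simp: empty_graph_def open_graph_def partial_graph_def)
  qed
  then have "card (vertices G) = size_opt Q + (\<Sum>e \<in> ?C. card (vertices (H e)))"
    using d.card_vertices_G size_skel[OF Q] by simp
  moreover have "fst (core_decomposition D L (G, (w, c, b))) = Q"
    using d.core_decomposition_skel[OF L Q refl] by simp
  ultimately show thesis using that[OF R] by simp
qed

lemma core_decomposition_surj:
  assumes D: "2 \<le> D" and k: "1 \<le> k" and L: "canonical_listing D L" and QHs: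
    "(Q, Hs) \<in> core_pairs D L k \<delta>"
  shows "\<exists>R \<in> rooted_graphs D k \<delta>. pair_class D (core_decomposition D L R) = pair_class D (Q, Hs)"
proof -
  obtain p where rg: "\<And>R. Q = Some R \<Longrightarrow> rooted_graph D R" and mf: "melon_free D Q" and p: "size_opt Q =
    2 * p"
    and deg: "degree_opt D Q = int \<delta>" and len: "length Hs = (D + 1) * p + 1"
    and mel: "\<And>H. H \<in> set Hs \<Longrightarrow> possibly_empty_open_melonic D H" and fit: "colours_fit D L Q Hs"
    and sum: "2 * p + (\<Sum>H \<leftarrow> Hs. card (vertices H)) = 2 * k"
    using QHs by (auto simp: core_pairs_def)
  \<comment> \<open>With an empty core all vertices lie in the single component, and
    \<open>1 \<le> k\<close> makes it nonempty.\<close>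
  have single: "\<exists>H. Hs = [H] \<and> H \<noteq> empty_graph \<and> open_graph D H" if "Q = None"
  proof -
    have p0: "p = 0" using p that by (simp add: size_opt_def)
    then obtain H where H: "Hs = [H]" using len by (auto simp: length_Suc_conv)
    then have "card (vertices H) \<noteq> 0" using sum p0 k by simp
    then have "H \<noteq> empty_graph" by (auto simp: empty_graph_def vertices_def Plus_def)
    then show ?thesis using mel[of H] H by (simp add: possibly_empty_open_melonic_def open_melonic_def)
  qed
  \<comment> \<open>An empty core has no root edge; its component supplies the colour.\<close>
  define c where "c = (case Q of None \<Rightarrow> open_colour D (hd Hs) | Some R \<Rightarrow> fst (snd (snd R)))"
  have Q: "valid_core D c Q"
  proof (cases Q)
    case None
    then obtain H where H: "Hs = [H]" "open_graph D H" using single by blast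
    obtain w l b where "free_white D H = {(w, l)}" by (rule rooted_cl_graph[OF H(2)])
    moreover from this have "l \<le> D" by (auto simp: free_white_def)
    ultimately show ?thesis using None H(1) by (simp add: valid_core_def c_def open_colour_def)
  next
    case (Some R)
    then have "rooted_graph D R" using rg by simp
    then have "fst (snd (snd R)) \<le> D" using rooted_cover(1,4)[of D "fst R" "snd R"] by auto
    then show ?thesis using Some rg by (simp add: valid_core_def c_def)
  qed
  note pl = places_skel[OF L Q]
  have "length (places L c Q) = length Hs" using length_places[OF L Q] p len by auto
  then obtain H where HsH: "map H (places L c Q) = Hs" using exists_map_eq[OF pl(2)] by blast
  have "list_all2 (\<lambda>e K. K = empty_graph \<or> open_colour D K = fst (snd e)) (places L c Q) Hs"
  proof (cases Q)
    case None
    then show ?thesis using single by (auto simp: places_def c_def)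
  next
    case (Some R)
    have "list_all2 (\<lambda>k K. K = empty_graph \<or> open_colour D K = k) (map colour (snd R # snd R # L R)) Hs"
      using fit Some unfolding list_all2_map1 by (simp add: colours_fit_def)
    moreover have "map colour (snd R # snd R # L R) = map (\<lambda>e. fst (snd e)) (places L c Q)"
      using Some by (auto simp: places_def colour_def lift_def case_prod_beta)
    ultimately show ?thesis by (simp add: list_all2_map1)
  qed
  then have col: "H e = empty_graph \<or> open_colour D (H e) = fst (snd e)" if "e \<in> skel c Q" for e
    using that unfolding HsH[symmetric] list_all2_map2 list_all2_same pl(1) by blast
  have mel': "possibly_empty_open_melonic D (H e)" if "e \<in> skel c Q" for e
    using mel that unfolding HsH[symmetric] pl(1)[symmetric] by simp
  have ne: "H (None, c, None) \<noteq> empty_graph" if "Q = None"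
    using single[OF that] HsH that by (auto simp: places_def)
  obtain G w b where R: "rooted_graph D (G, (w, c, b))"
    and Q_eq: "fst (core_decomposition D L (G, (w, c, b))) = Q"
    and R2: "pair_class D (core_decomposition D L (G, (w, c, b))) =
      pair_class D (Q, map H (places L c Q))"
    "card (vertices G) = size_opt Q + (\<Sum>e \<in> skel c Q. card (vertices (H e)))"
    by (rule exists_core_decomposition[OF D L Q mf mel' col ne])
  have "(\<Sum>H \<leftarrow> Hs. card (vertices H)) = (\<Sum>e \<in> skel c Q. card (vertices (H e)))"
    unfolding HsH[symmetric] using pl by (simp add: sum_list_distinct_conv_sum_set o_def)
  then have "card (vertices G) = 2 * k" using R2(2) p sum by simp
  moreover have "degree D G = int \<delta>"
  proof -
    \<comment> \<open>Some decomposition of \<open>G\<close> has a core of the same degree as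
      \<open>G\<close>. This core is also the first entry of \<open>core_decomposition\<close>,
      hence equal to \<open>Q\<close>.\<close>
    obtain Q' F' where Q': "valid_core D c Q'" "decomposed D G w c b (skel c Q') F'"
      "degree_opt D Q' = degree D G"
      by (rule exists_decomposed[OF D R])
    have "Q' = Q" using Q_eq unfolding decomposed.core_decomposition_skel[OF Q'(2) L Q'(1) refl] by simp
    then show ?thesis using Q'(3) deg by simp
  qed
  ultimately show ?thesis using R R2 HsH
    by (intro bexI[of _ "(G, (w, c, b))"]) (simp_all add: rooted_graphs_def)
qed

theorem theorem4:
  fixes D k \<delta> :: nat and L :: "rgraph \<Rightarrow> edge list"
  assumes "3 \<le> D" and "1 \<le> k" and "canonical_listing D L"
  shows "(\<lambda>R. pair_class D (core_decomposition D L R)) respects rooted_iso D \<and>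
    bij_betw (\<lambda>X. the_elem ((\<lambda>R. pair_class D (core_decomposition D L R)) ` X))
      (rooted_graphs D k \<delta> // rooted_iso D)
      (pair_class D ` core_pairs D L k \<delta>)"
proof
  have D: "2 \<le> D" using assms(1) by simp
  note L = assms(3)
  let ?F = "\<lambda>R. pair_class D (core_decomposition D L R)"
  show resp: "?F respects rooted_iso D"
    unfolding congruent_def using core_decomposition_respects[OF D L] by blast
  \<comment> \<open>On a class the map is constant, so its image is a singleton and
    \<open>the_elem\<close> returns the value at any representative.\<close>
  have F: "the_elem (?F ` (rooted_iso D `` {R})) = ?F R" if "rooted_graph D R" for R
  proof -
    have "?F ` (rooted_iso D `` {R}) = (\<lambda>_. ?F R) ` (rooted_iso D `` {R})"
    proof (rule image_cong[OF refl])
      fix R' assume "R' \<in> rooted_iso D `` {R}"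
      then have "(R, R') \<in> rooted_iso D" by simp
      then show "?F R' = ?F R" by (rule core_decomposition_respects[OF D L, symmetric])
    qed
    also have "\<dots> = {?F R}"
      using that by (intro image_constant[of R] equiv_class_self[OF equiv_rooted_iso]) simp
    finally have "?F ` (rooted_iso D `` {R}) = {?F R}" .
    then show ?thesis by simp
  qed
  have rg: "rooted_graph D R" if "R \<in> rooted_graphs D k \<delta>" for R using that
    by (simp add: rooted_graphs_def)
  show "bij_betw (\<lambda>X. the_elem (?F ` X)) (rooted_graphs D k \<delta> // rooted_iso D) (pair_class D `
    core_pairs D L k \<delta>)"
    unfolding bij_betw_def
  proof
    show "inj_on (\<lambda>X. the_elem (?F ` X)) (rooted_graphs D k \<delta> // rooted_iso D)"
    proof (rule inj_onI)
      fix X Y assume "X \<in> rooted_graphs D k \<delta> // rooted_iso D" "Y \<in> rooted_graphs D k \<delta> // rooted_iso D"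
        and eq: "the_elem (?F ` X) = the_elem (?F ` Y)"
      then obtain R R' where R: "R \<in> rooted_graphs D k \<delta>" "X = rooted_iso D `` {R}"
        and R': "R' \<in> rooted_graphs D k \<delta>" "Y = rooted_iso D `` {R'}" by (auto simp: quotient_image)
      have "?F R = ?F R'" using eq F rg R R' by simp
      then have "(R, R') \<in> rooted_iso D" using core_decomposition_inj[OF D L] rg R(1) R'(1) by blast
      then show "X = Y" unfolding R R' by (rule equiv_class_eq[OF equiv_rooted_iso])
    qed
    have "(\<lambda>X. the_elem (?F ` X)) ` (rooted_graphs D k \<delta> // rooted_iso D) = ?F ` rooted_graphs D k \<delta>"
      unfolding quotient_image image_image using F rg by (intro image_cong) auto
    also have "\<dots> = pair_class D ` core_pairs D L k \<delta>"
    proof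
      show "?F ` rooted_graphs D k \<delta> \<subseteq> pair_class D ` core_pairs D L k \<delta>"
      proof
        fix z assume "z \<in> ?F ` rooted_graphs D k \<delta>"
        then obtain R where R: "R \<in> rooted_graphs D k \<delta>" "z = ?F R" by blast
        obtain G w c b where G: "R = (G, (w, c, b))" by (cases R)
        have rG: "rooted_graph D (G, (w, c, b))" "card (vertices G) = 2 * k" "degree D G = int \<delta>"
          using R(1) G by (simp_all add: rooted_graphs_def)
        obtain Q F where Q: "valid_core D c Q" "decomposed D G w c b (skel c Q) F" "degree_opt D Q =
          degree D G"
          by (rule exists_decomposed[OF D rG(1)])
        have "core_decomposition D L R \<in> core_pairs D L k \<delta>"
          unfolding G by (rule decomposed.core_decomposition_in_core_pairs[OF Q(2) L Q(1) refl Q(3)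
            rG(2,3)])
        then show "z \<in> pair_class D ` core_pairs D L k \<delta>" using R(2) by blast
      qed
      show "pair_class D ` core_pairs D L k \<delta> \<subseteq> ?F ` rooted_graphs D k \<delta>"
      proof
        fix z assume "z \<in> pair_class D ` core_pairs D L k \<delta>"
        then obtain Q Hs where z: "z = pair_class D (Q, Hs)" "(Q, Hs) \<in> core_pairs D L k \<delta>" by auto
        show "z \<in> ?F ` rooted_graphs D k \<delta>"
          using core_decomposition_surj[OF D assms(2) L z(2)] unfolding z(1)
            by (metis (no_types, lifting) image_eqI)
      qed
    qed
    finally show "(\<lambda>X. the_elem (?F ` X)) ` (rooted_graphs D k \<delta> // rooted_iso D) =
      pair_class D ` core_pairs D L k \<delta>" .
  qed
qed

end
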